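(* Let $\mathcal{H}$ be a Hilbert space and let $F:\mathcal{B}(\mathbb{R})\to\mathcal{L}_s^+(\mathcal{H})$ be a normalized POVM. Then $F$ is commutative if and only if there exist a bounded self-adjoint operator $A=\int\lambda\,dE_\lambda$ on $\mathcal{H}$ (where $E$ is the spectral measure of $A$) with spectrum $\sigma(A)\subset[0,1]$, and a strong Markov kernel $(\mu,E,\Gamma\subset\sigma(A))$, such that: 1) $\mu_\Delta(\cdot):\sigma(A)\to[0,1]$ is continuous for each $\Delta\in\mathcal{R}(\mathcal{S})$; 2) $F(\Delta)=\int_\Gamma\mu_\Delta(\lambda)\,dE_\lambda$ for every $\Delta\in\mathcal{B}(\mathbb{R})$; 3) $\mu$ separates the points of $\Gamma$. Moreover, $\mu:\Gamma\times\mathcal{B}(\mathbb{R})\to[0,1]$ is a Feller Markov kernel.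
   Context: $\mathcal{B}(\mathbb{R})$ is the Borel $\sigma$-algebra of $\mathbb{R}$; $\mathcal{L}_s^+(\mathcal{H})$ is the set of positive bounded self-adjoint operators on $\mathcal{H}$; $\mathbf{1}$ is the identity operator. A POVM (semispectral measure) is a map $F:\mathcal{B}(\mathbb{R})\to\mathcal{L}_s^+(\mathcal{H})$ with $F(\bigcup_n\Delta_n)=\sum_nF(\Delta_n)$ for every countable family of pairwise disjoint Borel sets, the series converging in the weak operator topology. It is normalized if $F(\mathbb{R})=\mathbf{1}$, and commutative if $F(\Delta_1)F(\Delta_2)=F(\Delta_2)F(\Delta_1)$ for all $\Delta_1,\Delta_2\in\mathcal{B}(\mathbb{R})$. A PVM (spectral measure) is a normalized POVM whose values are orthogonal projections. For $\Lambda\subset\mathbb{R}$, a Markov kernel is a map $\mu:\Lambda\times\mathcal{B}(\mathbb{R})\to[0,1]$, $(\lambda,\Delta)\mapsto\mu_\Delta(\lambda)$, such that $\mu_\Delta(\cdot)$ is Borel measurable for each $\Delta$ and $\mu_{(\cdot)}(\lambda)$ is a probability measure for each $\lambda\in\Lambda$. Let $E$ be a PVM on $\mathcal{B}(\Lambda)$. A map $\mu:\Lambda\times\mathcal{B}(\mathbb{R})\to[0,1]$ is a weak Markov kernel with respect to $E$ if $\mu_\Delta(\cdot)$ is Borel measurable for each $\Delta\in\mathcal{B}(\mathbb{R})$ and, for each measure $\nu_x=\langle E(\cdot)x,x\rangle$, $x\in\mathcal{H}$: $0\le\mu_\Delta(\lambda)\le1$ $\nu_x$-a.e.; $\mu_{\mathbb{R}}(\lambda)=1$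 and $\mu_\emptyset(\lambda)=0$ $\nu_x$-a.e.; and for every sequence of pairwise disjoint Borel sets $\Delta_i$, $\sum_i\mu_{\Delta_i}(\lambda)=\mu_{\cup_i\Delta_i}(\lambda)$ $\nu_x$-a.e. (the exceptional null set may depend on the sequence). A strong Markov kernel $(\mu,E,\Gamma\subset\Lambda)$ is a weak Markov kernel $\mu:\Lambda\times\mathcal{B}(\mathbb{R})\to[0,1]$ with respect to $E$ together with a (Borel) set $\Gamma\subset\Lambda$ with $E(\Gamma)=\mathbf{1}$ such that the restriction $\mu:\Gamma\times\mathcal{B}(\mathbb{R})\to[0,1]$ is a Markov kernel. A Markov kernel $\mu:\Lambda\times\mathcal{B}(\mathbb{R})\to[0,1]$ is Feller if for every bounded continuous $f:\mathbb{R}\to\mathbb{R}$ the function $G(\lambda)=\int_{\mathbb{R}}f(t)\,d\mu_t(\lambda)$ (integral of $f$ with respect to the probability measure $\mu_{(\cdot)}(\lambda)$) is bounded and continuous on $\Lambda$. $\mu$ separates the points of $\Gamma$ if for all $\lambda\ne\lambda'$ in $\Gamma$ there is $\Delta\in\mathcal{B}(\mathbb{R})$ with $\mu_\Delta(\lambda)\ne\mu_\Delta(\lambda')$. $\mathcal{S}$ is the family of open intervals in $\mathbb{R}$ with rational end-points, and $\mathcal{R}(\mathcal{S})$ is the ring of sets generated by $\mathcal{S}$. *)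

theory Defs
  imports "HOL-Analysis.Analysis"
begin

section \<open>Complex Hilbert spaces\<close>

class scaleC = scaleR +
  fixes scaleC :: "complex \<Rightarrow> 'a \<Rightarrow> 'a"  (infixr "*\<^sub>C" 75)
  assumes scaleR_scaleC: "r *\<^sub>R x = complex_of_real r *\<^sub>C x"

class complex_vector = scaleC + ab_group_add +
  assumes scaleC_add_right: "c *\<^sub>C (x + y) = c *\<^sub>C x + c *\<^sub>C y"
    and scaleC_add_left: "(c + d) *\<^sub>C x = c *\<^sub>C x + d *\<^sub>C x"
    and scaleC_scaleC: "c *\<^sub>C (d *\<^sub>C x) = (c * d) *\<^sub>C x"
    and scaleC_one: "1 *\<^sub>C x = x"

text \<open>The real part of a complex inner product is a real inner product inducing the same norm,
  so basing the class on \<open>real_inner\<close> is no restriction; positive definiteness and the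
  norm come from there. The inner product is linear in its first argument.\<close>

class complex_inner = complex_vector + real_inner +
  fixes cinner :: "'a \<Rightarrow> 'a \<Rightarrow> complex"
  assumes cinner_commute: "cinner x y = cnj (cinner y x)"
    and cinner_add_left: "cinner (x + y) z = cinner x z + cinner y z"
    and cinner_scaleC_left: "cinner (c *\<^sub>C x) y = c * cinner x y"
    and inner_eq_Re_cinner: "inner x y = Re (cinner x y)"

class chilbert_space = complex_inner + complete_space

instantiation complex :: chilbert_space
begin

definition scaleC_complex :: "complex \<Rightarrow> complex \<Rightarrow> complex"
  where "scaleC_complex c x = c * x"

definition cinner_complex :: "complex \<Rightarrow> complex \<Rightarrow> complex"
  where "cinner_complex x y = x * cnj y"

instance
  by standard
    (auto simp: scaleC_complex_def cinner_complex_def scaleR_conv_of_real algebra_simps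
      inner_complex_def)

end


section \<open>Bounded operators\<close>

definition bounded_clinear :: "('a::complex_inner \<Rightarrow> 'a) \<Rightarrow> bool"
  where "bounded_clinear T \<longleftrightarrow> bounded_linear T \<and> (\<forall>c x. T (c *\<^sub>C x) = c *\<^sub>C T x)"

definition selfadjoint_op :: "('a::complex_inner \<Rightarrow> 'a) \<Rightarrow> bool"
  where "selfadjoint_op T \<longleftrightarrow> bounded_clinear T \<and> (\<forall>x y. cinner (T x) y = cinner x (T y))"

text \<open>For self-adjoint \<open>T\<close> the number \<open>cinner (T x) x\<close> is real, hence the use of \<open>Re\<close>.\<close>

definition positive_op :: "('a::complex_inner \<Rightarrow> 'a) \<Rightarrow> bool"
  where "positive_op T \<longleftrightarrow> selfadjoint_op T \<and> (\<forall>x. 0 \<le> Re (cinner (T x) x))"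

definition orthogonal_projection :: "('a::complex_inner \<Rightarrow> 'a) \<Rightarrow> bool"
  where "orthogonal_projection P \<longleftrightarrow> selfadjoint_op P \<and> P \<circ> P = P"

definition spectrum :: "('a::complex_inner \<Rightarrow> 'a) \<Rightarrow> complex set"
  where "spectrum T =
    {z. \<not> (\<exists>R. bounded_clinear R \<and>
        R \<circ> (\<lambda>x. T x - z *\<^sub>C x) = id \<and> (\<lambda>x. T x - z *\<^sub>C x) \<circ> R = id)}"

text \<open>The spectrum of a self-adjoint operator is real; this is that set as a subset of the
  type \<^typ>\<open>real\<close>.\<close>

definition real_spectrum :: "('a::complex_inner \<Rightarrow> 'a) \<Rightarrow> real set"
  where "real_spectrum T = {r. complex_of_real r \<in> spectrum T}"


section \<open>Operator-valued measures\<close>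

text \<open>Only \<open>space M\<close> and \<open>sets M\<close> matter here: \<open>M\<close> is \<open>borel\<close> for measures on the Borel sets of
  the line and \<open>restrict_space borel \<Lambda>\<close> for measures on the Borel sets of \<open>\<Lambda>\<close>.\<close>

definition povm :: "'b measure \<Rightarrow> ('b set \<Rightarrow> 'a::complex_inner \<Rightarrow> 'a) \<Rightarrow> bool"
  where "povm M F \<longleftrightarrow>
    (\<forall>\<Delta>\<in>sets M. positive_op (F \<Delta>)) \<and>
    (\<forall>D :: nat \<Rightarrow> 'b set. range D \<subseteq> sets M \<longrightarrow> disjoint_family D \<longrightarrow>
      (\<forall>x y. (\<lambda>n. cinner (F (D n) x) y) sums cinner (F (\<Union>n. D n) x) y))"

definition normalized_povm :: "'b measure \<Rightarrow> ('b set \<Rightarrow> 'a::complex_inner \<Rightarrow> 'a) \<Rightarrow> bool"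
  where "normalized_povm M F \<longleftrightarrow> povm M F \<and> F (space M) = id"

definition commutative_povm :: "'b measure \<Rightarrow> ('b set \<Rightarrow> 'a::complex_inner \<Rightarrow> 'a) \<Rightarrow> bool"
  where "commutative_povm M F \<longleftrightarrow>
    povm M F \<and> (\<forall>\<Delta>\<^sub>1\<in>sets M. \<forall>\<Delta>\<^sub>2\<in>sets M. F \<Delta>\<^sub>1 \<circ> F \<Delta>\<^sub>2 = F \<Delta>\<^sub>2 \<circ> F \<Delta>\<^sub>1)"

definition pvm :: "'b measure \<Rightarrow> ('b set \<Rightarrow> 'a::complex_inner \<Rightarrow> 'a) \<Rightarrow> bool"
  where "pvm M E \<longleftrightarrow> normalized_povm M E \<and> (\<forall>\<Delta>\<in>sets M. orthogonal_projection (E \<Delta>))"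

text \<open>The scalar measure \<open>\<nu>\<^sub>x = \<langle>E(\<cdot>)x, x\<rangle>\<close>.\<close>

definition scalar_measure ::
    "'b measure \<Rightarrow> ('b set \<Rightarrow> 'a::complex_inner \<Rightarrow> 'a) \<Rightarrow> 'a \<Rightarrow> 'b measure"
  where "scalar_measure M E x =
    measure_of (space M) (sets M) (\<lambda>\<Delta>. ennreal (Re (cinner (E \<Delta> x) x)))"

text \<open>\<open>T = \<integral>\<^sub>S f dE\<close> in the weak sense; over the complex numbers a bounded operator is determined
  by its quadratic form.\<close>

definition has_op_integral ::
    "'b measure \<Rightarrow> ('b set \<Rightarrow> 'a::complex_inner \<Rightarrow> 'a) \<Rightarrow> 'b set \<Rightarrow> ('b \<Rightarrow> real) \<Rightarrow> ('a \<Rightarrow> 'a) \<Rightarrow> bool"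
  where "has_op_integral M E S f T \<longleftrightarrow>
    bounded_clinear T \<and>
    (\<forall>x. set_integrable (scalar_measure M E x) S f \<and>
      cinner (T x) x = complex_of_real (LINT l:S|scalar_measure M E x. f l))"

definition spectral_measure_of ::
    "('a::complex_inner \<Rightarrow> 'a) \<Rightarrow> (real set \<Rightarrow> 'a \<Rightarrow> 'a) \<Rightarrow> bool"
  where "spectral_measure_of A E \<longleftrightarrow>
    pvm (restrict_space borel (real_spectrum A)) E \<and>
    has_op_integral (restrict_space borel (real_spectrum A)) E (real_spectrum A) (\<lambda>l. l) A"


section \<open>Markov kernels\<close>

text \<open>A kernel is written \<open>\<mu> \<Delta> l\<close> for \<open>\<mu>\<^sub>\<Delta>(l)\<close>; only its values for Borel \<open>\<Delta>\<close> and \<open>l \<in> \<Lambda>\<close> matter.\<close>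

definition markov_kernel :: "real set \<Rightarrow> (real set \<Rightarrow> real \<Rightarrow> real) \<Rightarrow> bool"
  where "markov_kernel \<Lambda> \<mu> \<longleftrightarrow>
    (\<forall>\<Delta>\<in>sets borel. \<forall>l\<in>\<Lambda>. 0 \<le> \<mu> \<Delta> l \<and> \<mu> \<Delta> l \<le> 1) \<and>
    (\<forall>\<Delta>\<in>sets borel. \<mu> \<Delta> \<in> borel_measurable (restrict_space borel \<Lambda>)) \<and>
    (\<forall>l\<in>\<Lambda>. measure_space UNIV (sets borel) (\<lambda>\<Delta>. ennreal (\<mu> \<Delta> l)) \<and> \<mu> UNIV l = 1)"

definition weak_markov_kernel ::
    "real set \<Rightarrow> (real set \<Rightarrow> 'a::complex_inner \<Rightarrow> 'a) \<Rightarrow> (real set \<Rightarrow> real \<Rightarrow> real) \<Rightarrow> bool"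
  where "weak_markov_kernel \<Lambda> E \<mu> \<longleftrightarrow>
    pvm (restrict_space borel \<Lambda>) E \<and>
    (\<forall>\<Delta>\<in>sets borel. \<forall>l\<in>\<Lambda>. 0 \<le> \<mu> \<Delta> l \<and> \<mu> \<Delta> l \<le> 1) \<and>
    (\<forall>\<Delta>\<in>sets borel. \<mu> \<Delta> \<in> borel_measurable (restrict_space borel \<Lambda>)) \<and>
    (\<forall>x. let \<nu> = scalar_measure (restrict_space borel \<Lambda>) E x in
      (\<forall>\<Delta>\<in>sets borel. AE l in \<nu>. 0 \<le> \<mu> \<Delta> l \<and> \<mu> \<Delta> l \<le> 1) \<and>
      (AE l in \<nu>. \<mu> UNIV l = 1) \<and>
      (AE l in \<nu>. \<mu> {} l = 0) \<and>
      (\<forall>D :: nat \<Rightarrow> real set. range D \<subseteq> sets borel \<longrightarrow> disjoint_family D \<longrightarrow>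
        (AE l in \<nu>. (\<lambda>i. \<mu> (D i) l) sums \<mu> (\<Union>i. D i) l)))"

definition strong_markov_kernel ::
    "(real set \<Rightarrow> real \<Rightarrow> real) \<Rightarrow> (real set \<Rightarrow> 'a::complex_inner \<Rightarrow> 'a) \<Rightarrow> real set \<Rightarrow> real set \<Rightarrow> bool"
  where "strong_markov_kernel \<mu> E \<Gamma> \<Lambda> \<longleftrightarrow>
    weak_markov_kernel \<Lambda> E \<mu> \<and>
    \<Gamma> \<subseteq> \<Lambda> \<and> \<Gamma> \<in> sets borel \<and> E \<Gamma> = id \<and>
    markov_kernel \<Gamma> \<mu>"

definition kernel_measure :: "(real set \<Rightarrow> real \<Rightarrow> real) \<Rightarrow> real \<Rightarrow> real measure"
  where "kernel_measure \<mu> l = measure_of UNIV (sets borel) (\<lambda>\<Delta>. ennreal (\<mu> \<Delta> l))"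

definition feller_markov_kernel :: "real set \<Rightarrow> (real set \<Rightarrow> real \<Rightarrow> real) \<Rightarrow> bool"
  where "feller_markov_kernel \<Lambda> \<mu> \<longleftrightarrow>
    markov_kernel \<Lambda> \<mu> \<and>
    (\<forall>f :: real \<Rightarrow> real. continuous_on UNIV f \<longrightarrow> bounded (range f) \<longrightarrow>
      bounded ((\<lambda>l. LINT t|kernel_measure \<mu> l. f t) ` \<Lambda>) \<and>
      continuous_on \<Lambda> (\<lambda>l. LINT t|kernel_measure \<mu> l. f t))"

definition separates_points :: "(real set \<Rightarrow> real \<Rightarrow> real) \<Rightarrow> real set \<Rightarrow> bool"
  where "separates_points \<mu> \<Gamma> \<longleftrightarrow>
    (\<forall>l\<in>\<Gamma>. \<forall>l'\<in>\<Gamma>. l \<noteq> l' \<longrightarrow> (\<exists>\<Delta>\<in>sets borel. \<mu> \<Delta> l \<noteq> \<mu> \<Delta> l'))"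


section \<open>The ring generated by the rational intervals\<close>

definition rational_intervals :: "real set set"
  where "rational_intervals = {{a<..<b} | a b. a \<in> \<rat> \<and> b \<in> \<rat> \<and> a < b}"

definition rational_ring :: "real set set"
  where "rational_ring = ring_of_sets UNIV hull rational_intervals"

end

theory Submission
  imports Defs "HOL-Probability.Probability"
begin

text \<open>Let \<open>F\<close> be commutative and let \<open>W\<close> be the self-adjoint part of its bicommutant, a commutative algebra closed
  under bounded strong limits. For a countable family \<open>K\<close> of Borel sets every \<open>F(\<Delta>)\<close>, \<open>\<Delta> \<in> K\<close>, has a
  binary expansion \<open>\<Sum>\<^sub>k 2\<^sup>-\<^sup>k\<^sup>-\<^sup>1 Q\<close> with digits that are spectral projections in \<open>W\<close>. Enumerate all these digits
  as \<open>Q\<^sub>m\<close> and put \<open>A = \<Sum>\<^sub>m 2\<cdot>3\<^sup>-\<^sup>m\<^sup>-\<^sup>1 Q\<^sub>m\<close>. The spectrum of \<open>A\<close> lies in the Cantor set, where the ternary digits are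
  continuous functions recovering the \<open>Q\<^sub>m\<close>; hence \<open>F(\<Delta>) = \<psi>\<^sub>\<Delta>(A)\<close> with \<open>\<psi>\<^sub>\<Delta>\<close> continuous. As the binary digits of
  \<open>\<psi>\<^sub>\<Delta>(l)\<close> are almost everywhere the ternary digits of \<open>l\<close>, the \<open>\<psi>\<^sub>\<Delta>\<close> separate points. Taking for \<open>K\<close> the rational ring
  together with the rational half-lines, the values \<open>\<psi>\<close> on half-lines are almost everywhere a distribution
  function and give the Markov kernel.

  Conversely, integrals with respect to one spectral measure commute. The Feller property is weak
  convergence of the kernel measures: convergence on rational intervals bounds the distribution functions
  from both sides at continuity points.\<close>

section \<open>Symmetric operators\<close>

text \<open>All operator theory runs over the real inner product with symmetric real-linear
  operators; complex homogeneity is recovered at the end, because multiplication by a scalar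
  commutes with \<open>F\<close> and hence with every member of the bicommutant. Base 3 with the
  digits 0 and 2 answers the demand for continuity: binary digits are discontinuous functions of the
  spectral variable, whereas on the Cantor set a ternary digit is locally constant, thanks to the
  gap between 1/3 and 2/3. The second obstacle is that the kernel measures agree with the continuous
  functions only almost everywhere, while continuity is asked on the whole spectrum. Therefore the
  kernel is patched together: the continuous function for members of \<open>K\<close>, the measure
  for all other Borel sets, and \<Gamma> lies within the set where the two agree on
  \<open>K\<close>.\<close>

instance chilbert_space \<subseteq> banach ..

text \<open>The imaginary part is the real inner product with \<open>\<i> *\<^sub>C y\<close>, so an
  identity between real inner products with arbitrary second vector carries over to
  \<open>cinner\<close>.\<close>

lemma cinner_conv_inner: "cinner x y = Complex (inner x y) (inner x (\<i> *\<^sub>C y))"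
proof -
  have "cinner x (\<i> *\<^sub>C y) = cnj (\<i> * cinner y x)"
    by (metis cinner_commute cinner_scaleC_left)
  also have "\<dots> = - \<i> * cinner x y"
    using cinner_commute[of x y] by simp
  finally show ?thesis
    by (simp add: complex_eq_iff inner_eq_Re_cinner)
qed

lemma cinner_scaleC_right: "cinner x (c *\<^sub>C y) = cnj c * cinner x y"
  by (metis cinner_commute cinner_scaleC_left complex_cnj_mult)

lemma cinner_self: "cinner x x = complex_of_real ((norm x)\<^sup>2)"
proof -
  have "Im (cinner x x) = 0"
    using arg_cong[OF cinner_commute[of x x], of Im] by simp
  then show ?thesis
    by (simp add: complex_eq_iff power2_norm_eq_inner inner_eq_Re_cinner)
qed

lemma norm_scaleC: "norm (c *\<^sub>C x) = cmod c * norm (x :: 'a :: complex_inner)"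
proof -
  have "complex_of_real ((norm (c *\<^sub>C x))\<^sup>2) = (c * cnj c) * complex_of_real ((norm x)\<^sup>2)"
    by (simp only: cinner_self [symmetric] cinner_scaleC_left cinner_scaleC_right mult_ac)
  also have "\<dots> = complex_of_real ((cmod c * norm x)\<^sup>2)"
    unfolding power_mult_distrib of_real_mult by (subst complex_norm_square) simp
  finally have "(norm (c *\<^sub>C x))\<^sup>2 = (cmod c * norm x)\<^sup>2"
    by (simp only: of_real_eq_iff)
  then show ?thesis
    by (simp add: power2_eq_iff_nonneg)
qed

lemma bounded_linear_scaleC: "bounded_linear (\<lambda>x :: 'a :: complex_inner. c *\<^sub>C x)"
  by (rule bounded_linear_intro[where K = "cmod c"])
    (simp_all add: scaleC_add_right scaleR_scaleC scaleC_scaleC norm_scaleC mult.commute)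

lemma scaleC_diff_right: "c *\<^sub>C (x - y) = c *\<^sub>C x - c *\<^sub>C (y :: 'a :: complex_inner)"
  by (rule linear_diff) (rule bounded_linear.linear[OF bounded_linear_scaleC])

text \<open>Real linear on purpose: the arguments on squares, cuts and digits see the real inner
  product alone, and \<open>selfadjoint_op_iff\<close> adds complex homogeneity as a separate
  condition.\<close>

definition symmetric_op :: "('a :: real_inner \<Rightarrow> 'a) \<Rightarrow> bool"
  where "symmetric_op T \<longleftrightarrow> bounded_linear T \<and> (\<forall>x y. inner (T x) y = inner x (T y))"

lemma symmetric_opD:
  assumes "symmetric_op T"
  shows "bounded_linear T" "inner (T x) y = inner x (T y)"
  using assms by (auto simp: symmetric_op_def)

lemma symmetric_op_linear:
  assumes "symmetric_op T"
  shows "T (x + y) = T x + T y" "T (x - y) = T x - T y" "T (r *\<^sub>R x) = r *\<^sub>R T x"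
    "T (- x) = - T x" "T 0 = 0"
  using symmetric_opD(1)[OF assms, THEN bounded_linear.linear]
  by (auto simp: linear_add linear_diff linear_scale linear_neg linear_0)

lemma selfadjoint_op_iff:
  "selfadjoint_op T \<longleftrightarrow> symmetric_op T \<and> (\<forall>c x. T (c *\<^sub>C x) = c *\<^sub>C T x)"
proof
  assume "selfadjoint_op T"
  then show "symmetric_op T \<and> (\<forall>c x. T (c *\<^sub>C x) = c *\<^sub>C T x)"
    by (auto simp: selfadjoint_op_def bounded_clinear_def symmetric_op_def inner_eq_Re_cinner)
next
  assume T: "symmetric_op T \<and> (\<forall>c x. T (c *\<^sub>C x) = c *\<^sub>C T x)"
  then have "cinner (T x) y = cinner x (T y)" for x y
    by (metis cinner_conv_inner symmetric_opD(2))
  with T show "selfadjoint_op T"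
    by (auto simp: selfadjoint_op_def bounded_clinear_def symmetric_op_def)
qed

lemma selfadjoint_op_cinner_self:
  assumes "selfadjoint_op T"
  shows "cinner (T x) x = complex_of_real (inner (T x) x)"
proof -
  have "cinner (T x) x = cnj (cinner (T x) x)"
    using assms by (metis cinner_commute selfadjoint_op_def)
  then have "Im (cinner (T x) x) = 0"
    by (simp add: complex_eq_iff)
  then show ?thesis
    by (simp add: complex_eq_iff inner_eq_Re_cinner)
qed

lemma positive_op_iff: "positive_op T \<longleftrightarrow> selfadjoint_op T \<and> (\<forall>x. 0 \<le> inner (T x) x)"
  by (simp add: positive_op_def inner_eq_Re_cinner)

lemma symmetric_op_polarization:
  assumes "symmetric_op T"
  shows "4 * inner (T x) y = inner (T (x + y)) (x + y) - inner (T (x - y)) (x - y)"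
  using symmetric_opD(2)[OF assms, of y x]
  by (simp add: symmetric_op_linear[OF assms] inner_simps inner_commute)

lemma symmetric_op_eqI:
  assumes "symmetric_op S" "symmetric_op T" "\<And>x. inner (S x) x = inner (T x) x"
  shows "S = T"
proof
  fix x
  have "inner (S x) y = inner (T x) y" for y
    using symmetric_op_polarization[OF assms(1), of x y]
      symmetric_op_polarization[OF assms(2), of x y] assms(3) by simp
  then show "S x = T x"
    by (metis inner_eq_zero_iff inner_diff_left right_minus_eq)
qed

text \<open>Polarization followed by the parallelogram law, with \<open>y\<close> along
  \<open>T x\<close> and scaled to the length of \<open>x\<close>, so that
  \<open>inner (T x) y\<close> is the product of the two norms.\<close>

lemma symmetric_op_norm_le:
  assumes T: "symmetric_op T" and q: "\<And>x. \<bar>inner (T x) x\<bar> \<le> c * (norm x)\<^sup>2"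
  shows "norm (T x) \<le> c * norm x"
proof (cases "x = 0 \<or> T x = 0")
  case True
  have "0 \<le> c * (norm x)\<^sup>2"
    using q[of x] by linarith
  with True show ?thesis
    by (cases "x = 0") (auto simp: symmetric_op_linear[OF T] zero_le_mult_iff)
next
  case False
  define y where "y = (norm x / norm (T x)) *\<^sub>R T x"
  have ny: "norm y = norm x"
    using False by (simp add: y_def)
  have "4 * inner (T x) y \<le> c * (norm (x + y))\<^sup>2 + c * (norm (x - y))\<^sup>2"
    using q[of "x + y"] q[of "x - y"] symmetric_op_polarization[OF T, of x y] by linarith
  also have "\<dots> = c * (2 * (norm x)\<^sup>2 + 2 * (norm y)\<^sup>2)"
    by (simp add: power2_norm_eq_inner inner_simps inner_commute algebra_simps)
  also have "\<dots> = 4 * (c * (norm x)\<^sup>2)"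
    by (simp add: ny)
  finally have "inner (T x) y \<le> c * (norm x)\<^sup>2"
    by simp
  also have "inner (T x) y = norm x * norm (T x)"
    using False by (simp add: y_def power2_norm_eq_inner [symmetric] power2_eq_square)
  finally show ?thesis
    using False by (simp add: power2_eq_square)
qed

lemma orthogonal_projection_iff:
  "orthogonal_projection P \<longleftrightarrow> selfadjoint_op P \<and> (\<forall>x. P (P x) = P x)"
  by (auto simp: orthogonal_projection_def fun_eq_iff)


section \<open>Commutative algebras of symmetric operators\<close>

definition positive_form :: "('a :: real_inner \<Rightarrow> 'a) \<Rightarrow> bool"
  where "positive_form T \<longleftrightarrow> (\<forall>x. 0 \<le> inner (T x) x)"

text \<open>The self-adjoint part of a commutative von Neumann algebra, seen as a real algebra. The
  constructions below leave finite algebra only through sequences of operators with a common bound,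
  and \<open>limit_mem\<close> keeps their strong limits inside.\<close>

locale comm_ops =
  fixes W :: "('a :: {real_inner, banach} \<Rightarrow> 'a) set"
  assumes sym: "T \<in> W \<Longrightarrow> symmetric_op T"
    and comm: "S \<in> W \<Longrightarrow> T \<in> W \<Longrightarrow> S (T x) = T (S x)"
    and id_mem: "(\<lambda>x. x) \<in> W"
    and add_mem: "S \<in> W \<Longrightarrow> T \<in> W \<Longrightarrow> (\<lambda>x. S x + T x) \<in> W"
    and scale_mem: "T \<in> W \<Longrightarrow> (\<lambda>x. r *\<^sub>R T x) \<in> W"
    and comp_mem: "S \<in> W \<Longrightarrow> T \<in> W \<Longrightarrow> (\<lambda>x. S (T x)) \<in> W"
    and limit_mem: "(\<And>n :: nat. X n \<in> W) \<Longrightarrow> (\<And>n x. norm (X n x) \<le> K * norm x) \<Longrightarrow>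
      (\<And>x. (\<lambda>n. X n x) \<longlonglongrightarrow> T x) \<Longrightarrow> T \<in> W"
begin

lemma lin:
  assumes "T \<in> W"
  shows "T (x + y) = T x + T y" "T (x - y) = T x - T y" "T (r *\<^sub>R x) = r *\<^sub>R T x"
    "T (- x) = - T x" "T 0 = 0"
  using symmetric_op_linear[OF sym[OF assms]] by auto

lemma swap: "T \<in> W \<Longrightarrow> inner (T x) y = inner x (T y)"
  using sym symmetric_opD(2) by blast

lemma diff_mem: "S \<in> W \<Longrightarrow> T \<in> W \<Longrightarrow> (\<lambda>x. S x - T x) \<in> W"
  using add_mem[of S "\<lambda>x. (- 1) *\<^sub>R T x"] scale_mem[of T "- 1"] by simp

lemma zero_mem: "(\<lambda>x. 0) \<in> W"
  using scale_mem[OF id_mem, of 0] by simp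

lemma tendsto_op:
  assumes "T \<in> W" "f \<longlonglongrightarrow> x"
  shows "(\<lambda>n. T (f n)) \<longlonglongrightarrow> T x"
  using bounded_linear.tendsto[OF symmetric_opD(1)[OF sym[OF assms(1)]] assms(2)] .

definition proj :: "('a \<Rightarrow> 'a) \<Rightarrow> bool"
  where "proj P \<longleftrightarrow> P \<in> W \<and> (\<forall>x. P (P x) = P x)"

lemma projD: "proj P \<Longrightarrow> P \<in> W" "proj P \<Longrightarrow> P (P x) = P x"
  by (auto simp: proj_def)

lemma proj_inner: "proj P \<Longrightarrow> inner (P x) x = (norm (P x))\<^sup>2"
  by (metis projD power2_norm_eq_inner swap)

lemma proj_norm_le: 
  assumes "proj P" shows "norm (P x) \<le> norm x"
proof -
  have "(norm (P x))\<^sup>2 \<le> norm (P x) * norm x"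
    using proj_inner[OF assms, of x] norm_cauchy_schwarz[of "P x" x] by simp
  then show ?thesis
    by (cases "P x = 0") (auto simp: power2_eq_square)
qed

lemma proj_compl: "proj P \<Longrightarrow> proj (\<lambda>x. x - P x)"
  by (auto simp: proj_def lin intro!: diff_mem id_mem)

lemma proj_zero: "proj (\<lambda>x. 0)"
  by (simp add: proj_def zero_mem)

lemma proj_pythagoras: "proj P \<Longrightarrow> (norm x)\<^sup>2 = (norm (P x))\<^sup>2 + (norm (x - P x))\<^sup>2"
  using proj_inner[of P x] proj_inner[OF proj_compl, of P x] 
  by (simp add: inner_simps power2_norm_eq_inner)

text \<open>Commuting with \<open>P\<close> makes \<open>T\<close> block diagonal, so the cross
  terms between the range of \<open>P\<close> and its complement vanish.\<close>

lemma inner_split: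
  assumes "proj P" "T \<in> W"
  shows "inner (T x) x = inner (T (P x)) (P x) + inner (T (x - P x)) (x - P x)"
proof -
  have "inner (T x) (P x) = inner (T (P x)) (P x)"
    by (simp add: comm[OF projD(1)[OF assms(1)] assms(2), symmetric]
        swap[OF projD(1)[OF assms(1)], symmetric] projD(2)[OF assms(1)])
  moreover have "inner (T (P x)) x = inner (T (P x)) (P x)"
    by (simp add: comm[OF assms(2) projD(1)[OF assms(1)]]
        swap[OF projD(1)[OF assms(1)]] projD(2)[OF assms(1)])
  ultimately show ?thesis
    by (simp add: inner_simps lin[OF assms(2)])
qed

text \<open>The identity \<open>inner (P n x) (P n x) = inner (P n x) x\<close> survives strong
  limits, and a symmetric operator is determined by its quadratic form.\<close>

lemma proj_limit:
  assumes P: "\<And>n :: nat. proj (P n)" and lim: "\<And>x. (\<lambda>n. P n x) \<longlonglongrightarrow> Q x"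
  shows "proj Q"
proof -
  have Q: "Q \<in> W"
    using projD(1)[OF P] proj_norm_le[OF P] by (intro limit_mem[where K = 1, OF _ _ lim]) auto
  have "inner (Q (Q x)) x = inner (Q x) x" for x
  proof -
    have "(\<lambda>n. inner (P n x) (P n x)) \<longlonglongrightarrow> inner (Q x) (Q x)"
      by (intro tendsto_intros lim)
    moreover have "(\<lambda>n. inner (P n x) x) \<longlonglongrightarrow> inner (Q x) x"
      by (intro tendsto_intros lim)
    ultimately have "inner (Q x) (Q x) = inner (Q x) x"
      using proj_inner[OF P] by (simp add: LIMSEQ_unique power2_norm_eq_inner)
    then show ?thesis
      using swap[OF Q, of "Q x" x] by simp
  qed
  then have "(\<lambda>x. Q (Q x)) = Q"
    by (rule symmetric_op_eqI[OF sym[OF comp_mem[OF Q Q]] sym[OF Q]])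
  then show ?thesis
    by (simp add: proj_def Q fun_eq_iff)
qed

text \<open>F. Riesz: \<open>A\<^sub>n\<^sub>+\<^sub>1 = A\<^sub>n - A\<^sub>n\<^sup>2\<close> writes a positive contraction as a sum of squares,
  \<open>A\<^sub>0 = \<Sum>A\<^sub>n\<^sup>2\<close>.\<close>

lemma positive_form_comp_contraction:
  assumes A: "A \<in> W" "positive_form A" "\<And>x. inner (A x) x \<le> (norm x)\<^sup>2"
    and B: "B \<in> W" "positive_form B"
  shows "positive_form (\<lambda>x. A (B x))"
  unfolding positive_form_def
proof
  fix x
  define X where "X = rec_nat A (\<lambda>_ T x. T x - T (T x))"
  have X: "X n \<in> W \<and> (\<forall>x. 0 \<le> inner (X n x) x \<and> inner (X n x) x \<le> (norm x)\<^sup>2)" for n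
  proof (induction n)
    case 0
    then show ?case
      using A by (auto simp: X_def positive_form_def)
  next
    case (Suc n)
    define T where "T = X n"
    have T: "T \<in> W" "\<And>x. 0 \<le> inner (T x) x" "\<And>x. inner (T x) x \<le> (norm x)\<^sup>2"
      using Suc by (auto simp: T_def)
    have S: "X (Suc n) = (\<lambda>x. T x - T (T x))"
      by (simp add: X_def T_def)
    \<comment> \<open>\<open>T - T\<^sup>2 = (1 - T) T (1 - T) + T (1 - T) T\<close>, and both
      summands have nonnegative form.\<close>
    have "inner (T x - T (T x)) x
        = inner (T (x - T x)) (x - T x) + ((norm (T x))\<^sup>2 - inner (T (T x)) (T x))" for x
      using swap[OF T(1), of "T x" x] swap[OF T(1), of "T (T x)" x]
      by (simp add: lin[OF T(1)] inner_simps power2_norm_eq_inner inner_commute)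
    then have "0 \<le> inner (T x - T (T x)) x" for x
      using T(2)[of "x - T x"] T(3)[of "T x"] by simp
    moreover have "inner (T x - T (T x)) x \<le> (norm x)\<^sup>2" for x
      using T(3)[of x] swap[OF T(1), of "T x" x] inner_ge_zero[of "T x"]
      unfolding inner_diff_left by linarith
    ultimately show ?case
      unfolding S using diff_mem[OF T(1) comp_mem[OF T(1) T(1)]] by blast
  qed
  have sum: "(\<Sum>k<n. X k (X k y)) = A y - X n y" for n y
    by (induction n) (auto simp: X_def)
  have XW: "X k \<in> W" for k
    using X by blast
  have sq: "(norm (X k z))\<^sup>2 = inner (X k (X k z)) z" for k z
    using swap[OF XW, of k "X k z" z] by (simp only: power2_norm_eq_inner)
  \<comment> \<open>The squares telescope to \<open>A - X n\<close>, so the squared norms at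
    \<open>B x\<close> are summable and the remainder \<open>X n (B x)\<close> tends to
    zero.\<close>
  have "summable (\<lambda>k. (norm (X k (B x)))\<^sup>2)"
  proof (rule summableI_nonneg_bounded)
    fix n
    have "(\<Sum>k<n. (norm (X k (B x)))\<^sup>2) = inner (\<Sum>k<n. X k (X k (B x))) (B x)"
      by (simp only: inner_sum_left sq)
    also have "\<dots> \<le> inner (A (B x)) (B x)"
      unfolding sum inner_diff_left using X[of n] by simp
    finally show "(\<Sum>k<n. (norm (X k (B x)))\<^sup>2) \<le> inner (A (B x)) (B x)" .
  qed simp
  then have "(\<lambda>k. (norm (X k (B x)))\<^sup>2) \<longlonglongrightarrow> 0"
    by (rule summable_LIMSEQ_zero)
  then have "(\<lambda>k. X k (B x)) \<longlonglongrightarrow> 0"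
    using tendsto_real_sqrt by (fastforce simp: tendsto_norm_zero_iff)
  then have "(\<lambda>n. inner (\<Sum>k<n. X k (X k (B x))) x) \<longlonglongrightarrow> inner (A (B x) - 0) x"
    unfolding sum by (intro tendsto_intros)
  moreover have "0 \<le> inner (\<Sum>k<n. X k (X k (B x))) x" for n
    unfolding inner_sum_left
  proof (rule sum_nonneg)
    fix k
    have "inner (X k (X k (B x))) x = inner (B (X k x)) (X k x)"
      using swap[OF XW, of k "X k (B x)" x] by (simp only: comm[OF XW B(1)])
    then show "0 \<le> inner (X k (X k (B x))) x"
      using B(2) by (simp add: positive_form_def)
  qed
  ultimately show "0 \<le> inner (A (B x)) x"
    by (simp add: LIMSEQ_le_const)
qed

lemma inner_bound:
  assumes "T \<in> W"
  obtains K where "0 < K" "\<And>x. \<bar>inner (T x) x\<bar> \<le> K * (norm x)\<^sup>2"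
proof -
  obtain K where K: "0 < K" "\<And>x. norm (T x) \<le> norm x * K"
    using bounded_linear.pos_bounded[OF symmetric_opD(1)[OF sym[OF assms]]] by blast
  have "\<bar>inner (T x) x\<bar> \<le> K * (norm x)\<^sup>2" for x
  proof -
    have "\<bar>inner (T x) x\<bar> \<le> norm (T x) * norm x"
      by (rule Cauchy_Schwarz_ineq2)
    also have "\<dots> \<le> (norm x * K) * norm x"
      using K(2)[of x] by (rule mult_right_mono) simp
    finally show ?thesis
      by (simp add: power2_eq_square mult_ac)
  qed
  with K(1) that show thesis by blast
qed

lemma positive_form_comp:
  assumes A: "A \<in> W" "positive_form A" and B: "B \<in> W" "positive_form B"
  shows "positive_form (\<lambda>x. A (B x))"
proof -
  obtain K where K: "0 < K" "\<And>x. \<bar>inner (A x) x\<bar> \<le> K * (norm x)\<^sup>2"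
    using inner_bound[OF A(1)] by blast
  have "positive_form (\<lambda>x. (inverse K *\<^sub>R A (B x)))"
  proof (rule positive_form_comp_contraction[where A = "\<lambda>x. inverse K *\<^sub>R A x"])
    show "positive_form (\<lambda>x. inverse K *\<^sub>R A x)"
      using A(2) K(1) by (auto simp: positive_form_def)
    show "inner (inverse K *\<^sub>R A x) x \<le> (norm x)\<^sup>2" for x
      using K(1) K(2)[of x] by (simp add: field_simps abs_le_iff)
  qed (use A B in \<open>auto intro: scale_mem\<close>)
  then show ?thesis
    using K(1) by (auto simp: positive_form_def zero_le_mult_iff)
qed

text \<open>This is \<open>T\<^sup>2 \<le> K T\<close>: the product of the commuting positive
  operators \<open>T\<close> and \<open>K - T\<close> is positive.\<close>

lemma positive_form_norm_sq_le:
  assumes T: "T \<in> W" "positive_form T" and K: "0 \<le> K" "\<And>x. inner (T x) x \<le> K * (norm x)\<^sup>2"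
  shows "(norm (T x))\<^sup>2 \<le> K * inner (T x) x"
proof -
  have "positive_form (\<lambda>x. T (K *\<^sub>R x - T x))"
    using K(2)
    by (intro positive_form_comp[OF T diff_mem[OF scale_mem[OF id_mem] T(1)]])
      (simp add: positive_form_def inner_simps power2_norm_eq_inner)
  then have "0 \<le> inner (T (K *\<^sub>R x - T x)) x"
    by (simp add: positive_form_def)
  then show ?thesis
    using swap[OF T(1), of "T x" x] by (simp add: lin[OF T(1)] inner_simps power2_norm_eq_inner)
qed

end

text \<open>Plays the role of monotone convergence for operators: the increments of a bounded scalar
  sequence control squared distances, which gives the Cauchy property.\<close>

lemma convergent_if_norm_sq_le:
  fixes X :: "nat \<Rightarrow> 'a :: {real_normed_vector, complete_space}"
  assumes le: "\<And>m n. n \<le> m \<Longrightarrow> (norm (X m - X n))\<^sup>2 \<le> a m - a n" and bdd: "\<And>n. a n \<le> B"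
  shows "convergent X"
proof -
  have mono: "a n \<le> a m" if "n \<le> m" for m n
    using le[OF that] zero_le_power2[of "norm (X m - X n)"] by linarith
  have "convergent a"
    using incseq_convergent[of a B] mono bdd unfolding incseq_def convergent_def by metis
  then have "Cauchy a"
    by (rule convergent_Cauchy)
  have "Cauchy X"
  proof (rule metric_CauchyI)
    fix e :: real assume e: "0 < e"
    then obtain M where M: "\<And>m n. m \<ge> M \<Longrightarrow> n \<ge> M \<Longrightarrow> dist (a m) (a n) < e\<^sup>2"
      using \<open>Cauchy a\<close> by (meson metric_CauchyD zero_less_power)
    have *: "norm (X m - X n) < e" if "n \<ge> M" "m \<ge> n" for m n
    proof -
      have "(norm (X m - X n))\<^sup>2 < e\<^sup>2"
        using le[OF that(2)] M[of m n] that by (auto simp: dist_real_def)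
      then show ?thesis
        using e by (simp add: power2_less_imp_less)
    qed
    have "dist (X m) (X n) < e" if "m \<ge> M" "n \<ge> M" for m n
      using *[of n m] *[of m n] that by (cases "n \<le> m") (auto simp: dist_norm norm_minus_commute)
    then show "\<exists>M. \<forall>m\<ge>M. \<forall>n\<ge>M. dist (X m) (X n) < e"
      by blast
  qed
  then show ?thesis
    by (rule Cauchy_convergent)
qed

context comm_ops
begin

text \<open>Multiplication is jointly strongly continuous on bounded sets; this carries the cubic
  recursion of \<open>cut_contraction\<close> to its limit.\<close>

lemma tendsto_op_op:
  assumes X: "\<And>n :: nat. X n \<in> W" "\<And>n x. norm (X n x) \<le> K * norm x"
    and lim: "\<And>x. (\<lambda>n. X n x) \<longlonglongrightarrow> T x" and y: "y \<longlonglongrightarrow> z"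
  shows "(\<lambda>n. X n (y n)) \<longlonglongrightarrow> T z"
proof -
  have "(\<lambda>n. X n (y n - z)) \<longlonglongrightarrow> 0"
  proof (rule tendsto_norm_zero_cancel, rule tendsto_sandwich[where f = "\<lambda>_. 0"])
    show "(\<lambda>n. K * norm (y n - z)) \<longlonglongrightarrow> 0"
      using y by (auto intro!: tendsto_eq_intros simp: LIM_zero tendsto_norm_zero)
  qed (use X(2) in auto)
  from tendsto_add[OF this lim[of z]] show ?thesis
    by (simp add: lin[OF X(1)])
qed

lemma positive_form_zero:
  assumes "T \<in> W" "positive_form T" "inner (T x) x = 0"
  shows "T x = 0"
proof -
  obtain K where K: "0 < K" "\<And>x. \<bar>inner (T x) x\<bar> \<le> K * (norm x)\<^sup>2"
    using inner_bound[OF assms(1)] by blast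
  have "(norm (T x))\<^sup>2 \<le> K * inner (T x) x"
    using K by (intro positive_form_norm_sq_le assms) (auto simp: abs_le_iff)
  with assms(3) show ?thesis
    by simp
qed

text \<open>The iteration \<open>t \<mapsto> 3t/2 - 2t\<^sup>3\<close> preserves \<open>[-1/2, 1/2]\<close> and drives \<open>t\<close> to \<open>sgn t / 2\<close>. On
  the limit \<open>D\<close> the polynomial \<open>2D\<^sup>2 + D\<close> is the indicator of \<open>D = 1/2\<close>, so it gives the spectral
  projection of \<open>S\<close> for the open half-line \<open>t > 0\<close>.\<close>

lemma cut_contraction:
  assumes S: "S \<in> W" and bd: "\<And>x. \<bar>inner (S x) x\<bar> \<le> (norm x)\<^sup>2 / 2"
  shows "\<exists>P. proj P \<and> (\<forall>z. P z = z \<longrightarrow> inner (S z) z \<le> 0 \<longrightarrow> z = 0) \<and>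
    (\<forall>z. P z = 0 \<longrightarrow> inner (S z) z \<le> 0)"
proof -
  define D where "D = rec_nat S (\<lambda>_ T x. (3/2) *\<^sub>R T x - 2 *\<^sub>R T (T (T x)))"
  \<comment> \<open>The relative increment: \<open>D (Suc n) x = D n x + c n (D n x)\<close>. It is
    positive as long as \<open>D n\<close> lies between -1/2 and 1/2.\<close>
  define c where "c n x = (1/2) *\<^sub>R x - 2 *\<^sub>R D n (D n x)" for n x
  have D0: "D 0 = S"
    by (simp add: D_def)
  have DS: "D (Suc n) x = (3/2) *\<^sub>R D n x - 2 *\<^sub>R D n (D n (D n x))" for n x
    by (simp add: D_def)
  have DS': "D (Suc n) x = D n x + (1/2) *\<^sub>R D n x - 2 *\<^sub>R D n (D n (D n x))" for n x
    using scaleR_add_left[of 1 "1/2" "D n x"] by (simp add: DS)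
  have D: "D n \<in> W \<and> positive_form (\<lambda>x. (1/2) *\<^sub>R x + D n x)
      \<and> positive_form (\<lambda>x. (1/2) *\<^sub>R x - D n x)" for n
  proof (induction n)
    case 0
    have "0 \<le> inner ((1/2) *\<^sub>R x + S x) x" "0 \<le> inner ((1/2) *\<^sub>R x - S x) x" for x
      using bd[of x, unfolded abs_le_iff power2_norm_eq_inner] by (simp_all only: inner_simps) linarith+
    then show ?case
      using S by (simp add: D0 positive_form_def)
  next
    case (Suc n)
    define T where "T = D n"
    define U V where "U = (\<lambda>x. (1/2) *\<^sub>R x + T x)" and "V = (\<lambda>x. (1/2) *\<^sub>R x - T x)"
    have T: "T \<in> W"
      using Suc by (simp add: T_def)
    note l = lin[OF T]
    have U: "U \<in> W" "positive_form U" and V: "V \<in> W" "positive_form V"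
      using Suc add_mem[OF scale_mem[OF id_mem] T] diff_mem[OF scale_mem[OF id_mem] T]
      by (simp_all add: U_def V_def T_def)
    \<comment> \<open>The interval is preserved because \<open>1/2 + (3/2 t - 2 t\<^sup>3) = (1/2 +
      t)\<^sup>2 (1 + 2 (1/2 - t))\<close>, and likewise with \<open>t\<close> replaced by
      \<open>- t\<close>.\<close>
    have "positive_form (\<lambda>x. A (A (x + 2 *\<^sub>R B x)))"
      if "A \<in> W" "positive_form A" "B \<in> W" "positive_form B" for A B
    proof (rule positive_form_comp[where A = "\<lambda>x. A (A x)"])
      show "positive_form (\<lambda>x. x + 2 *\<^sub>R B x)"
        using that(4) by (simp add: positive_form_def inner_simps)
    qed (use that in \<open>auto intro: positive_form_comp add_mem id_mem scale_mem comp_mem\<close>)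
    from this[OF U V] this[OF V U]
    have "positive_form (\<lambda>x. U (U (x + 2 *\<^sub>R V x)))" "positive_form (\<lambda>x. V (V (x + 2 *\<^sub>R U x)))"
      by auto
    moreover have "U (U (x + 2 *\<^sub>R V x)) = (1/2) *\<^sub>R x + D (Suc n) x" for x
      by (rule iffD1[OF vector_eq_rdot], rule allI)
        (simp add: U_def V_def DS l T_def[symmetric] inner_simps field_simps)
    moreover have "V (V (x + 2 *\<^sub>R U x)) = (1/2) *\<^sub>R x - D (Suc n) x" for x
      by (rule iffD1[OF vector_eq_rdot], rule allI)
        (simp add: U_def V_def DS l T_def[symmetric] inner_simps field_simps)
    moreover have "D (Suc n) \<in> W"
    proof -
      have "D (Suc n) = (\<lambda>x. (3/2) *\<^sub>R T x - 2 *\<^sub>R T (T (T x)))"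
        by (simp add: DS T_def fun_eq_iff)
      then show ?thesis
        using diff_mem[OF scale_mem[OF T] scale_mem[OF comp_mem[OF T comp_mem[OF T T]]]] by simp
    qed
    ultimately show ?case
      by simp
  qed
  have DW: "D n \<in> W" for n
    using D by blast
  note l = lin[OF DW]
  have half: "\<bar>inner (D n x) x\<bar> \<le> 1/2 * (norm x)\<^sup>2" for n x
  proof -
    have "0 \<le> inner ((1/2) *\<^sub>R x + D n x) x" "0 \<le> inner ((1/2) *\<^sub>R x - D n x) x"
      using D[of n] by (simp_all only: positive_form_def)
    then show ?thesis
      unfolding abs_le_iff power2_norm_eq_inner by (simp only: inner_simps) linarith
  qed
  have cW: "c n \<in> W" for n
    unfolding c_def using diff_mem[OF scale_mem[OF id_mem] scale_mem[OF comp_mem[OF DW DW]]] .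
  have c_pos: "positive_form (c n)" for n
  proof -
    have "positive_form (\<lambda>x. (1/2) *\<^sub>R (x + 2 *\<^sub>R D n x) - D n (x + 2 *\<^sub>R D n x))"
    proof (rule positive_form_comp[where A = "\<lambda>x. (1/2) *\<^sub>R x - D n x"])
      show "positive_form (\<lambda>x. x + 2 *\<^sub>R D n x)"
        unfolding positive_form_def
      proof
        fix x
        have "0 \<le> inner ((1/2) *\<^sub>R x + D n x) x"
          using D[of n] by (simp only: positive_form_def)
        then show "0 \<le> inner (x + 2 *\<^sub>R D n x) x"
          by (simp add: inner_simps)
      qed
      show "positive_form (\<lambda>x. (1/2) *\<^sub>R x - D n x)"
        using D by blast
    qed (intro diff_mem add_mem scale_mem id_mem DW)+
    moreover have "(1/2) *\<^sub>R (x + 2 *\<^sub>R D n x) - D n (x + 2 *\<^sub>R D n x) = c n x" for x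
      by (simp add: c_def l algebra_simps)
    ultimately show ?thesis
      by simp
  qed
  have DSc: "D (Suc n) x = D n x + c n (D n x)" for n x
    by (simp add: DS' c_def algebra_simps)
  \<comment> \<open>Expresses without functional calculus that later iterates keep the sign of
    \<open>D n\<close> and have at least its modulus: their product with \<open>D n\<close>
    dominates its square. The norm estimate \<open>sq\<close> follows.\<close>
  have pos: "positive_form (\<lambda>x. D m (D n x) - D n (D n x))" if "n \<le> m" for m n
    using that
  proof (induction m rule: dec_induct)
    case base
    then show ?case by (simp add: positive_form_def)
  next
    case (step m)
    have "positive_form (\<lambda>x. D m (D n x))"
      unfolding positive_form_def
    proof
      fix x
      have "0 \<le> inner (D m (D n x)) x - inner (D n (D n x)) x"
        using step.IH by (simp add: positive_form_def inner_simps)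
      moreover have "inner (D n (D n x)) x = inner (D n x) (D n x)"
        by (rule swap[OF DW])
      ultimately show "0 \<le> inner (D m (D n x)) x"
        using inner_ge_zero[of "D n x"] by linarith
    qed
    then have "positive_form (\<lambda>x. c m (D m (D n x)))"
      by (rule positive_form_comp[OF cW c_pos comp_mem[OF DW DW]])
    with step.IH show ?case
      unfolding positive_form_def DSc inner_diff_left inner_add_left
      by (smt (verit, best))
  qed
  have sq: "(norm (D m x - D n x))\<^sup>2 \<le> (norm (D m x))\<^sup>2 - (norm (D n x))\<^sup>2" if "n \<le> m" for m n x
  proof -
    have "0 \<le> inner (D m (D n x)) x - inner (D n (D n x)) x"
      using pos[OF that] by (simp add: positive_form_def inner_simps)
    then have "(norm (D n x))\<^sup>2 \<le> inner (D m x) (D n x)"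
      using swap[OF DW, of n "D n x" x] swap[OF DW, of m "D n x" x]
      by (simp add: power2_norm_eq_inner inner_commute)
    then show ?thesis
      by (simp add: power2_norm_eq_inner inner_simps inner_commute)
  qed
  have nD: "norm (D n x) \<le> 1/2 * norm x" for n x
    using symmetric_op_norm_le[OF sym[OF DW] half] .
  define L where "L x = lim (\<lambda>n. D n x)" for x
  have lim: "(\<lambda>n. D n x) \<longlonglongrightarrow> L x" for x
  proof -
    have "(norm (D n x))\<^sup>2 \<le> (1/2 * norm x)\<^sup>2" for n
      by (intro power_mono nD) simp
    then have "convergent (\<lambda>n. D n x)"
      using sq by (intro convergent_if_norm_sq_le[where a = "\<lambda>n. (norm (D n x))\<^sup>2"])
    then show ?thesis
      by (simp add: L_def convergent_LIMSEQ_iff)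
  qed
  have LW: "L \<in> W"
    by (rule limit_mem[OF DW nD lim])
  note Ll = lin[OF LW]
  have L3: "L (L (L x)) = (1/4) *\<^sub>R L x" for x
  proof -
    have "(\<lambda>n. D (Suc n) x) \<longlonglongrightarrow> (3/2) *\<^sub>R L x - 2 *\<^sub>R L (L (L x))"
      unfolding DS
      by (intro tendsto_diff tendsto_scaleR[OF tendsto_const] lim
          tendsto_op_op[OF DW nD lim tendsto_op_op[OF DW nD lim lim]])
    then have "L x = (3/2) *\<^sub>R L x - 2 *\<^sub>R L (L (L x))"
      using lim[of x, THEN LIMSEQ_Suc] LIMSEQ_unique by blast
    then have "2 *\<^sub>R L (L (L x)) = (3/2) *\<^sub>R L x - 1 *\<^sub>R L x"
      by (simp add: algebra_simps)
    then have "2 *\<^sub>R L (L (L x)) = (1/2) *\<^sub>R L x"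
      by (simp only: scaleR_left_diff_distrib[symmetric]) simp
    then have "(1/2) *\<^sub>R 2 *\<^sub>R L (L (L x)) = (1/2) *\<^sub>R (1/2) *\<^sub>R L x"
      by (rule arg_cong)
    then show ?thesis by simp
  qed
  \<comment> \<open>Moduli grow along the iteration from \<open>D 0 = S\<close>, so \<open>S\<close>
    vanishes wherever the limit \<open>L\<close> does.\<close>
  have S_le: "norm (S x) \<le> norm (L x)" for x
  proof (rule LIMSEQ_le_const[OF tendsto_norm[OF lim]])
    have "norm (S x) \<le> norm (D n x)" for n
    proof (rule power2_le_imp_le)
      show "(norm (S x))\<^sup>2 \<le> (norm (D n x))\<^sup>2"
        using sq[of 0 n x] zero_le_power2[of "norm (D n x - D 0 x)"] by (simp only: D0) linarith
    qed simp
    then show "\<exists>N. \<forall>n\<ge>N. norm (S x) \<le> norm (D n x)" by blast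
  qed
  have SL: "positive_form (\<lambda>x. S (L x))"
    unfolding positive_form_def
  proof
    fix x
    have "(\<lambda>n. inner (S (D n x)) x) \<longlonglongrightarrow> inner (S (L x)) x"
      by (intro tendsto_intros tendsto_op[OF S] lim)
    moreover have "0 \<le> inner (S (D n x)) x" for n
    proof -
      have "0 \<le> inner (D n (S x)) x - inner (S (S x)) x"
        using pos[of 0 n] by (simp add: D0 positive_form_def inner_simps)
      then show ?thesis
        using swap[OF S, of "S x" x] inner_ge_zero[of "S x"]
        unfolding comm[OF S DW[of n], of x] by linarith
    qed
    ultimately show "0 \<le> inner (S (L x)) x"
      by (simp add: LIMSEQ_le_const)
  qed
  define P where "P = (\<lambda>x. 2 *\<^sub>R L (L x) + L x)"
  have "P \<in> W"
    unfolding P_def by (intro add_mem[OF scale_mem[OF comp_mem[OF LW LW]] LW])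
  moreover have PP: "P (P x) = P x" for x
    by (rule iffD1[OF vector_eq_rdot], rule allI)
      (simp add: P_def Ll L3 inner_simps field_simps)
  ultimately have "proj P"
    by (simp add: proj_def)
  moreover have "z = 0" if z: "P z = z" "inner (S z) z \<le> 0" for z
  proof -
    have "L z = (1/2) *\<^sub>R L z + L (L z)"
      using arg_cong[OF z(1), of L] by (simp add: P_def Ll L3)
    then have "L (L z) = 1 *\<^sub>R L z - (1/2) *\<^sub>R L z"
      by (simp add: algebra_simps)
    then have "L (L z) = (1/2) *\<^sub>R L z"
      by (simp only: scaleR_left_diff_distrib[symmetric]) simp
    then have Lz: "2 *\<^sub>R L z = z"
      using z(1) by (simp add: P_def) (simp add: scaleR_2)
    then have eq: "S z = 2 *\<^sub>R S (L z)"
      using lin(3)[OF S, of 2 "L z"] by simp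
    have "inner (S (L z)) z = 0"
      using SL z(2) by (auto simp: eq positive_form_def intro: antisym)
    then have "S (L z) = 0"
      using positive_form_zero[OF comp_mem[OF S LW] SL] by blast
    then have "D n z = 0" for n
      by (induction n) (simp_all add: D0 DS l eq)
    then have "L z = 0"
      using lim[of z] by (simp add: LIMSEQ_const_iff)
    with Lz show ?thesis by simp
  qed
  moreover have "inner (S z) z \<le> 0" if z: "P z = 0" for z
  proof -
    \<comment> \<open>Since \<open>4 L\<^sup>3 = L\<close>, the vector \<open>4 L (L z)\<close> is
      the part of \<open>z\<close> off the kernel of \<open>L\<close>, and \<open>S\<close> sees
      this part alone. There \<open>P z = 0\<close> makes \<open>L\<close> act as -1/2.\<close>
    have "L (z - 4 *\<^sub>R L (L z)) = 0"
      by (simp add: Ll L3)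
    then have "S (z - 4 *\<^sub>R L (L z)) = 0"
      using S_le[of "z - 4 *\<^sub>R L (L z)"] by simp
    then have "S z = S (2 *\<^sub>R 2 *\<^sub>R L (L z))"
      by (simp add: lin[OF S])
    moreover have "2 *\<^sub>R L (L z) = - L z"
      using z by (simp add: P_def add_eq_0_iff2)
    ultimately have "S z = - 2 *\<^sub>R S (L z)"
      by (simp add: lin[OF S])
    then show ?thesis
      using SL by (simp add: positive_form_def)
  qed
  ultimately show ?thesis
    by blast
qed

lemma cut:
  assumes S: "S \<in> W"
  shows "\<exists>P. proj P \<and> (\<forall>z. P z = z \<longrightarrow> inner (S z) z \<le> 0 \<longrightarrow> z = 0) \<and>
    (\<forall>z. P z = 0 \<longrightarrow> inner (S z) z \<le> 0)"
proof -
  obtain K where K: "0 < K" "\<And>x. \<bar>inner (S x) x\<bar> \<le> K * (norm x)\<^sup>2"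
    using inner_bound[OF S] by blast
  define r where "r = inverse (2 * K)"
  have r: "0 < r" "r * K = 1 / 2"
    using K(1) by (auto simp: r_def)
  have "\<bar>inner (r *\<^sub>R S x) x\<bar> \<le> (norm x)\<^sup>2 / 2" for x
  proof -
    have "r * \<bar>inner (S x) x\<bar> \<le> r * (K * (norm x)\<^sup>2)"
      using K(2) r(1) by (intro mult_left_mono) auto
    then show ?thesis
      using r by (simp add: abs_mult flip: mult.assoc)
  qed
  moreover have "inner (r *\<^sub>R S z) z \<le> 0 \<longleftrightarrow> inner (S z) z \<le> 0" for z
    using r(1) by (simp add: mult_le_0_iff)
  ultimately show ?thesis
    using cut_contraction[OF scale_mem[OF S, of r]] by simp
qed

text \<open>The strict condition on the range and the weak one on the kernel send the kernel of
  \<open>S\<close> into the kernel of the projection. This asymmetry is what makes the family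
  \<open>below\<close> right continuous.\<close>

definition cut_proj :: "('a \<Rightarrow> 'a) \<Rightarrow> 'a \<Rightarrow> 'a"
  where "cut_proj S = (SOME P. proj P \<and> (\<forall>z. P z = z \<longrightarrow> inner (S z) z \<le> 0 \<longrightarrow> z = 0) \<and>
    (\<forall>z. P z = 0 \<longrightarrow> inner (S z) z \<le> 0))"

lemma cut_proj:
  assumes "S \<in> W"
  shows "proj (cut_proj S)" "cut_proj S z = z \<Longrightarrow> inner (S z) z \<le> 0 \<Longrightarrow> z = 0"
    "cut_proj S z = 0 \<Longrightarrow> inner (S z) z \<le> 0"
  using someI_ex[OF cut[OF assms]] unfolding cut_proj_def by blast+

lemma cut_proj_nonneg:
  assumes "S \<in> W" "cut_proj S z = z"
  shows "0 \<le> inner (S z) z"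
  using cut_proj(2)[OF assms] lin(5)[OF assms(1)] by fastforce


section \<open>Digit expansions\<close>

definition contraction :: "('a \<Rightarrow> 'a) \<Rightarrow> bool"
  where "contraction T \<longleftrightarrow> T \<in> W \<and> (\<forall>x. 0 \<le> inner (T x) x \<and> inner (T x) x \<le> (norm x)\<^sup>2)"

lemma contractionD:
  assumes "contraction T"
  shows "T \<in> W" "0 \<le> inner (T x) x" "inner (T x) x \<le> (norm x)\<^sup>2" "norm (T x) \<le> norm x"
proof -
  show *: "T \<in> W" "0 \<le> inner (T x) x" "inner (T x) x \<le> (norm x)\<^sup>2" for x
    using assms by (auto simp: contraction_def)
  show "norm (T x) \<le> norm x"
    using symmetric_op_norm_le[OF sym[OF *(1)], of 1 x] * by (simp add: abs_le_iff order_trans[of _ 0])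
qed

text \<open>\<open>resid T n\<close> is \<open>T\<close> with its first \<open>n\<close> binary digits shifted out.\<close>

primrec resid :: "('a \<Rightarrow> 'a) \<Rightarrow> nat \<Rightarrow> 'a \<Rightarrow> 'a"
  where "resid T 0 = T"
  | "resid T (Suc n) =
      (\<lambda>x. 2 *\<^sub>R resid T n x - cut_proj (\<lambda>x. resid T n x - (1/2) *\<^sub>R x) x)"

text \<open>The cut at 1/2 is strict, so the value 1/2 receives digit 0 and leaves the remainder 1:
  a positive dyadic value is expanded with a tail of ones. \<open>binary_digit\<close> follows the
  same convention.\<close>

definition digit :: "('a \<Rightarrow> 'a) \<Rightarrow> nat \<Rightarrow> 'a \<Rightarrow> 'a"
  where "digit T n = cut_proj (\<lambda>x. resid T n x - (1/2) *\<^sub>R x)"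

lemma resid_Suc: "resid T (Suc n) x = 2 *\<^sub>R resid T n x - digit T n x"
  by (simp add: digit_def)

text \<open>On the range of the digit the remainder lies in \<open>[1/2, 1]\<close> and turns into
  \<open>2 t - 1\<close>; on the complement it lies in \<open>[0, 1/2]\<close> and turns into
  \<open>2 t\<close>. Both results stay in \<open>[0, 1]\<close>.\<close>

lemma contraction_resid:
  assumes "contraction T"
  shows "contraction (resid T n)"
proof (induction n)
  case 0
  then show ?case using assms by simp
next
  case (Suc n)
  define R where "R = resid T n"
  define S where "S = (\<lambda>x. R x - (1/2) *\<^sub>R x)"
  define P where "P = cut_proj S"
  have R: "contraction R"
    using Suc by (simp add: R_def)
  have S: "S \<in> W"
    unfolding S_def by (intro diff_mem contractionD[OF R] scale_mem id_mem)
  have P: "proj P"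
    unfolding P_def by (rule cut_proj[OF S])
  have eq: "resid T (Suc n) = (\<lambda>x. 2 *\<^sub>R R x - P x)"
    by (simp add: R_def P_def S_def)
  have R': "(\<lambda>x. 2 *\<^sub>R R x - P x) \<in> W"
    by (intro diff_mem scale_mem contractionD[OF R] projD P)
  have "0 \<le> inner (2 *\<^sub>R R x - P x) x \<and> inner (2 *\<^sub>R R x - P x) x \<le> (norm x)\<^sup>2" for x
  proof -
    define y z where "y = P x" and "z = x - P x"
    have y: "P y = y" and z: "P z = 0"
      using P by (auto simp: y_def z_def proj_def lin)
    have "0 \<le> inner (S y) y"
      using cut_proj_nonneg[OF S] y by (simp add: P_def)
    then have 1: "0 \<le> inner (2 *\<^sub>R R y - P y) y \<and> inner (2 *\<^sub>R R y - P y) y \<le> (norm y)\<^sup>2"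
      using contractionD(3)[OF R, of y]
      by (simp add: S_def y inner_simps power2_norm_eq_inner)
    have "inner (S z) z \<le> 0"
      using cut_proj(3)[OF S] z by (simp add: P_def)
    then have 2: "0 \<le> inner (2 *\<^sub>R R z - P z) z \<and> inner (2 *\<^sub>R R z - P z) z \<le> (norm z)\<^sup>2"
      using contractionD(2)[OF R, of z]
      by (simp add: S_def z inner_simps power2_norm_eq_inner)
    from 1 2 show ?thesis
      using inner_split[OF P R', of x] proj_pythagoras[OF P, of x] by (simp add: y_def z_def)
  qed
  with R' show ?case
    unfolding contraction_def eq by blast
qed

lemma proj_digit: "contraction T \<Longrightarrow> proj (digit T n)"
  unfolding digit_def
  by (intro cut_proj(1) diff_mem scale_mem id_mem contractionD[OF contraction_resid])

lemma resid_sums: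
  assumes "contraction T"
  shows "(\<lambda>k. (1/2) ^ Suc k *\<^sub>R digit T k x) sums T x"
proof -
  have partial: "(\<Sum>k<n. (1/2) ^ Suc k *\<^sub>R digit T k x) = T x - (1/2) ^ n *\<^sub>R resid T n x" for n
    by (induction n) (simp_all add: resid_Suc scaleR_diff_right del: resid.simps(2))
  have "(\<lambda>n. (1/2) ^ n *\<^sub>R resid T n x) \<longlonglongrightarrow> 0"
  proof (rule tendsto_norm_zero_cancel, rule tendsto_sandwich[where f = "\<lambda>_. 0"])
    show "(\<lambda>n. (1/2) ^ n * norm x) \<longlonglongrightarrow> 0"
      using tendsto_mult_right[OF LIMSEQ_realpow_zero[of "1/2"], of "norm x"] by simp
    show "\<forall>\<^sub>F n in sequentially. norm ((1/2) ^ n *\<^sub>R resid T n x) \<le> (1/2) ^ n * norm x"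
      using contractionD(4)[OF contraction_resid[OF assms]] by (simp add: mult_left_mono)
  qed auto
  then show ?thesis
    unfolding sums_def partial using tendsto_diff[OF tendsto_const, of _ 0 sequentially "T x"] by simp
qed

lemma sum_mem: "(\<And>k. k \<in> I \<Longrightarrow> f k \<in> W) \<Longrightarrow> (\<lambda>x. \<Sum>k\<in>I. f k x) \<in> W"
  by (induction I rule: infinite_finite_induct) (auto simp: zero_mem add_mem)

text \<open>\<open>A 0\<close> is the encoding operator, the other \<open>A m\<close> are its
  shifted tails; its digits are later identified by induction along these tails. The weights
  \<open>2 / 3 ^ Suc k\<close> add up to 1, hence the bounds.\<close>

lemma ternary_contraction:
  assumes Q: "\<And>m. proj (Q m)"
  obtains A where "\<And>m. contraction (A m)"
    "\<And>m x. A m x = (2/3) *\<^sub>R Q m x + (1/3) *\<^sub>R A (Suc m) x"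
proof -
  define A where "A m x = (\<Sum>k. (2 / 3 ^ Suc k) *\<^sub>R Q (m + k) x)" for m x
  have geo: "(\<lambda>k. 2 / 3 ^ Suc k * c) sums c" for c :: real
    using sums_mult[OF geometric_sums[of "1/3 :: real"], of "2/3 * c"]
    by (simp add: power_divide field_simps)
  have nQ: "norm ((2 / 3 ^ Suc k) *\<^sub>R Q m x) \<le> 2 / 3 ^ Suc k * norm x" for k m x
    using proj_norm_le[OF Q, of m x] by (simp add: divide_right_mono)
  have summ: "(\<lambda>k. (2 / 3 ^ Suc k) *\<^sub>R Q (m + k) x) sums A m x" for m x
    unfolding A_def
    by (rule summable_sums, rule summable_comparison_test'[OF sums_summable[OF geo[of "norm x"]] nQ])
  have AW: "A m \<in> W" for m
  proof (rule limit_mem)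
    show "(\<lambda>x. \<Sum>k<n. (2 / 3 ^ Suc k) *\<^sub>R Q (m + k) x) \<in> W" for n
      by (intro sum_mem scale_mem projD Q)
    show "norm (\<Sum>k<n. (2 / 3 ^ Suc k) *\<^sub>R Q (m + k) x) \<le> 1 * norm x" for n x
    proof -
      have "norm (\<Sum>k<n. (2 / 3 ^ Suc k) *\<^sub>R Q (m + k) x) \<le> (\<Sum>k<n. 2 / 3 ^ Suc k * norm x)"
        by (rule sum_norm_le[OF nQ])
      also have "\<dots> \<le> norm x"
        using geo[of "norm x"] by (intro sum_le_suminf[of _ "{..<n}", THEN order_trans])
          (auto simp: sums_iff)
      finally show ?thesis by simp
    qed
    show "(\<lambda>n. \<Sum>k<n. (2 / 3 ^ Suc k) *\<^sub>R Q (m + k) x) \<longlonglongrightarrow> A m x" for x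
      using summ by (simp add: sums_def)
  qed
  have form: "(\<lambda>k. 2 / 3 ^ Suc k * (norm (Q (m + k) x))\<^sup>2) sums inner (A m x) x" for m x
    using bounded_linear.sums[OF bounded_linear_inner_left[of x] summ[of m x]]
    by (simp add: proj_inner[OF Q])
  have "0 \<le> inner (A m x) x" for m x
    using sums_le[OF _ sums_zero form] by simp
  moreover have "inner (A m x) x \<le> (norm x)\<^sup>2" for m x
    by (rule sums_le[OF _ form geo])
      (auto intro!: divide_right_mono power_mono proj_norm_le[OF Q])
  ultimately have "contraction (A m)" for m
    using AW by (simp add: contraction_def)
  moreover have "A m x = (2/3) *\<^sub>R Q m x + (1/3) *\<^sub>R A (Suc m) x" for m x
  proof -
    have "(\<lambda>k. (1/3) *\<^sub>R (2 / 3 ^ Suc k) *\<^sub>R Q (Suc m + k) x) sums ((1/3) *\<^sub>R A (Suc m) x)"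
      using summ by (rule sums_scaleR_right)
    then have "(\<lambda>k. (2 / 3 ^ Suc (Suc k)) *\<^sub>R Q (m + Suc k) x) sums ((1/3) *\<^sub>R A (Suc m) x)"
      by simp
    then show ?thesis
      using summ[of m x] by (subst (asm) sums_Suc_iff) (simp add: sums_unique2 algebra_simps)
  qed
  ultimately show thesis
    by (rule that)
qed

end

section \<open>Operator measures and their quadratic forms\<close>

definition form_measure :: "'b measure \<Rightarrow> ('b set \<Rightarrow> 'a::real_inner \<Rightarrow> 'a) \<Rightarrow> 'a \<Rightarrow> 'b measure"
  where "form_measure M F x =
    measure_of (space M) (sets M) (\<lambda>\<Delta>. ennreal (inner (F \<Delta> x) x))"

lemma space_form_measure [simp]: "space (form_measure M F x) = space M"
  and sets_form_measure [measurable_cong, simp]: "sets (form_measure M F x) = sets M"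
  by (simp_all add: form_measure_def)

lemma measurable_form_measure [simp]:
  "measurable (form_measure M F x) N = measurable M N"
  by (rule measurable_cong_sets) simp_all

lemma symmetric_op_zero: "symmetric_op (\<lambda>x. 0)"
  by (simp add: symmetric_op_def)

lemma symmetric_op_id: "symmetric_op (\<lambda>x. x)"
  by (simp add: symmetric_op_def bounded_linear_ident)

lemma symmetric_op_add:
  "symmetric_op S \<Longrightarrow> symmetric_op T \<Longrightarrow> symmetric_op (\<lambda>x. S x + T x)"
  by (simp add: symmetric_op_def bounded_linear_add inner_simps)

text \<open>Keeps the quadratic forms only; \<open>povmI\<close> recovers weak additivity for pairs
  of vectors by polarization.\<close>

locale form_povm =
  fixes M :: "'b measure" and F :: "'b set \<Rightarrow> 'a :: real_inner \<Rightarrow> 'a"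
  assumes symmetric: "B \<in> sets M \<Longrightarrow> symmetric_op (F B)"
    and nonneg: "B \<in> sets M \<Longrightarrow> 0 \<le> inner (F B x) x"
    and sums: "range D \<subseteq> sets M \<Longrightarrow> disjoint_family D \<Longrightarrow>
      (\<lambda>n :: nat. inner (F (D n) x) x) sums inner (F (\<Union>n. D n) x) x"
begin

abbreviation nu :: "'a \<Rightarrow> 'b measure"
  where "nu \<equiv> form_measure M F"

lemma empty: "F {} x = 0"
proof -
  have "inner (F {} y) y = 0" for y
    using sums[of "\<lambda>_. {}" y] summable_LIMSEQ_zero[of "\<lambda>_. inner (F {} y) y"]
    by (auto simp: disjoint_family_on_def sums_iff LIMSEQ_const_iff)
  then have "F {} = (\<lambda>x. 0)"
    by (intro symmetric_op_eqI symmetric symmetric_op_zero) auto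
  then show ?thesis by simp
qed

lemma emeasure_nu:
  assumes "B \<in> sets M"
  shows "emeasure (nu x) B = ennreal (inner (F B x) x)"
  unfolding form_measure_def
proof (rule emeasure_measure_of_sigma[OF sets.sigma_algebra_axioms _ _ assms])
  show "positive (sets M) (\<lambda>\<Delta>. ennreal (inner (F \<Delta> x) x))"
    by (simp add: positive_def empty)
  show "countably_additive (sets M) (\<lambda>\<Delta>. ennreal (inner (F \<Delta> x) x))"
    by (rule countably_additiveI, rule suminf_ennreal_eq) (blast intro: nonneg sums)+
qed

lemma measure_nu: "B \<in> sets M \<Longrightarrow> measure (nu x) B = inner (F B x) x"
  by (simp add: measure_def emeasure_nu nonneg)

lemma finite_measure_nu: "finite_measure (nu x)"
  by (rule finite_measureI) (simp add: emeasure_nu)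

lemma additive:
  assumes "B \<in> sets M" "C \<in> sets M" "B \<inter> C = {}"
  shows "F (B \<union> C) x = F B x + F C x"
proof -
  have "inner (F (B \<union> C) y) y = inner (F B y + F C y) y" for y
    using finite_measure.finite_measure_Union[OF finite_measure_nu, of B y C] assms
    by (simp add: measure_nu inner_simps)
  then have "F (B \<union> C) = (\<lambda>y. F B y + F C y)"
    using assms by (intro symmetric_op_eqI symmetric_op_add symmetric) auto
  then show ?thesis by simp
qed

end

locale form_pvm = form_povm M E for M :: "'b measure" and E :: "'b set \<Rightarrow> 'a :: real_inner \<Rightarrow> 'a" +
  assumes total: "E (space M) x = x"
    and idem: "B \<in> sets M \<Longrightarrow> E B (E B x) = E B x"
begin

lemma norm_sq: "B \<in> sets M \<Longrightarrow> (norm (E B x))\<^sup>2 = inner (E B x) x"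
  using symmetric_opD(2)[OF symmetric, of B "E B x" x]
  by (simp add: idem power2_norm_eq_inner)

lemma measure_nu': "B \<in> sets M \<Longrightarrow> measure (nu x) B = (norm (E B x))\<^sup>2"
  by (simp add: measure_nu norm_sq)

lemma measure_space_nu: "measure (nu x) (space M) = (norm x)\<^sup>2"
  by (simp add: measure_nu' total)

text \<open>At \<open>E C x\<close> the scalar measure already has its full mass on
  \<open>C\<close>, so additivity leaves none for the disjoint set \<open>B\<close>.\<close>

lemma disjoint:
  assumes "B \<in> sets M" "C \<in> sets M" "B \<inter> C = {}"
  shows "E B (E C x) = 0"
proof -
  let ?y = "E C x"
  interpret finite_measure "nu ?y"
    by (rule finite_measure_nu)
  have "measure (nu ?y) (B \<union> C) \<le> measure (nu ?y) (space M)"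
    using assms(1,2) by (intro finite_measure_mono) (auto dest: sets.sets_into_space)
  then have "(norm (E B ?y))\<^sup>2 + (norm ?y)\<^sup>2 \<le> (norm ?y)\<^sup>2"
    using assms finite_measure_Union[of B C] by (simp only: sets_form_measure measure_space_nu) (simp add: measure_nu' idem)
  then show ?thesis by simp
qed

lemma comp:
  assumes "B \<in> sets M" "C \<in> sets M"
  shows "E B (E C x) = E (B \<inter> C) x"
proof -
  have eq: "(B \<inter> C) \<union> (C - B) = C" "(B - C) \<union> (B \<inter> C) = B"
    by blast+
  have "E C x = E (B \<inter> C) x + E (C - B) x"
    using additive[of "B \<inter> C" "C - B" x] assms unfolding eq by blast
  moreover have "E B (E (B \<inter> C) x) = E (B - C) (E (B \<inter> C) x) + E (B \<inter> C) (E (B \<inter> C) x)"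
    using additive[of "B - C" "B \<inter> C" "E (B \<inter> C) x"] assms unfolding eq by blast
  moreover have "E (B - C) (E (B \<inter> C) x) = 0" "E B (E (C - B) x) = 0"
    using assms by (intro disjoint; auto)+
  ultimately show ?thesis
    using assms by (simp add: idem symmetric_op_linear[OF symmetric])
qed

lemma commute: "B \<in> sets M \<Longrightarrow> C \<in> sets M \<Longrightarrow> E B (E C x) = E C (E B x)"
  by (simp add: comp Int_commute)

lemma compl:
  assumes "B \<in> sets M"
  shows "E (space M - B) x = x - E B x"
proof -
  have "B \<union> (space M - B) = space M"
    using sets.sets_into_space[OF assms] by blast
  then have "E B x + E (space M - B) x = x"
    using additive[of B "space M - B" x] assms total[of x] by simp
  then show ?thesis
    by (metis add_diff_cancel_left')
qed

lemma AE_nu: 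
  assumes "B \<in> sets M" "E B z = z"
  shows "AE l in nu z. l \<in> B"
proof (rule AE_I)
  show "emeasure (nu z) (space M - B) = 0"
    using emeasure_nu[of "space M - B" z] compl[OF assms(1), of z] assms by simp
qed (use assms sets.sets_into_space in auto)

text \<open>The standard device below for proving a vector zero: a strictly positive integrand on
  the carrier \<open>B\<close> forces the scalar measure, of total mass
  \<open>(norm z)\<^sup>2\<close>, to vanish.\<close>

lemma zero_if_integral_nonpos:
  assumes B: "B \<in> sets M" and z: "E B z = z" and h: "integrable (nu z) h"
    and pos: "\<And>l. l \<in> B \<Longrightarrow> 0 < h l" and int: "(\<integral>l. h l \<partial>nu z) \<le> (0 :: real)"
  shows "z = 0"
proof -
  have AE: "AE l in nu z. l \<in> B"
    by (rule AE_nu[OF B z])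
  then have nn: "AE l in nu z. 0 \<le> h l"
    by eventually_elim (use pos less_imp_le in blast)
  then have "(\<integral>l. h l \<partial>nu z) = 0"
    using int integral_nonneg_AE[OF nn] by simp
  then have "AE l in nu z. h l = 0"
    using integral_nonneg_eq_0_iff_AE[OF h nn] by simp
  with AE have "AE l in nu z. False"
    by eventually_elim (use pos in force)
  then have "measure (nu z) (space M) = 0"
    using AE_iff_measurable[of "space M" "nu z" "\<lambda>_. False"] by (simp add: measure_def)
  then show ?thesis
    by (simp add: measure_space_nu)
qed

text \<open>Tested on vectors in the range of the projection in question: their scalar measures are
  carried by the points where \<open>f\<close> exceeds \<open>g\<close>, so the inequality of
  integrals forces them to vanish.\<close>

lemma null_if_integral_le:
  assumes f: "\<And>x. integrable (nu x) f" and g: "\<And>x. integrable (nu x) g"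
    and le: "\<And>x. (\<integral>l. f l \<partial>nu x) \<le> (\<integral>l. g l \<partial>nu x)"
    and [measurable]: "f \<in> borel_measurable M" "g \<in> borel_measurable M"
  shows "E {l \<in> space M. g l < (f l :: real)} x = 0"
proof (rule zero_if_integral_nonpos)
  let ?B = "{l \<in> space M. g l < f l}"
  show "?B \<in> sets M"
    by measurable
  then show "E ?B (E ?B x) = E ?B x"
    by (rule idem)
  show "(\<integral>l. f l - g l \<partial>nu (E ?B x)) \<le> 0"
    using le by (simp add: f g)
qed (auto intro: f g)

lemma null_countable_Un:
  assumes "countable I" "\<And>i. i \<in> I \<Longrightarrow> B i \<in> sets M" "\<And>i x. i \<in> I \<Longrightarrow> E (B i) x = 0"
  shows "E (\<Union>i\<in>I. B i) x = 0"
proof -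
  have "(\<Union>i\<in>I. B i) \<in> null_sets (nu x)"
    using assms by (intro null_sets_UN') (auto simp: null_sets_def emeasure_nu)
  then have S: "(\<Union>i\<in>I. B i) \<in> sets M" and "emeasure (nu x) (\<Union>i\<in>I. B i) = 0"
    by auto
  then have "inner (E (\<Union>i\<in>I. B i) x) x \<le> 0"
    by (simp add: emeasure_nu ennreal_eq_0_iff)
  then have "(norm (E (\<Union>i\<in>I. B i) x))\<^sup>2 \<le> 0"
    using norm_sq[OF S, of x] by linarith
  then show ?thesis
    by simp
qed

lemma null_subset:
  assumes "C \<subseteq> B" "B \<in> sets M" "C \<in> sets M" "\<And>x. E B x = 0"
  shows "E C x = 0"
  using comp[OF assms(2,3), of x] assms by (simp add: Int_absorb1)

end


lemma borel_Ioc_induct [consumes 1, case_names Ioc empty compl union]: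
  assumes B: "B \<in> sets borel"
    and Ioc: "\<And>a b. a \<le> b \<Longrightarrow> P {a<..b :: real}" and empty: "P {}"
    and compl: "\<And>B. B \<in> sets borel \<Longrightarrow> P B \<Longrightarrow> P (UNIV - B)"
    and union: "\<And>D :: nat \<Rightarrow> real set. disjoint_family D \<Longrightarrow> range D \<subseteq> sets borel \<Longrightarrow>
      (\<And>i. P (D i)) \<Longrightarrow> P (\<Union>i. D i)"
  shows "P B"
proof -
  have "Int_stable (range (\<lambda>(a, b). {a<..b :: real}))"
    by (rule Int_stableI) (auto simp: image_iff, blast)
  moreover have "range (\<lambda>(a, b). {a<..b :: real}) \<subseteq> Pow UNIV"
    by simp
  moreover have "B \<in> sigma_sets UNIV (range (\<lambda>(a, b). {a<..b :: real}))"
    using B by (simp add: borel_sigma_sets_Ioc)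
  ultimately show ?thesis
  proof (induction B rule: sigma_sets_induct_disjoint)
    case (basic I)
    then obtain a b where I: "I = {a<..b}" by auto
    show ?case
      unfolding I using Ioc[of a b] empty by (cases "a \<le> b") auto
  qed (simp_all add: empty compl union borel_sigma_sets_Ioc)
qed

definition sym_Ioc :: "nat \<Rightarrow> real set"
  where "sym_Ioc n = {- real n<..real n}"

lemma sym_Ioc: "incseq sym_Ioc" "(\<Union>n. sym_Ioc n) = UNIV" "range sym_Ioc \<subseteq> sets borel"
proof -
  show "incseq sym_Ioc"
    by (auto simp: incseq_def sym_Ioc_def)
  have "r \<in> (\<Union>n. sym_Ioc n)" for r
  proof -
    obtain n where "\<bar>r\<bar> < real n"
      using reals_Archimedean2 by blast
    then show ?thesis
      by (intro UN_I[of n]) (auto simp: sym_Ioc_def)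
  qed
  then show "(\<Union>n. sym_Ioc n) = UNIV"
    by blast
qed (auto simp: sym_Ioc_def)


section \<open>The spectral theorem\<close>

context comm_ops
begin

text \<open>The spectral family of \<open>A\<close>, formally the indicator of
  \<open>A \<le> t\<close>; since the cut is strict, the end-point \<open>t\<close> is
  included.\<close>

definition below :: "('a \<Rightarrow> 'a) \<Rightarrow> real \<Rightarrow> 'a \<Rightarrow> 'a"
  where "below A t x = x - cut_proj (\<lambda>x. A x - t *\<^sub>R x) x"

context
  fixes A assumes A: "contraction A"
begin

lemma shift_mem: "(\<lambda>x. A x - t *\<^sub>R x) \<in> W"
  by (intro diff_mem scale_mem id_mem contractionD[OF A])

lemma proj_below: "proj (below A t)"
  using proj_compl[OF cut_proj(1)[OF shift_mem, of t]]
  by (simp add: below_def[abs_def])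

lemma below_mem: "below A t \<in> W"
  using proj_below projD by blast

lemma below_le: "below A t z = z \<Longrightarrow> inner (A z) z \<le> t * (norm z)\<^sup>2"
  using cut_proj(3)[OF shift_mem, of t z]
  by (simp add: below_def inner_simps power2_norm_eq_inner)

lemma below_ge: "below A t z = 0 \<Longrightarrow> t * (norm z)\<^sup>2 \<le> inner (A z) z"
  using cut_proj_nonneg[OF shift_mem, of t z]
  by (simp add: below_def inner_simps power2_norm_eq_inner)

lemma below_strict: "below A t z = 0 \<Longrightarrow> inner (A z) z \<le> t * (norm z)\<^sup>2 \<Longrightarrow> z = 0"
  using cut_proj(2)[OF shift_mem, of t z]
  by (simp add: below_def inner_simps power2_norm_eq_inner)

text \<open>The component of \<open>Q x\<close> outside \<open>below A t\<close> lies strictly above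
  \<open>t\<close> and, still being in the range of \<open>Q\<close>, not above \<open>t\<close>; so
  it is zero.\<close>

lemma below_max:
  assumes "Q \<in> W" and le: "\<And>x. inner (A (Q x)) (Q x) \<le> t * (norm (Q x))\<^sup>2"
  shows "below A t (Q x) = Q x"
proof -
  define z where "z = Q x - below A t (Q x)"
  have "below A t z = 0"
    by (simp add: z_def lin[OF below_mem] projD(2)[OF proj_below])
  moreover have "z = Q (x - below A t x)"
    by (simp add: z_def lin[OF assms(1)] comm[OF assms(1) below_mem])
  then have "inner (A z) z \<le> t * (norm z)\<^sup>2"
    using le by metis
  ultimately have "z = 0"
    by (rule below_strict)
  then show ?thesis
    by (simp add: z_def)
qed

lemma below_comp:
  assumes "s \<le> t"
  shows "below A t (below A s x) = below A s x"
proof (rule below_max[OF below_mem])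
  fix x
  have "inner (A (below A s x)) (below A s x) \<le> s * (norm (below A s x))\<^sup>2"
    by (rule below_le[OF projD(2)[OF proj_below]])
  also have "\<dots> \<le> t * (norm (below A s x))\<^sup>2"
    using assms by (intro mult_right_mono) auto
  finally show "inner (A (below A s x)) (below A s x) \<le> t * (norm (below A s x))\<^sup>2" .
qed

lemma below_comp': "s \<le> t \<Longrightarrow> below A s (below A t x) = below A s x"
  using below_comp[of s t x] comm[OF below_mem below_mem, of s t x] by simp

lemma below_id:
  assumes "1 \<le> t" shows "below A t x = x"
proof (rule below_max[OF id_mem])
  fix x :: 'a
  have "1 * (norm x)\<^sup>2 \<le> t * (norm x)\<^sup>2"
    using assms by (intro mult_right_mono) auto
  then show "inner (A x) x \<le> t * (norm x)\<^sup>2"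
    using contractionD(3)[OF A, of x] by simp
qed

lemma below_zero:
  assumes "t < 0" shows "below A t x = 0"
proof -
  have "0 \<le> t * (norm (below A t x))\<^sup>2"
    using below_le[OF projD(2)[OF proj_below], of t x] contractionD(2)[OF A, of "below A t x"] by linarith
  with assms show ?thesis
    by (simp add: zero_le_mult_iff)
qed

lemma below_diff: 
  assumes "s \<le> t"
  shows "(norm (below A t x - below A s x))\<^sup>2 = (norm (below A t x))\<^sup>2 - (norm (below A s x))\<^sup>2"
proof -
  have "inner (below A t x) (below A s x) = inner x (below A s x)"
    by (simp add: swap[OF below_mem] below_comp[OF assms])
  also have "\<dots> = (norm (below A s x))\<^sup>2"
    by (metis inner_commute proj_below proj_inner)
  finally show ?thesis
    by (simp add: power2_norm_eq_inner inner_simps inner_commute)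
qed

lemma below_mono: "s \<le> t \<Longrightarrow> inner (below A s x) x \<le> inner (below A t x) x"
  using below_diff[of s t x] zero_le_power2[of "norm (below A t x - below A s x)"]
  by (simp add: proj_inner[OF proj_below])

text \<open>The decreasing projections have a strong limit \<open>Q\<close>. On its range the form
  of \<open>A\<close> is bounded by \<open>t + 1 / real (Suc n)\<close> for all \<open>n\<close>,
  hence by \<open>t\<close>, and \<open>below_max\<close> puts \<open>Q\<close> beneath
  \<open>below A t\<close>.\<close>

lemma below_tendsto: "(\<lambda>n. below A (t + 1 / real (Suc n)) x) \<longlonglongrightarrow> below A t x"
proof -
  let ?t = "\<lambda>n. t + 1 / real (Suc n)"
  have dec: "?t m \<le> ?t n" if "n \<le> m" for m n
    using that by (simp add: frac_le)
  define Q where "Q x = lim (\<lambda>n. below A (?t n) x)" for x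
  have lim: "(\<lambda>n. below A (?t n) x) \<longlonglongrightarrow> Q x" for x
  proof -
    have "(norm (below A (?t m) x - below A (?t n) x))\<^sup>2
        \<le> - ((norm (below A (?t m) x))\<^sup>2) - - ((norm (below A (?t n) x))\<^sup>2)" if "n \<le> m" for m n
      using below_diff[OF dec[OF that], of x] by (simp add: norm_minus_commute del: of_nat_Suc)
    then have "convergent (\<lambda>n. below A (?t n) x)"
      by (intro convergent_if_norm_sq_le[where a = "\<lambda>n. - ((norm (below A (?t n) x))\<^sup>2)" and B = 0]) simp_all
    then show ?thesis
      by (simp add: Q_def convergent_LIMSEQ_iff)
  qed
  have Q: "proj Q"
    by (rule proj_limit[OF proj_below lim])
  have below_Q: "below A (?t n) (Q x) = Q x" for n x
  proof (rule LIMSEQ_unique[OF tendsto_op[OF below_mem lim]])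
    have "\<forall>\<^sub>F m in sequentially. below A (?t m) x = below A (?t n) (below A (?t m) x)"
      by (rule eventually_sequentiallyI[of n]) (rule below_comp[OF dec, symmetric])
    then show "(\<lambda>m. below A (?t n) (below A (?t m) x)) \<longlonglongrightarrow> Q x"
      using lim by (rule Lim_transform_eventually[rotated])
  qed
  have "below A t (Q x) = Q x"
  proof (rule below_max[OF projD(1)[OF Q]])
    fix x
    have "(\<lambda>n. ?t n * (norm (Q x))\<^sup>2) \<longlonglongrightarrow> (t + 0) * (norm (Q x))\<^sup>2"
      by (intro tendsto_intros LIMSEQ_Suc[OF lim_1_over_n])
    then show "inner (A (Q x)) (Q x) \<le> t * (norm (Q x))\<^sup>2"
      using below_le[OF below_Q, of x] by (intro LIMSEQ_le_const) auto
  qed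
  moreover have "below A t (Q x) = below A t x"
  proof (rule LIMSEQ_unique[OF tendsto_op[OF below_mem lim]])
    show "(\<lambda>n. below A t (below A (?t n) x)) \<longlonglongrightarrow> below A t x"
      by (simp add: below_comp')
  qed
  ultimately show ?thesis
    using lim by simp
qed

definition dist_measure :: "'a \<Rightarrow> real measure"
  where "dist_measure x = interval_measure (\<lambda>t. inner (below A t x) x)"

lemma continuous_below: "continuous (at_right t) (\<lambda>t. inner (below A t x) x)"
  unfolding continuous_within
proof (rule order_tendstoI)
  fix l assume "l < inner (below A t x) x"
  then show "\<forall>\<^sub>F s in at_right t. l < inner (below A s x) x"
    using below_mono[of t _ x] by (auto simp: eventually_at_filter intro!: always_eventually)
      (meson less_le_trans less_imp_le)
next
  fix u assume u: "inner (below A t x) x < u"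
  have "(\<lambda>n. inner (below A (t + 1 / real (Suc n)) x) x) \<longlonglongrightarrow> inner (below A t x) x"
    by (intro tendsto_intros below_tendsto)
  from order_tendstoD(2)[OF this u] obtain n where
    n: "inner (below A (t + 1 / real (Suc n)) x) x < u"
    by (auto simp: eventually_sequentially)
  have "\<forall>\<^sub>F s in at_right t. s \<in> {t<..<t + 1 / real (Suc n)}"
    by (rule eventually_at_right_real) simp
  then show "\<forall>\<^sub>F s in at_right t. inner (below A s x) x < u"
  proof (rule eventually_mono)
    fix s assume "s \<in> {t<..<t + 1 / real (Suc n)}"
    then have "inner (below A s x) x \<le> inner (below A (t + 1 / real (Suc n)) x) x"
      by (intro below_mono) simp
    with n show "inner (below A s x) x < u"
      by linarith
  qed
qed

lemma emeasure_dist_Ioc: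
  "a \<le> b \<Longrightarrow> emeasure (dist_measure x) {a<..b} = inner (below A b x - below A a x) x"
  unfolding dist_measure_def
  by (subst emeasure_interval_measure_Ioc)
    (auto simp: below_mono continuous_below inner_simps)

lemma sets_dist_measure [simp]: "sets (dist_measure x) = sets borel"
  and space_dist_measure [simp]: "space (dist_measure x) = UNIV"
  by (simp_all add: dist_measure_def)

lemma emeasure_dist_UNIV: "emeasure (dist_measure x) UNIV = ennreal ((norm x)\<^sup>2)"
proof (rule LIMSEQ_unique)
  show "(\<lambda>n. emeasure (dist_measure x) (sym_Ioc (Suc n))) \<longlonglongrightarrow> emeasure (dist_measure x) UNIV"
    unfolding sym_Ioc(2)[symmetric]
    by (rule LIMSEQ_Suc, rule Lim_emeasure_incseq[OF _ sym_Ioc(1)]) (simp add: sym_Ioc(3))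
  show "(\<lambda>n. emeasure (dist_measure x) (sym_Ioc (Suc n))) \<longlonglongrightarrow> ennreal ((norm x)\<^sup>2)"
    by (simp add: sym_Ioc_def emeasure_dist_Ioc below_id below_zero power2_norm_eq_inner)
qed

lemma finite_measure_dist: "finite_measure (dist_measure x)"
  by (rule finite_measureI) (simp add: emeasure_dist_UNIV)

lemma measure_dist_Ioc:
  "a \<le> b \<Longrightarrow> measure (dist_measure x) {a<..b} = inner (below A b x - below A a x) x"
  using below_mono[of a b x] by (simp add: measure_def emeasure_dist_Ioc inner_simps)

lemma measure_dist_UNIV: "measure (dist_measure x) UNIV = (norm x)\<^sup>2"
  by (simp add: measure_def emeasure_dist_UNIV)

text \<open>Disjoint unions carry the weight: since the measures add up to at most the total mass,
  the projections are mutually orthogonal, so the partial sums are projections increasing to a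
  strong limit.\<close>

lemma ex_proj_dist:
  assumes "B \<in> sets borel"
  shows "\<exists>Q. proj Q \<and> (\<forall>x. measure (dist_measure x) B = inner (Q x) x)"
  using assms
proof (induction rule: borel_Ioc_induct)
  case (Ioc a b)
  have "proj (\<lambda>x. below A b x - below A a x)"
    by (simp add: proj_def diff_mem below_mem lin[OF below_mem] projD(2)[OF proj_below]
        below_comp[OF Ioc] below_comp'[OF Ioc])
  with Ioc show ?case
    by (intro exI[of _ "\<lambda>x. below A b x - below A a x"]) (simp add: measure_dist_Ioc)
next
  case empty
  then show ?case using proj_zero by (auto intro!: exI[of _ "\<lambda>x. 0"])
next
  case (compl B)
  then obtain Q where Q: "proj Q" "\<And>x. measure (dist_measure x) B = inner (Q x) x" by blast
  with compl(1) have "measure (dist_measure x) (UNIV - B) = inner (x - Q x) x" for x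
    using finite_measure.finite_measure_compl[OF finite_measure_dist, of B x]
    by (simp add: measure_dist_UNIV Q(2) inner_simps power2_norm_eq_inner)
  with proj_compl[OF Q(1)] show ?case by blast
next
  case (union D)
  note D = union(2)
  obtain Q where Q: "\<And>i. proj (Q i)" "\<And>i x. measure (dist_measure x) (D i) = inner (Q i x) x"
    using union(3) by metis
  have orth: "Q i (Q j x) = 0" if "i \<noteq> j" for i j x
  proof -
    let ?y = "Q j x"
    interpret finite_measure "dist_measure ?y" by (rule finite_measure_dist)
    have "measure (dist_measure ?y) (D i \<union> D j) \<le> measure (dist_measure ?y) UNIV"
      using D by (intro finite_measure_mono) auto
    then have "(norm (Q i ?y))\<^sup>2 + (norm ?y)\<^sup>2 \<le> (norm ?y)\<^sup>2"
      using D union(1) that finite_measure_Union[of "D i" "D j"]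
      by (auto simp: Q(2) proj_inner[OF Q(1)] measure_dist_UNIV projD(2)[OF Q(1)]
          disjoint_family_on_def power2_norm_eq_inner)
    then show ?thesis by simp
  qed
  define S where "S n x = (\<Sum>i<n. Q i x)" for n x
  have S0: "S 0 x = 0" and SSuc: "S (Suc n) x = S n x + Q n x" for n x
    by (simp_all add: S_def)
  have SW: "S n \<in> W" for n
    unfolding S_def[abs_def] by (intro sum_mem projD Q(1))
  have SS: "S m (S n x) = S n x" if "n \<le> m" for m n x
  proof -
    have "S m (Q j x) = Q j x" if "j < m" for j x
      using that orth projD(2)[OF Q(1)] by (simp add: S_def sum.remove[of "{..<m}" j])
    then have "(\<Sum>j<n. S m (Q j x)) = S n x"
      using that by (simp add: S_def[of n])
    moreover have "S m (S k x) = (\<Sum>j<k. S m (Q j x))" for k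
      by (induction k) (simp_all add: S0 SSuc lin[OF SW])
    ultimately show ?thesis by simp
  qed
  have S: "proj (S n)" for n
    using SS[of n n] by (simp add: proj_def SW)
  have "(norm (S m x - S n x))\<^sup>2 = (norm (S m x))\<^sup>2 - (norm (S n x))\<^sup>2" if "n \<le> m" for m n x
  proof -
    have "inner (S m x) (S n x) = inner x (S n x)"
      by (simp add: swap[OF SW] SS[OF that])
    also have "\<dots> = (norm (S n x))\<^sup>2"
      by (metis inner_commute S proj_inner)
    finally show ?thesis
      by (simp add: power2_norm_eq_inner inner_simps inner_commute)
  qed
  then have conv: "convergent (\<lambda>n. S n x)" for x
    by (intro convergent_if_norm_sq_le[where a = "\<lambda>n. (norm (S n x))\<^sup>2" and B = "(norm x)\<^sup>2"])
      (auto intro: power_mono proj_norm_le[OF S])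
  define R where "R x = lim (\<lambda>n. S n x)" for x
  have lim: "(\<lambda>n. S n x) \<longlonglongrightarrow> R x" for x
    using conv by (simp add: R_def convergent_LIMSEQ_iff)
  have "(\<lambda>i. inner (Q i x) x) sums inner (R x) x" for x
    using tendsto_inner[OF lim[of x] tendsto_const[of x]]
    by (simp add: sums_def S_def inner_sum_left)
  moreover have "(\<lambda>i. inner (Q i x) x) sums measure (dist_measure x) (\<Union>i. D i)" for x
    using finite_measure.finite_measure_UNION[OF finite_measure_dist _ union(1)] D
    by (simp add: Q(2))
  ultimately have "measure (dist_measure x) (\<Union>i. D i) = inner (R x) x" for x
    by (rule sums_unique2[rotated])
  with proj_limit[OF S lim] show ?case by blast
qed

end

definition spectral_proj :: "('a \<Rightarrow> 'a) \<Rightarrow> real set \<Rightarrow> 'a \<Rightarrow> 'a"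
  where "spectral_proj A B =
    (SOME Q. proj Q \<and> (\<forall>x. measure (dist_measure A x) B = inner (Q x) x))"

end

context comm_ops
begin

lemma spectral_proj:
  assumes "contraction A" "B \<in> sets borel"
  shows "proj (spectral_proj A B)" "inner (spectral_proj A B x) x = measure (dist_measure A x) B"
proof -
  note * = someI_ex[OF ex_proj_dist[OF assms], folded spectral_proj_def]
  show "proj (spectral_proj A B)"
    using * by (rule conjunct1)
  show "inner (spectral_proj A B x) x = measure (dist_measure A x) B"
    using *[THEN conjunct2, THEN spec, of x] by (simp only:)
qed

lemma form_pvm_spectral_proj:
  assumes A: "contraction A"
  shows "form_pvm borel (spectral_proj A)"
proof
  note E = spectral_proj[OF A]
  fix B :: "real set" assume B: "B \<in> sets borel"
  show "symmetric_op (spectral_proj A B)"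
    by (rule sym[OF projD(1)[OF E(1)[OF B]]])
  show "0 \<le> inner (spectral_proj A B x) x" for x
    by (simp add: E(2)[OF B])
  show "spectral_proj A B (spectral_proj A B x) = spectral_proj A B x" for x
    by (rule projD(2)[OF E(1)[OF B]])
next
  note E = spectral_proj[OF A]
  fix D :: "nat \<Rightarrow> real set" and x
  assume D: "range D \<subseteq> sets borel" "disjoint_family D"
  have "(\<lambda>n. measure (dist_measure A x) (D n)) sums measure (dist_measure A x) (\<Union>n. D n)"
    using D by (intro finite_measure.finite_measure_UNION finite_measure_dist[OF A])
      (simp_all add: sets_dist_measure[OF A])
  moreover have "inner (spectral_proj A (D n) x) x = measure (dist_measure A x) (D n)" for n
    using D(1) by (intro E(2)) auto
  moreover have "inner (spectral_proj A (\<Union>n. D n) x) x = measure (dist_measure A x) (\<Union>n. D n)"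
    using D(1) by (intro E(2) sets.countable_nat_UN)
  ultimately show "(\<lambda>n. inner (spectral_proj A (D n) x) x) sums
      inner (spectral_proj A (\<Union>n. D n) x) x"
    by simp
next
  note E = spectral_proj[OF A]
  fix x
  have "spectral_proj A UNIV = (\<lambda>x. x)"
    by (rule symmetric_op_eqI[OF sym[OF projD(1)[OF E(1)]] symmetric_op_id])
      (simp_all add: E(2) measure_dist_UNIV[OF A] power2_norm_eq_inner)
  then show "spectral_proj A (space borel) x = x"
    by simp
qed

lemma spectral_proj_Ioc:
  assumes A: "contraction A" and "a \<le> b"
  shows "spectral_proj A {a<..b} x = below A b x - below A a x"
proof -
  have "spectral_proj A {a<..b} = (\<lambda>x. below A b x - below A a x)"
    using assms by (intro symmetric_op_eqI sym projD spectral_proj diff_mem below_mem)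
      (simp_all add: spectral_proj measure_dist_Ioc)
  then show ?thesis by simp
qed

lemma spectral_proj_Ioc_bounds:
  assumes A: "contraction A" and ab: "a \<le> b" and z: "spectral_proj A {a<..b} z = z"
  shows "a * (norm z)\<^sup>2 \<le> inner (A z) z" "inner (A z) z \<le> b * (norm z)\<^sup>2"
proof -
  have z': "z = below A b z - below A a z"
    using z spectral_proj_Ioc[OF A ab] by simp
  have "below A b (below A b z - below A a z) = below A b z - below A a z"
    by (simp add: lin[OF below_mem[OF A]] projD(2)[OF proj_below[OF A]] below_comp[OF A ab])
  then have "below A b z = z"
    unfolding z'[symmetric] .
  then show "inner (A z) z \<le> b * (norm z)\<^sup>2"
    by (rule below_le[OF A])
  have "below A a (below A b z - below A a z) = 0"
    by (simp add: lin[OF below_mem[OF A]] projD(2)[OF proj_below[OF A]] below_comp'[OF A ab])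
  then have "below A a z = 0"
    unfolding z'[symmetric] .
  then show "a * (norm z)\<^sup>2 \<le> inner (A z) z"
    by (rule below_ge[OF A])
qed

text \<open>Riemann sums: on a piece of length \<open>1 / N\<close> the form of \<open>A\<close> and
  the integral both lie between the end-points times the mass, so the errors add up to at most
  \<open>(norm x)\<^sup>2 / N\<close>.\<close>

lemma spectral_form:
  assumes A: "contraction A"
  defines "nu \<equiv> form_measure borel (spectral_proj A)"
  shows "integrable (nu x) (\<lambda>l. l)" "inner (A x) x = (\<integral>l. l \<partial>nu x)"
proof -
  interpret E: form_pvm borel "spectral_proj A"
    by (rule form_pvm_spectral_proj[OF A])
  have nu: "nu = E.nu"
    by (simp add: nu_def)
  interpret finite_measure "nu x"
    unfolding nu by (rule E.finite_measure_nu)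
  define E where "E = spectral_proj A"
  have EW: "proj (E B)" if "B \<in> sets borel" for B
    unfolding E_def by (rule spectral_proj[OF A that])
  have full: "E {-1<..1} x = x"
    by (simp add: E_def spectral_proj_Ioc[OF A] below_id[OF A] below_zero[OF A])
  have AE: "AE l in nu x. l \<in> {-1<..1}"
    unfolding nu by (rule E.AE_nu) (use full in \<open>simp_all add: E_def\<close>)
  have meas: "(\<lambda>l. l) \<in> borel_measurable (nu x)"
    by (simp add: nu)
  show int: "integrable (nu x) (\<lambda>l. l)"
    by (rule integrable_const_bound[where B = 1, OF _ meas]) (use AE in \<open>eventually_elim, auto\<close>)
  have int': "integrable (nu x) (\<lambda>l. indicator B l * l)" if "B \<in> sets borel" for B
    using integrable_real_mult_indicator[of B "nu x", OF _ int] that by (simp add: nu mult.commute)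
  have bound: "\<bar>inner (A x) x - (\<integral>l. l \<partial>nu x)\<bar> \<le> inverse (real N) * (norm x)\<^sup>2" if N: "N > 0" for N :: nat
  proof -
    \<comment> \<open>The grid starts at -1 rather than 0, so that the half-open pieces catch an
      atom at 0; it reaches 1 at \<open>k = 2 * N\<close>.\<close>
    define t where "t k = -1 + real k / real N" for k
    have t: "-1 \<le> t k" "t k \<le> t (Suc k)" "t (Suc k) = t k + inverse (real N)" for k
      using N by (simp_all add: t_def field_simps)
    define y where "y k = E {-1<..t k} x" for k
    have "\<bar>inner (A (y k)) (y k) - (\<integral>l. indicator {-1<..t k} l * l \<partial>nu x)\<bar> \<le> inverse (real N) * (norm (y k))\<^sup>2" for k
    proof (induction k)
      case 0
      have "y 0 = 0"
        using E.empty by (simp add: y_def t_def E_def)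
      then show ?case
        by (simp add: t_def lin[OF contractionD(1)[OF A]])
    next
      case (Suc k)
      let ?I = "{t k<..t (Suc k)}" and ?J = "{-1<..t k}"
      define w where "w = E ?I x"
      have un: "?J \<union> ?I = {-1<..t (Suc k)}" and disj: "?J \<inter> ?I = {}"
        using t(1,2)[of k] by auto
      have add: "y (Suc k) = y k + w"
        using E.additive[of ?J ?I x, OF _ _ disj] unfolding un by (simp add: y_def w_def E_def)
      have Jw: "E ?J w = 0" and Jy: "E ?J (y k) = y k" and Iw: "E ?I w = w"
        using E.disjoint[of ?J ?I x, OF _ _ disj] E.idem[of ?J x] E.idem[of ?I x]
        by (simp_all add: y_def w_def E_def)
      have J: "E ?J (y (Suc k)) = y k"
        by (simp add: add Jw Jy lin[OF projD(1)[OF EW]])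
      have 1: "inner (A (y (Suc k))) (y (Suc k)) = inner (A (y k)) (y k) + inner (A w) w"
        using inner_split[OF EW[of ?J] contractionD(1)[OF A], of "y (Suc k)"] by (simp add: J) (simp add: add)
      have 2: "(norm (y (Suc k)))\<^sup>2 = (norm (y k))\<^sup>2 + (norm w)\<^sup>2"
        using proj_pythagoras[OF EW[of ?J], of "y (Suc k)"] by (simp add: J) (simp add: add)
      have "indicator {-1<..t (Suc k)} l * l = indicator ?J l * l + indicator ?I l * l" for l :: real
        using disj unfolding un[symmetric] by (auto simp: indicator_def)
      then have 3: "(\<integral>l. indicator {-1<..t (Suc k)} l * l \<partial>nu x) =
          (\<integral>l. indicator ?J l * l \<partial>nu x) + (\<integral>l. indicator ?I l * l \<partial>nu x)"
        by (simp add: int')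
      have m: "measure (nu x) ?I = (norm w)\<^sup>2"
        unfolding nu by (simp add: E.measure_nu' w_def E_def)
      have c: "integrable (nu x) (\<lambda>l. indicator ?I l * c)" "(\<integral>l. indicator ?I l * c \<partial>nu x) = c * (norm w)\<^sup>2" for c :: real
        using integrable_real_mult_indicator[of ?I "nu x", OF _ integrable_const[of c]] m
        by (simp_all add: nu mult.commute[of c])
      have lo: "t k * (norm w)\<^sup>2 \<le> (\<integral>l. indicator ?I l * l \<partial>nu x)"
        unfolding c(2)[symmetric] by (rule integral_mono[OF c(1) int']) (auto simp: indicator_def)
      have hi: "(\<integral>l. indicator ?I l * l \<partial>nu x) \<le> t (Suc k) * (norm w)\<^sup>2"
        unfolding c(2)[symmetric] by (rule integral_mono[OF int' c(1)]) (auto simp: indicator_def)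
      have "t (Suc k) * (norm w)\<^sup>2 = t k * (norm w)\<^sup>2 + inverse (real N) * (norm w)\<^sup>2"
        unfolding t(3) by (rule distrib_right)
      with lo hi spectral_proj_Ioc_bounds[OF A t(2)[of k], folded E_def, OF Iw]
      have "\<bar>inner (A w) w - (\<integral>l. indicator ?I l * l \<partial>nu x)\<bar> \<le> inverse (real N) * (norm w)\<^sup>2"
        unfolding abs_le_iff by linarith
      with Suc show ?case
        unfolding 1 2 3 abs_le_iff distrib_left by linarith
    qed
    from this[of "2 * N"] have "\<bar>inner (A x) x - (\<integral>l. indicator {-1<..1} l * l \<partial>nu x)\<bar> \<le> inverse (real N) * (norm x)\<^sup>2"
      using N full by (simp add: y_def t_def)
    moreover have "(\<integral>l. indicator {-1<..1} l * l \<partial>nu x) = (\<integral>l. l \<partial>nu x)"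
      by (rule integral_cong_AE) (use AE in \<open>simp_all add: nu, eventually_elim, auto\<close>)
    ultimately show ?thesis by simp
  qed
  have "(\<lambda>n. inverse (real (Suc n)) * (norm x)\<^sup>2) \<longlonglongrightarrow> 0 * (norm x)\<^sup>2"
    by (intro tendsto_intros LIMSEQ_inverse_real_of_nat)
  then have "\<bar>inner (A x) x - (\<integral>l. l \<partial>nu x)\<bar> \<le> 0 * (norm x)\<^sup>2"
    by (rule LIMSEQ_le_const) (use bound in blast)
  then show "inner (A x) x = (\<integral>l. l \<partial>nu x)"
    by simp
qed

end


section \<open>Digits of a point of the Cantor set\<close>

text \<open>On the Cantor set \<open>2 * tdig m l\<close> is the ternary digit of \<open>l\<close> with index \<open>m\<close>, and \<open>trem m l\<close> is
  the remainder shifted by \<open>m\<close> places.\<close>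

primrec trem :: "nat \<Rightarrow> real \<Rightarrow> real"
  where "trem 0 l = l"
  | "trem (Suc m) l = 3 * trem m l - 2 * indicator {1/2..} (trem m l)"

text \<open>The threshold 1/2 lies in the gap between the two parts of \<open>cantor_pieces\<close>,
  so the indicator is continuous on them.\<close>

definition tdig :: "nat \<Rightarrow> real \<Rightarrow> real"
  where "tdig m l = indicator {1/2..} (trem m l)"

lemma trem_Suc: "trem (Suc m) l = 3 * trem m l - 2 * tdig m l"
  by (simp add: tdig_def)

lemma measurable_trem [measurable]: "trem m \<in> borel_measurable borel"
proof (induction m)
  case (Suc m)
  then have [measurable]: "trem m \<in> borel_measurable borel" .
  show ?case
    unfolding trem.simps[abs_def] by measurable
qed (simp add: trem.simps[abs_def])

lemma measurable_tdig [measurable]: "tdig m \<in> borel_measurable borel"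
  unfolding tdig_def[abs_def] by measurable

lemma tdig_range: "tdig m l \<in> {0, 1}"
  by (simp add: tdig_def indicator_def)

definition cantor_pieces :: "real set"
  where "cantor_pieces = {0..1/3} \<union> {2/3..1}"

definition cantor :: "real set"
  where "cantor = {l. \<forall>m. trem m l \<in> cantor_pieces}"

lemma closed_cantor_pieces: "closed cantor_pieces"
  by (simp add: cantor_pieces_def closed_Un)

text \<open>Closedness and continuity need each other: \<open>trem (Suc m)\<close> is continuous
  where the digit \<open>tdig m\<close> is, namely on \<open>C m\<close>, and its preimage of the
  pieces cuts the next closed set out of \<open>C m\<close>.\<close>

lemma cantor_approx:
  defines "C \<equiv> \<lambda>m. {l. \<forall>i\<le>m. trem i l \<in> cantor_pieces}"
  shows "closed (C m) \<and> continuous_on (C m) (trem m) \<and> continuous_on (C m) (tdig m)"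
proof -
  have ind: "continuous_on cantor_pieces (indicator {1/2..} :: real \<Rightarrow> real)"
    unfolding cantor_pieces_def
  proof (rule continuous_on_closed_Un)
    show "continuous_on {0..1/3} (indicator {1/2..} :: real \<Rightarrow> real)"
      by (rule continuous_on_eq[OF continuous_on_const[of _ 0]]) (auto simp: indicator_def)
    show "continuous_on {2/3..1} (indicator {1/2..} :: real \<Rightarrow> real)"
      by (rule continuous_on_eq[OF continuous_on_const[of _ 1]]) (auto simp: indicator_def)
  qed auto
  have dig: "continuous_on (C m) (tdig m)" if "continuous_on (C m) (trem m)" for m
    unfolding tdig_def[abs_def]
    by (rule continuous_on_compose2[OF ind that]) (auto simp: C_def)
  show ?thesis
  proof (induction m)
    case 0
    have "continuous_on (C 0) (trem 0)"
      unfolding trem.simps[abs_def] by (rule continuous_on_id)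
    moreover have "C 0 = cantor_pieces"
      by (simp add: C_def)
    ultimately show ?case
      using dig[of 0] closed_cantor_pieces by simp
  next
    case (Suc m)
    have cont: "continuous_on (C m) (trem (Suc m))"
      unfolding trem_Suc[abs_def] using Suc by (intro continuous_intros) auto
    have "C (Suc m) = C m \<inter> trem (Suc m) -` cantor_pieces"
      by (auto simp: C_def le_Suc_eq simp del: trem.simps)
    then have "closed (C (Suc m))"
      using continuous_closed_preimage[OF cont _ closed_cantor_pieces] Suc by simp
    moreover have "continuous_on (C (Suc m)) (trem (Suc m))"
      by (rule continuous_on_subset[OF cont]) (auto simp: C_def)
    ultimately show ?case
      using dig by blast
  qed
qed

lemma closed_cantor: "closed cantor"
proof -
  have eq: "cantor = (\<Inter>m. {l. \<forall>i\<le>m. trem i l \<in> cantor_pieces})"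
    by (auto simp: cantor_def)
  show ?thesis
    unfolding eq using cantor_approx by (intro closed_INT) blast
qed

lemma continuous_tdig: "continuous_on cantor (tdig m)"
  by (rule continuous_on_subset[of "{l. \<forall>i\<le>m. trem i l \<in> cantor_pieces}"])
    (use cantor_approx in \<open>auto simp: cantor_def\<close>)

lemma trem_range: "l \<in> cantor \<Longrightarrow> trem m l \<in> {0..1}"
  by (auto simp: cantor_def cantor_pieces_def dest: spec[of _ m])

lemma cantor_subset: "cantor \<subseteq> {0..1}"
  using trem_range[of _ 0] by auto

text \<open>With equal digits the difference of the remainders triples at each step, while the
  remainders stay in \<open>[0, 1]\<close>.\<close>

lemma cantor_eqI:
  assumes "l \<in> cantor" "l' \<in> cantor" and dig: "\<And>m. tdig m l = tdig m l'"
  shows "l = l'"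
proof (rule ccontr)
  assume "l \<noteq> l'"
  have diff: "trem m l - trem m l' = 3 ^ m * (l - l')" for m
    by (induction m) (simp_all add: trem_Suc dig algebra_simps del: trem.simps(2))
  have "\<bar>trem m l - trem m l'\<bar> \<le> 1" for m
    using trem_range[OF assms(1), of m] trem_range[OF assms(2), of m] by auto
  then have *: "3 ^ m * \<bar>l - l'\<bar> \<le> 1" for m
    by (simp add: diff abs_mult)
  obtain m where "1 / \<bar>l - l'\<bar> < 3 ^ m"
    using real_arch_pow[of 3] by auto
  then have "1 < 3 ^ m * \<bar>l - l'\<bar>"
    using \<open>l \<noteq> l'\<close> by (simp add: divide_less_eq)
  with *[of m] show False by simp
qed

text \<open>\<open>e\<close> tells at which ternary places the binary digits of one operator are
  stored; the shift by \<open>j\<close> gives the scalar counterpart of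
  \<open>resid T j\<close>.\<close>

definition bsum :: "(nat \<Rightarrow> nat) \<Rightarrow> nat \<Rightarrow> real \<Rightarrow> real"
  where "bsum e j l = (\<Sum>k. (1/2) ^ Suc k * tdig (e (j + k)) l)"

lemma summable_half: "summable (\<lambda>k. (1/2 :: real) ^ Suc k)"
  using power_half_series by (rule sums_summable)

lemma tdig_bound: "norm ((1/2) ^ Suc k * tdig m l) \<le> (1/2) ^ Suc k"
  using tdig_range[of m l] by auto

lemma bsum_sums: "(\<lambda>k. (1/2) ^ Suc k * tdig (e (j + k)) l) sums bsum e j l"
  unfolding bsum_def
  by (rule summable_sums[OF summable_comparison_test'[OF summable_half tdig_bound]])

lemma bsum_range: "0 \<le> bsum e j l" "bsum e j l \<le> 1"
proof -
  show "0 \<le> bsum e j l"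
    by (rule sums_le[OF _ sums_zero bsum_sums]) (use tdig_range in \<open>auto simp: tdig_def\<close>)
  show "bsum e j l \<le> 1"
    by (rule sums_le[OF _ bsum_sums power_half_series]) (use tdig_bound in \<open>auto simp: abs_le_iff\<close>)
qed

lemma bsum_Suc: "bsum e (Suc j) l = 2 * bsum e j l - tdig (e j) l"
proof -
  have "(\<lambda>k. (1/2) ^ Suc (Suc k) * tdig (e (j + Suc k)) l) sums (bsum e j l - (1/2) ^ Suc 0 * tdig (e (j + 0)) l)"
    using bsum_sums[of e j l] by (subst sums_Suc_iff) simp
  then have "(\<lambda>k. 2 * ((1/2) ^ Suc (Suc k) * tdig (e (j + Suc k)) l)) sums
      (2 * (bsum e j l - (1/2) ^ Suc 0 * tdig (e (j + 0)) l))"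
    by (rule sums_mult)
  then have "(\<lambda>k. (1/2) ^ Suc k * tdig (e (Suc j + k)) l) sums (2 * bsum e j l - tdig (e j) l)"
    by (simp add: algebra_simps)
  with bsum_sums show ?thesis
    by (rule sums_unique2)
qed

lemma measurable_bsum [measurable]: "bsum e j \<in> borel_measurable borel"
  unfolding bsum_def[abs_def] by measurable

lemma continuous_bsum: "continuous_on cantor (bsum e j)"
proof (rule uniform_limit_theorem)
  show "uniform_limit cantor (\<lambda>n l. \<Sum>k<n. (1/2) ^ Suc k * tdig (e (j + k)) l) (bsum e j) sequentially"
    unfolding bsum_def[abs_def] by (rule Weierstrass_m_test[OF tdig_bound summable_half])
qed (auto intro!: always_eventually continuous_on_sum continuous_on_mult continuous_on_const
    continuous_tdig simp del: power_Suc)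

section \<open>Simultaneous diagonalization\<close>

context comm_ops
begin

text \<open>The tails \<open>A m\<close> and the remainders \<open>trem m\<close> obey the same
  recursion, so the integral formula passes from \<open>m\<close> to \<open>Suc m\<close> once
  \<open>Q m\<close> is known to be the digit. That follows from the gap: the form of
  \<open>A m\<close>, relative to the squared norm, is at most 1/3 on the kernel of
  \<open>Q m\<close> and at least 2/3 on its range.\<close>

lemma ternary_spectral_proj:
  assumes Q: "\<And>m. proj (Q m)" and A: "\<And>m. contraction (A m)"
    and rec: "\<And>m x. A m x = (2/3) *\<^sub>R Q m x + (1/3) *\<^sub>R A (Suc m) x"
  defines "E \<equiv> spectral_proj (A 0)"
  shows "E {l. trem m l \<notin> cantor_pieces} x = 0" "E {l. tdig m l = 1} x = Q m x"
proof -
  interpret E: form_pvm borel E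
    unfolding E_def by (rule form_pvm_spectral_proj[OF A])
  have EW: "E B \<in> W" if "B \<in> sets borel" for B
    unfolding E_def using projD(1)[OF spectral_proj(1)[OF A that]] .
  have QW: "Q m \<in> W" for m
    by (rule projD(1)[OF Q])
  have ge: "z = 0" if B: "B \<in> sets borel" and z: "E B z = z" and h: "integrable (E.nu z) h"
    and hB: "\<And>l. l \<in> B \<Longrightarrow> c < h l" and int: "(\<integral>l. h l \<partial>E.nu z) \<le> c * (norm z)\<^sup>2" for B z c and h :: "real \<Rightarrow> real"
  proof (rule E.zero_if_integral_nonpos[OF B z])
    interpret finite_measure "E.nu z" by (rule E.finite_measure_nu)
    show "integrable (E.nu z) (\<lambda>l. h l - c)"
      using h by simp
    show "(\<integral>l. h l - c \<partial>E.nu z) \<le> 0"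
      using h int E.measure_space_nu[of z] by (simp add: mult.commute)
  qed (use hB in auto)
  have le: "z = 0" if "B \<in> sets borel" and "E B z = z" and h: "integrable (E.nu z) h"
    and "\<And>l. l \<in> B \<Longrightarrow> h l < c" and int: "c * (norm z)\<^sup>2 \<le> (\<integral>l. h l \<partial>E.nu z)" for B z c and h :: "real \<Rightarrow> real"
    by (rule ge[where h = "\<lambda>l. - h l" and c = "- c"]) (use that in auto)
  have step: "(E {l. trem m l \<notin> cantor_pieces} x = 0) \<and> E {l. tdig m l = 1} x = Q m x"
    if int: "\<And>x. integrable (E.nu x) (trem m)" and form: "\<And>x. inner (A m x) x = (\<integral>l. trem m l \<partial>E.nu x)" for m x
  proof -
    define B1 B2 B3 where "B1 = {l. 1/3 < trem m l}" and "B2 = {l. trem m l < 2/3}"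
      and "B3 = {l. tdig m l = 1}"
    have B [measurable]: "B1 \<in> sets borel" "B2 \<in> sets borel" "B3 \<in> sets borel"
      unfolding B1_def B2_def B3_def by measurable
    have 1: "E B1 x = E B1 (Q m x)" for x
    proof -
      define z where "z = E B1 (x - Q m x)"
      have "Q m z = 0"
        by (simp add: z_def comm[OF QW EW[OF B(1)]] lin[OF QW] projD(2)[OF Q] lin[OF EW[OF B(1)]])
      then have "inner (A m z) z \<le> 1/3 * (norm z)\<^sup>2"
        using contractionD(3)[OF A, of "Suc m" z] by (simp add: rec[of m])
      then have "z = 0"
        unfolding form by (rule ge[OF B(1) _ int, rotated -1]) (simp_all add: z_def E.idem B1_def B2_def)
      then show ?thesis
        by (simp add: z_def lin[OF EW[OF B(1)]])
    qed
    have 2: "E B2 (Q m x) = 0" for x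
    proof -
      define z where "z = E B2 (Q m x)"
      have "Q m z = z"
        by (simp add: z_def comm[OF QW EW[OF B(2)]] projD(2)[OF Q])
      then have "2/3 * (norm z)\<^sup>2 \<le> inner (A m z) z"
        using contractionD(2)[OF A, of "Suc m" z] by (simp add: rec[of m] inner_simps power2_norm_eq_inner)
      then have "z = 0"
        unfolding form by (rule le[OF B(2) _ int, rotated -1]) (simp_all add: z_def E.idem B1_def B2_def)
      then show ?thesis
        by (simp add: z_def)
    qed
    have sub: "B3 \<inter> B1 = B3" "(UNIV - B3) \<inter> B2 = UNIV - B3"
      by (auto simp: B1_def B2_def B3_def tdig_def indicator_def split: if_splits)
    have "E B3 x = E B3 (E B1 x)"
      by (simp add: E.comp sub)
    also have "\<dots> = E B3 (E B1 (Q m x))"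
      by (simp only: 1[of x])
    also have "\<dots> = E B3 (Q m x)"
      by (simp add: E.comp sub)
    also have "\<dots> = Q m x - E (UNIV - B3) (Q m x)"
      using E.compl[of B3 "Q m x"] by simp
    also have "E (UNIV - B3) (Q m x) = E (UNIV - B3) (E B2 (Q m x))"
      using E.comp[of "UNIV - B3" B2] sub by simp
    also have "\<dots> = 0"
      by (simp add: 2 lin[OF EW])
    finally have Q_eq: "E B3 x = Q m x"
      by simp
    have low: "E {l. trem m l < 0} x = 0" for x
      by (rule le[where h = "trem m" and c = 0 and B = "{l. trem m l < 0}"])
        (use int contractionD(2)[OF A, of m] in \<open>simp_all add: E.idem form\<close>)
    have high: "E {l. 1 < trem m l} x = 0" for x
      by (rule ge[where h = "trem m" and c = 1 and B = "{l. 1 < trem m l}"])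
        (use int contractionD(3)[OF A, of m] in \<open>simp_all add: E.idem form\<close>)
    \<comment> \<open>The middle gap carries no mass: above 1/3 only the range of \<open>Q m\<close>
      contributes, and below 2/3 this range contributes nothing.\<close>
    have mid: "E (B1 \<inter> B2) x = 0" for x
    proof -
      have "E (B1 \<inter> B2) x = E B2 (E B1 x)"
        by (simp add: E.comp Int_commute)
      also have "\<dots> = E B1 (E B2 (Q m x))"
        using E.commute[OF B(2,1), of "Q m x"] by (simp only: 1[of x])
      finally show ?thesis
        by (simp add: 2 lin[OF EW])
    qed
    have "E {l. trem m l \<notin> cantor_pieces} x
        = E (\<Union>i\<in>{0, 1, 2 :: nat}. if i = 0 then {l. trem m l < 0} else if i = 1 then {l. 1 < trem m l} else B1 \<inter> B2) x"
      by (rule arg_cong2[where f = E]) (auto simp: cantor_pieces_def B1_def B2_def)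
    also have "\<dots> = 0"
      by (rule E.null_countable_Un) (auto simp: low high mid)
    finally show ?thesis
      using Q_eq by (simp add: B3_def)
  qed
  have "(\<forall>x. integrable (E.nu x) (trem m)) \<and> (\<forall>x. inner (A m x) x = (\<integral>l. trem m l \<partial>E.nu x))" for m
  proof (induction m)
    case 0
    show ?case
      using spectral_form[OF A[of 0]] unfolding E_def trem.simps(1) by simp
  next
    case (Suc m)
    then have int: "integrable (E.nu x) (trem m)" and form: "inner (A m x) x = (\<integral>l. trem m l \<partial>E.nu x)" for x
      by auto
    note Q_eq = step[OF int form, THEN conjunct2]
    have [measurable]: "{l. tdig m l = 1} \<in> sets borel"
      by measurable
    have tdig: "tdig m = indicator {l. tdig m l = 1}"
      using tdig_range[of m] by (auto simp: fun_eq_iff indicator_def)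
    have dig: "integrable (E.nu x) (tdig m)" "(\<integral>l. tdig m l \<partial>E.nu x) = inner (Q m x) x" for x
    proof -
      interpret finite_measure "E.nu x" by (rule E.finite_measure_nu)
      show "integrable (E.nu x) (tdig m)" "(\<integral>l. tdig m l \<partial>E.nu x) = inner (Q m x) x"
        by (subst tdig, simp add: E.measure_nu Q_eq less_top[symmetric])+
    qed
    have "inner (A (Suc m) x) x = 3 * inner (A m x) x - 2 * inner (Q m x) x" for x
      by (simp add: rec[of m] inner_simps)
    then show ?case
      unfolding trem_Suc[abs_def] using int dig form by simp
  qed
  then show "E {l. trem m l \<notin> cantor_pieces} x = 0" "E {l. tdig m l = 1} x = Q m x"
    using step by blast+
qed

text \<open>Termwise integration of the digit series settles \<open>j = 0\<close>; from there on
  \<open>resid\<close> and \<open>bsum\<close> satisfy the same recursion.\<close>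

lemma binary_form:
  assumes E: "form_pvm borel E" and T: "contraction T"
    and dig: "\<And>k x. E {l. tdig (e k) l = 1} x = digit T k x"
  shows "integrable (form_measure borel E x) (bsum e j)"
    "inner (resid T j x) x = (\<integral>l. bsum e j l \<partial>form_measure borel E x)"
proof -
  interpret E: form_pvm borel E by (rule E)
  have tdig: "tdig m = indicator {l. tdig m l = 1}" for m
    using tdig_range[of m] by (auto simp: fun_eq_iff indicator_def)
  have [measurable]: "{l. tdig m l = 1} \<in> sets borel" for m
    by measurable
  have fin: "finite_measure (E.nu x)" for x
    by (rule E.finite_measure_nu)
  show int: "integrable (E.nu x) (bsum e j)" for x j
    by (rule finite_measure.integrable_const_bound[OF fin, where B = 1]) (simp_all add: bsum_range)
  have d: "integrable (E.nu x) (tdig (e k))" "(\<integral>l. tdig (e k) l \<partial>E.nu x) = inner (digit T k x) x" for x k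
  proof -
    interpret finite_measure "E.nu x" by (rule fin)
    show "integrable (E.nu x) (tdig (e k))" "(\<integral>l. tdig (e k) l \<partial>E.nu x) = inner (digit T k x) x"
      by (subst tdig, simp add: E.measure_nu dig less_top[symmetric])+
  qed
  have form0: "inner (T x) x = (\<integral>l. bsum e 0 l \<partial>E.nu x)" for x
  proof -
    have "(\<lambda>k. inner ((1/2) ^ Suc k *\<^sub>R digit T k x) x) sums inner (T x) x"
      by (rule bounded_linear.sums[OF bounded_linear_inner_left resid_sums[OF T]])
    then have 1: "(\<lambda>k. (1/2) ^ Suc k * inner (digit T k x) x) sums inner (T x) x"
      by simp
    have "(\<lambda>k. \<integral>l. (1/2) ^ Suc k * tdig (e k) l \<partial>E.nu x) sums
        (\<integral>l. (\<Sum>k. (1/2) ^ Suc k * tdig (e k) l) \<partial>E.nu x)"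
    proof (rule sums_integral)
      show "integrable (E.nu x) (\<lambda>l. (1/2) ^ Suc k * tdig (e k) l)" for k
        using d(1) by simp
      show "AE l in E.nu x. summable (\<lambda>k. norm ((1/2) ^ Suc k * tdig (e k) l))"
        by (rule AE_I2, rule summable_comparison_test'[OF summable_half]) (use tdig_bound in simp)
      have "(\<integral>l. norm ((1/2) ^ Suc k * tdig (e k) l) \<partial>E.nu x) = (1/2) ^ Suc k * inner (digit T k x) x" for k
      proof -
        have "norm ((1/2) ^ Suc k * tdig (e k) l) = (1/2) ^ Suc k * tdig (e k) l" for l
          using tdig_range[of "e k" l] by auto
        then show ?thesis
          using d(2)[of x k] by (simp only: integral_mult_right_zero)
      qed
      then show "summable (\<lambda>k. \<integral>l. norm ((1/2) ^ Suc k * tdig (e k) l) \<partial>E.nu x)"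
        using sums_summable[OF 1] by (simp only:)
    qed
    moreover have "(\<integral>l. (1/2) ^ Suc k * tdig (e k) l \<partial>E.nu x) = (1/2) ^ Suc k * inner (digit T k x) x" for k
      using d(2)[of x k] by (simp only: integral_mult_right_zero)
    ultimately have "(\<lambda>k. (1/2) ^ Suc k * inner (digit T k x) x) sums (\<integral>l. bsum e 0 l \<partial>E.nu x)"
      by (simp only: bsum_def add_0)
    with 1 show ?thesis
      by (rule sums_unique2)
  qed
  have "\<forall>x. inner (resid T j x) x = (\<integral>l. bsum e j l \<partial>E.nu x)"
  proof (induction j)
    case (Suc j)
    then show ?case
      unfolding bsum_Suc[abs_def] resid_Suc using int d by (simp add: inner_simps)
  qed (simp add: form0)
  then show "inner (resid T j x) x = (\<integral>l. bsum e j l \<partial>E.nu x)"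
    by blast
qed

text \<open>Both conditions on \<open>l\<close> describe the spectral projection of
  \<open>resid T j\<close> above 1/2, one through \<open>digit\<close>, the other through the
  integral formula; so they differ on a null set.\<close>

lemma binary_digit:
  assumes E: "form_pvm borel E" "\<And>B. B \<in> sets borel \<Longrightarrow> E B \<in> W" and T: "contraction T"
    and dig: "\<And>k x. E {l. tdig (e k) l = 1} x = digit T k x"
  shows "E {l. \<not> (tdig (e j) l = 1 \<longleftrightarrow> 1/2 < bsum e j l)} x = 0"
proof -
  interpret E: form_pvm borel E by (rule E)
  define S where "S x = resid T j x - (1/2) *\<^sub>R x" for x
  define P where "P = digit T j"
  have SW: "S \<in> W"
    unfolding S_def[abs_def] by (intro diff_mem scale_mem id_mem contractionD[OF contraction_resid[OF T]])
  have P: "proj P" and P_cut: "P = cut_proj S"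
    unfolding P_def S_def[abs_def] digit_def
    using proj_digit[OF T, of j] by (simp_all add: digit_def)
  let ?D = "{l. 1/2 < bsum e j l}" and ?B = "{l. tdig (e j) l = 1}"
  have [measurable]: "?D \<in> sets borel" "?B \<in> sets borel"
    by measurable
  have int: "integrable (E.nu z) (\<lambda>l. bsum e j l - 1/2)"
    and form: "inner (S z) z = (\<integral>l. bsum e j l - 1/2 \<partial>E.nu z)" for z
  proof -
    interpret finite_measure "E.nu z" by (rule E.finite_measure_nu)
    show "integrable (E.nu z) (\<lambda>l. bsum e j l - 1/2)"
      using binary_form(1)[where x = z, OF E(1) T dig] by simp
    show "inner (S z) z = (\<integral>l. bsum e j l - 1/2 \<partial>E.nu z)"
      using binary_form[where x = z, OF E(1) T dig, where j = j] E.measure_space_nu[of z]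
      by (simp add: S_def inner_simps power2_norm_eq_inner)
  qed
  have 1: "E ?D (x - P x) = 0"
  proof (rule E.zero_if_integral_nonpos[OF _ _ int])
    let ?z = "E ?D (x - P x)"
    show "E ?D ?z = ?z"
      by (simp add: E.idem)
    have "P ?z = 0"
      using projD[OF P] by (simp add: comm[OF projD(1)[OF P] E(2)] lin[OF projD(1)[OF P]] lin[OF E(2)])
    then show "(\<integral>l. bsum e j l - 1/2 \<partial>E.nu ?z) \<le> 0"
      unfolding form[symmetric] using cut_proj(3)[OF SW] by (simp add: P_cut)
  qed auto
  have 2: "E (UNIV - ?D) (P x) = 0"
  proof (rule cut_proj(2)[OF SW])
    let ?z = "E (UNIV - ?D) (P x)"
    show "cut_proj S ?z = ?z"
      using projD[OF P] by (simp add: P_cut[symmetric] comm[OF projD(1)[OF P] E(2)])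
    have "AE l in E.nu ?z. l \<in> UNIV - ?D"
      by (rule E.AE_nu) (simp_all add: E.idem)
    then have "(\<integral>l. bsum e j l - 1/2 \<partial>E.nu ?z) \<le> (\<integral>l. 0 \<partial>E.nu ?z)"
    proof (intro integral_mono_AE int)
      show "AE l in E.nu ?z. bsum e j l - 1/2 \<le> 0"
        using \<open>AE l in E.nu ?z. l \<in> UNIV - ?D\<close> by eventually_elim auto
    qed simp
    then show "inner (S ?z) ?z \<le> 0"
      by (simp add: form)
  qed
  have PB: "P x = E ?B x" for x
    by (simp add: P_def dig)
  have "E (?D \<inter> (UNIV - ?B)) x = 0"
    using E.comp[of ?D "UNIV - ?B" x] E.compl[of ?B x] 1 by (simp add: PB)
  moreover have "E ((UNIV - ?D) \<inter> ?B) x = 0"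
    using E.comp[of "UNIV - ?D" ?B x] 2 by (simp add: PB)
  moreover have "{l. \<not> (tdig (e j) l = 1 \<longleftrightarrow> 1/2 < bsum e j l)} =
      (?D \<inter> (UNIV - ?B)) \<union> ((UNIV - ?D) \<inter> ?B)"
    by blast
  ultimately show ?thesis
    using E.additive[of "?D \<inter> (UNIV - ?B)" "(UNIV - ?D) \<inter> ?B" x] by auto
qed

text \<open>Pairs of an operator index and a digit index are coded by \<open>prod_encode\<close>, so
  that one \<open>A\<close> stores all digits of all \<open>T n\<close>. On \<Gamma> a digit can be
  read off from the binary remainder, so equal values of all \<open>\<psi> n\<close> give, digit
  after digit, equal ternary expansions.\<close>

theorem simultaneous_diagonalization:
  assumes T: "\<And>n :: nat. contraction (T n)"
  obtains A E \<psi> \<Gamma> where "contraction A" "form_pvm borel E" "\<And>B. B \<in> sets borel \<Longrightarrow> E B \<in> W"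
    "\<And>x. integrable (form_measure borel E x) (\<lambda>l. l)"
    "\<And>x. inner (A x) x = (\<integral>l. l \<partial>form_measure borel E x)"
    "\<And>n. \<psi> n \<in> borel_measurable borel" "\<And>n l. 0 \<le> \<psi> n l" "\<And>n l. \<psi> n l \<le> 1"
    "\<And>n. continuous_on cantor (\<psi> n)"
    "\<And>n x. inner (T n x) x = (\<integral>l. \<psi> n l \<partial>form_measure borel E x)"
    "\<Gamma> \<in> sets borel" "\<And>x. E (UNIV - \<Gamma>) x = 0" "\<Gamma> \<subseteq> cantor"
    "\<And>l l'. l \<in> \<Gamma> \<Longrightarrow> l' \<in> \<Gamma> \<Longrightarrow> (\<And>n. \<psi> n l = \<psi> n l') \<Longrightarrow> l = l'"
proof -
  define Q where "Q m = digit (T (fst (prod_decode m))) (snd (prod_decode m))" for m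
  have Q: "proj (Q m)" for m
    unfolding Q_def by (rule proj_digit[OF T])
  obtain A where A: "\<And>m. contraction (A m)"
    and rec: "\<And>m x. A m x = (2/3) *\<^sub>R Q m x + (1/3) *\<^sub>R A (Suc m) x"
    using ternary_contraction[of Q] Q by blast
  define E where "E = spectral_proj (A 0)"
  define e where "e n k = prod_encode (n, k)" for n k
  define \<psi> where "\<psi> n = bsum (e n) 0" for n
  define G where "G = (\<lambda>(n, j). {l. tdig (e n j) l = 1 \<longleftrightarrow> 1/2 < bsum (e n) j l})"
  define \<Gamma> where "\<Gamma> = cantor \<inter> (\<Inter>p. G p)"
  have E: "form_pvm borel E"
    unfolding E_def by (rule form_pvm_spectral_proj[OF A])
  interpret E: form_pvm borel E by (rule E)
  have EW: "E B \<in> W" if "B \<in> sets borel" for B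
    unfolding E_def using projD(1)[OF spectral_proj(1)[OF A that]] .
  note ternary = ternary_spectral_proj[where Q = Q and A = A, OF Q A rec]
  have dig: "E {l. tdig (e n k) l = 1} x = digit (T n) k x" for n k x
    unfolding E_def ternary(2) by (simp add: Q_def e_def)
  note form = binary_form[where T = "T n" and e = "e n" for n, OF E T dig]
  have G_meas: "G p \<in> sets borel" for p
    unfolding G_def split_def by measurable
  then have meas: "\<Gamma> \<in> sets borel"
    unfolding \<Gamma>_def using borel_closed[OF closed_cantor]
    by (intro sets.Int sets.countable_INT'') auto
  have null: "E (UNIV - \<Gamma>) x = 0" for x
  proof -
    define N :: "nat + nat \<times> nat \<Rightarrow> real set"
      where "N = case_sum (\<lambda>m. {l. trem m l \<notin> cantor_pieces}) (\<lambda>p. UNIV - G p)"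
    have "{l. trem m l \<notin> cantor_pieces} \<in> sets borel" for m
      unfolding cantor_pieces_def by measurable
    moreover have "E (UNIV - G p) x = 0" for p x
    proof -
      have "UNIV - G p =
          {l. \<not> (tdig (e (fst p) (snd p)) l = 1 \<longleftrightarrow> 1/2 < bsum (e (fst p)) (snd p) l)}"
        by (auto simp: G_def split_def)
      then show ?thesis
        using binary_digit[where T = "T (fst p)" and e = "e (fst p)" and j = "snd p" and x = x,
            OF E EW T dig] by (simp only:)
    qed
    ultimately have "E (\<Union>i. N i) x = 0"
      using G_meas ternary(1)[folded E_def]
      by (intro E.null_countable_Un) (auto simp: N_def split: sum.split)
    moreover have "(\<Union>i. N i) = UNIV - \<Gamma>"
    proof -
      have "(\<Union>i. N i) = (\<Union>m. N (Inl m)) \<union> (\<Union>p. N (Inr p))"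
        by (subst UNIV_sum) (simp add: UN_Un)
      then show ?thesis
        by (auto simp: N_def \<Gamma>_def cantor_def)
    qed
    ultimately show ?thesis by simp
  qed
  have inj: "l = l'" if l: "l \<in> \<Gamma>" "l' \<in> \<Gamma>" and eq: "\<And>n. \<psi> n l = \<psi> n l'" for l l'
  proof (rule cantor_eqI)
    show "l \<in> cantor" "l' \<in> cantor"
      using l by (auto simp: \<Gamma>_def)
    have *: "tdig (e n j) l = tdig (e n j) l'" if "bsum (e n) j l = bsum (e n) j l'" for n j
    proof -
      have "l \<in> G (n, j)" "l' \<in> G (n, j)"
        using l by (auto simp: \<Gamma>_def)
      then show ?thesis
        using that tdig_range[of "e n j" l] tdig_range[of "e n j" l'] by (auto simp: G_def)
    qed
    have **: "bsum (e n) j l = bsum (e n) j l'" for n j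
      by (induction j) (use eq in \<open>simp_all add: \<psi>_def bsum_Suc *\<close>)
    show "tdig m l = tdig m l'" for m
      using *[OF **, of "fst (prod_decode m)" "snd (prod_decode m)"] by (simp add: e_def)
  qed
  show thesis
  proof (rule that[of "A 0" E \<psi> \<Gamma>])
    show "inner (T n x) x = (\<integral>l. \<psi> n l \<partial>E.nu x)" for n x
      using form(2)[of n 0 x] by (simp add: \<psi>_def)
    show "integrable (E.nu x) (\<lambda>l. l)" "inner (A 0 x) x = (\<integral>l. l \<partial>E.nu x)" for x
      unfolding E_def by (rule spectral_form[OF A])+
    show "\<Gamma> \<subseteq> cantor"
      by (auto simp: \<Gamma>_def)
    show "continuous_on cantor (\<psi> n)" for n
      unfolding \<psi>_def by (rule continuous_bsum)
  qed (use A E EW meas null inj in \<open>auto simp: \<psi>_def bsum_range\<close>)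
qed

end

section \<open>Complex operator measures\<close>

lemma scalar_measure_eq: "scalar_measure M E x = form_measure M E x"
  by (simp add: scalar_measure_def form_measure_def inner_eq_Re_cinner)

lemma form_povm_if_povm:
  assumes "povm M F" shows "form_povm M F"
proof
  fix B x assume "B \<in> sets M"
  then show "symmetric_op (F B)" "0 \<le> inner (F B x) x"
    using assms by (auto simp: povm_def positive_op_iff selfadjoint_op_iff)
next
  fix D :: "nat \<Rightarrow> _" and x
  assume "range D \<subseteq> sets M" "disjoint_family D"
  then have "(\<lambda>n. cinner (F (D n) x) x) sums cinner (F (\<Union>n. D n) x) x"
    using assms by (auto simp: povm_def)
  then show "(\<lambda>n. inner (F (D n) x) x) sums inner (F (\<Union>n. D n) x) x"
    unfolding inner_eq_Re_cinner by (rule sums_Re)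
qed

lemma povmI:
  assumes F: "form_povm M F" and C: "\<And>B c x. B \<in> sets M \<Longrightarrow> F B (c *\<^sub>C x) = c *\<^sub>C F B x"
  shows "povm M F"
  unfolding povm_def
proof (intro conjI ballI allI impI)
  interpret form_povm M F by (rule F)
  show "positive_op (F B)" if "B \<in> sets M" for B
    using that by (simp add: positive_op_iff selfadjoint_op_iff symmetric nonneg C)
  fix D :: "nat \<Rightarrow> _" and x y
  assume D: "range D \<subseteq> sets M" "disjoint_family D"
  have DM: "D n \<in> sets M" for n
    using D(1) by blast
  have UM: "(\<Union>n. D n) \<in> sets M"
    using DM by blast
  have *: "(\<lambda>n. inner (F (D n) x) y) sums inner (F (\<Union>n. D n) x) y" for y
  proof -
    have "(\<lambda>n. (inner (F (D n) (x + y)) (x + y) - inner (F (D n) (x - y)) (x - y)) / 4) sums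
        ((inner (F (\<Union>n. D n) (x + y)) (x + y) - inner (F (\<Union>n. D n) (x - y)) (x - y)) / 4)"
      by (intro sums_divide sums_diff sums D)
    moreover have "(inner (F B (x + y)) (x + y) - inner (F B (x - y)) (x - y)) / 4 = inner (F B x) y"
      if "B \<in> sets M" for B
      using symmetric_op_polarization[OF symmetric[OF that], of x y]
      by (metis (no_types) nonzero_mult_div_cancel_left zero_neq_numeral)
    ultimately show ?thesis
      using DM UM by simp
  qed
  then show "(\<lambda>n. cinner (F (D n) x) y) sums cinner (F (\<Union>n. D n) x) y"
    by (simp add: sums_complex_iff cinner_conv_inner)
qed

lemma form_pvm_if_pvm:
  assumes "pvm M E" shows "form_pvm M E"
proof -
  interpret form_povm M E
    using assms by (intro form_povm_if_povm) (auto simp: pvm_def normalized_povm_def)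
  show ?thesis
    by unfold_locales
      (use assms in \<open>auto simp: pvm_def normalized_povm_def orthogonal_projection_iff\<close>)
qed

lemma pvmI:
  assumes E: "form_pvm M E" and C: "\<And>B c x. B \<in> sets M \<Longrightarrow> E B (c *\<^sub>C x) = c *\<^sub>C E B x"
  shows "pvm M E"
proof -
  interpret form_pvm M E by (rule E)
  show ?thesis
    using povmI[OF form_povm_axioms C]
    by (auto simp: pvm_def normalized_povm_def orthogonal_projection_iff selfadjoint_op_iff
        symmetric C idem total)
qed

text \<open>The bicommutant of a commutative operator measure is commutative, since it is contained in
  the commutant.\<close>

definition commutant :: "(real set \<Rightarrow> 'a :: real_normed_vector \<Rightarrow> 'a) \<Rightarrow> ('a \<Rightarrow> 'a) set"
  where "commutant F = {S. bounded_linear S \<and> (\<forall>B\<in>sets borel. \<forall>x. S (F B x) = F B (S x))}"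

definition bicommutant :: "(real set \<Rightarrow> 'a :: real_inner \<Rightarrow> 'a) \<Rightarrow> ('a \<Rightarrow> 'a) set"
  where "bicommutant F = {T. symmetric_op T \<and> (\<forall>S\<in>commutant F. \<forall>x. T (S x) = S (T x))}"

lemma symmetric_op_limit:
  assumes X: "\<And>n :: nat. symmetric_op (X n)" and K: "\<And>n x. norm (X n x) \<le> K * norm x"
    and lim: "\<And>x. (\<lambda>n. X n x) \<longlonglongrightarrow> T x"
  shows "symmetric_op T"
  unfolding symmetric_op_def
proof (intro conjI allI)
  show "bounded_linear T"
  proof (rule bounded_linear_intro)
    show "T (x + y) = T x + T y" for x y
      using tendsto_add[OF lim[of x] lim[of y]] lim[of "x + y"]
      by (simp add: symmetric_op_linear[OF X] LIMSEQ_unique)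
    show "T (r *\<^sub>R x) = r *\<^sub>R T x" for r x
      using tendsto_scaleR[OF tendsto_const lim[of x], of r] lim[of "r *\<^sub>R x"]
      by (simp add: symmetric_op_linear[OF X] LIMSEQ_unique)
    show "norm (T x) \<le> norm x * K" for x
      using K[of _ x] by (intro LIMSEQ_le_const2[OF tendsto_norm[OF lim]]) (auto simp: mult.commute)
  qed
  show "inner (T x) y = inner x (T y)" for x y
    using tendsto_inner[OF lim[of x] tendsto_const[of y]] tendsto_inner[OF tendsto_const[of x] lim[of y]]
    by (simp add: symmetric_opD(2)[OF X] LIMSEQ_unique)
qed

lemma comm_ops_bicommutant:
  fixes F :: "real set \<Rightarrow> 'a :: {real_inner, banach} \<Rightarrow> 'a"
  assumes F: "\<And>B. B \<in> sets borel \<Longrightarrow> symmetric_op (F B)"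
    and comm: "\<And>B C x. B \<in> sets borel \<Longrightarrow> C \<in> sets borel \<Longrightarrow> F B (F C x) = F C (F B x)"
  shows "comm_ops (bicommutant F)"
proof
  have sub: "T \<in> commutant F" if "T \<in> bicommutant F" for T
  proof -
    have "F B \<in> commutant F" if "B \<in> sets borel" for B
      using that F comm by (auto simp: commutant_def symmetric_op_def)
    then have "T (F B x) = F B (T x)" if "B \<in> sets borel" for B x
      using \<open>T \<in> bicommutant F\<close> that by (simp add: bicommutant_def)
    moreover have "bounded_linear T"
      using \<open>T \<in> bicommutant F\<close> by (simp add: bicommutant_def symmetric_op_def)
    ultimately show ?thesis
      by (simp add: commutant_def)
  qed
  show "S (T x) = T (S x)" if "S \<in> bicommutant F" "T \<in> bicommutant F" for S T x
    using that(1) sub[OF that(2)] unfolding bicommutant_def by blast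
  have lin: "S (x + y) = S x + S y" "S (r *\<^sub>R x) = r *\<^sub>R S x" if "S \<in> commutant F" for S r x y
    using that by (auto simp: commutant_def linear_add linear_scale dest!: bounded_linear.linear)
  show "symmetric_op T" if "T \<in> bicommutant F" for T
    using that by (simp add: bicommutant_def)
  show "(\<lambda>x. x) \<in> bicommutant F"
    by (simp add: bicommutant_def symmetric_op_id)
  show "(\<lambda>x. S x + T x) \<in> bicommutant F" if "S \<in> bicommutant F" "T \<in> bicommutant F" for S T
    using that by (simp add: bicommutant_def symmetric_op_add lin)
  show "(\<lambda>x. r *\<^sub>R T x) \<in> bicommutant F" if "T \<in> bicommutant F" for r T
    using that by (simp add: bicommutant_def symmetric_op_def bounded_linear_scaleR_right
        bounded_linear_const_scaleR lin)
  show "(\<lambda>x. S (T x)) \<in> bicommutant F" if S: "S \<in> bicommutant F" and T: "T \<in> bicommutant F" for S T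
  proof -
    have "S (T x) = T (S x)" for x
      using S sub[OF T] by (simp add: bicommutant_def)
    then have "inner (S (T x)) y = inner x (S (T y))" for x y
      using S T by (simp add: bicommutant_def symmetric_op_def)
    then show ?thesis
      using S T by (simp add: bicommutant_def symmetric_op_def bounded_linear_compose)
  qed
  show "T \<in> bicommutant F"
    if X: "\<And>n :: nat. X n \<in> bicommutant F" and K: "\<And>n x. norm (X n x) \<le> K * norm x"
      and lim: "\<And>x. (\<lambda>n. X n x) \<longlonglongrightarrow> T x" for X K T
  proof -
    have "T (S x) = S (T x)" if "S \<in> commutant F" for S x
    proof (rule LIMSEQ_unique[OF lim])
      have "(\<lambda>n. S (X n x)) \<longlonglongrightarrow> S (T x)"
        using that lim by (intro bounded_linear.tendsto[of S]) (auto simp: commutant_def)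
      then show "(\<lambda>n. X n (S x)) \<longlonglongrightarrow> S (T x)"
        using X that by (simp add: bicommutant_def)
    qed
    moreover have "symmetric_op T"
      by (rule symmetric_op_limit[OF _ K lim]) (use X in \<open>simp add: bicommutant_def\<close>)
    ultimately show ?thesis
      by (simp add: bicommutant_def)
  qed
qed

lemma mem_bicommutant:
  "B \<in> sets borel \<Longrightarrow> symmetric_op (F B) \<Longrightarrow> F B \<in> bicommutant F"
  by (simp add: bicommutant_def commutant_def)

text \<open>Multiplication by \<open>c\<close> is a bounded real-linear map commuting with
  \<open>F\<close>, hence a member of \<open>commutant\<close>; this is why the commutant is built
  from real-linear maps.\<close>

lemma bicommutant_clinear:
  fixes F :: "real set \<Rightarrow> 'a :: complex_inner \<Rightarrow> 'a"
  assumes F: "\<And>B c x. B \<in> sets borel \<Longrightarrow> F B (c *\<^sub>C x) = c *\<^sub>C F B x"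
    and T: "T \<in> bicommutant F"
  shows "T (c *\<^sub>C x) = c *\<^sub>C T x"
proof -
  have "(\<lambda>x. c *\<^sub>C x) \<in> commutant F"
    using F by (simp add: commutant_def bounded_linear_scaleC)
  then show ?thesis
    using T by (simp add: bicommutant_def)
qed


section \<open>The rational ring\<close>

text \<open>Syntax for ring operations on rational intervals: countability of the generated ring is
  inherited from that of the terms.\<close>

datatype ring_term = Interval rat rat | Null | Join ring_term ring_term | Minus ring_term ring_term

primrec ring_set :: "ring_term \<Rightarrow> real set"
  where "ring_set (Interval a b) = {of_rat a<..<of_rat b}"
  | "ring_set Null = {}"
  | "ring_set (Join s t) = ring_set s \<union> ring_set t"
  | "ring_set (Minus s t) = ring_set s - ring_set t"

instance ring_term :: countable
  by countable_datatype

lemma rational_ring_subset: "rational_ring \<subseteq> range ring_set"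
  unfolding rational_ring_def
proof (rule hull_minimal)
  show "rational_intervals \<subseteq> range ring_set"
    by (auto simp: rational_intervals_def Rats_def intro: range_eqI[of _ _ "Interval _ _"])
  show "ring_of_sets UNIV (range ring_set)"
  proof (rule ring_of_setsI)
    show "{} \<in> range ring_set"
      by (rule range_eqI[of _ _ Null]) simp
    show "a \<union> b \<in> range ring_set" if "a \<in> range ring_set" "b \<in> range ring_set" for a b
      using that by (auto intro: range_eqI[of _ _ "Join _ _"])
    show "a - b \<in> range ring_set" if "a \<in> range ring_set" "b \<in> range ring_set" for a b
      using that by (auto intro: range_eqI[of _ _ "Minus _ _"])
  qed simp
qed

lemma countable_rational_ring: "countable rational_ring"
  using rational_ring_subset by (rule countable_subset) simp

lemma rational_ring_borel: "rational_ring \<subseteq> sets borel"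
proof -
  have "ring_set t \<in> sets borel" for t
    by (induction t) auto
  then show ?thesis
    using rational_ring_subset by blast
qed

lemma rational_interval_mem_ring:
  "a \<in> \<rat> \<Longrightarrow> b \<in> \<rat> \<Longrightarrow> a < b \<Longrightarrow> {a<..<b} \<in> rational_ring"
  unfolding rational_ring_def by (rule hull_inc) (auto simp: rational_intervals_def)


section \<open>Spectra of self-adjoint operators\<close>

text \<open>The equation \<open>B y = x\<close> is solved by a fixed point of
  \<open>y - t *\<^sub>R (B y - x)\<close>, which coercivity makes a contraction for suitable
  \<open>t\<close>.\<close>

lemma lax_milgram:
  fixes B :: "'a :: {real_inner, banach} \<Rightarrow> 'a"
  assumes B: "bounded_linear B" and c: "0 < c" "\<And>x. c * (norm x)\<^sup>2 \<le> inner (B x) x"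
  obtains R where "bounded_linear R" "\<And>x. R (B x) = x" "\<And>x. B (R x) = x"
proof -
  interpret B: bounded_linear B by (rule B)
  obtain M0 where M0: "0 < M0" "\<And>x. norm (B x) \<le> norm x * M0"
    using B.pos_bounded by blast
  define M where "M = max M0 c"
  have M: "0 < M" "c \<le> M" "norm (B x) \<le> M * norm x" for x
  proof -
    have "norm x * M0 \<le> norm x * M"
      by (rule mult_left_mono) (simp_all add: M_def)
    then show "norm (B x) \<le> M * norm x"
      using M0(2)[of x] by (simp add: mult.commute)
  qed (use M0 in \<open>simp_all add: M_def\<close>)
  have lower: "c * norm x \<le> norm (B x)" for x
  proof (cases "x = 0")
    case False
    have "c * norm x * norm x \<le> norm (B x) * norm x"
      using c(2)[of x] norm_cauchy_schwarz[of "B x" x] by (simp add: power2_eq_square)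
    with False show ?thesis by simp
  qed simp
  \<comment> \<open>\<open>t\<close> minimizes the bound
    \<open>1 - 2 t c + t\<^sup>2 M\<^sup>2\<close> for the squared contraction factor. The minimum
    \<open>1 - c\<^sup>2 / M\<^sup>2\<close> is nonnegative because \<open>M\<close> was taken at
    least \<open>c\<close>.\<close>
  define t q where "t = c / M\<^sup>2" and "q = sqrt (1 - c\<^sup>2 / M\<^sup>2)"
  have q2: "0 \<le> 1 - c\<^sup>2 / M\<^sup>2"
    using M c(1) by (simp add: power_mono)
  have q: "0 \<le> q" "q < 1"
    using q2 M c(1) by (simp_all add: q_def)
  have contr: "norm (u - t *\<^sub>R B u) \<le> q * norm u" for u
  proof (rule power2_le_imp_le)
    have "(norm (u - t *\<^sub>R B u))\<^sup>2 = (norm u)\<^sup>2 - 2 * t * inner (B u) u + t\<^sup>2 * (norm (B u))\<^sup>2"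
      by (simp add: power2_norm_eq_inner inner_simps inner_commute power2_eq_square[of t] algebra_simps)
    also have "\<dots> \<le> (norm u)\<^sup>2 - 2 * t * (c * (norm u)\<^sup>2) + t\<^sup>2 * (M * norm u)\<^sup>2"
      using c M by (intro add_mono diff_mono mult_left_mono power_mono) (auto simp: t_def)
    also have "\<dots> = (1 - c\<^sup>2 / M\<^sup>2) * (norm u)\<^sup>2"
      using M(1) by (simp add: t_def power2_eq_square field_simps)
    also have "\<dots> = (q * norm u)\<^sup>2"
      using q2 by (simp add: q_def power_mult_distrib)
    finally show "(norm (u - t *\<^sub>R B u))\<^sup>2 \<le> (q * norm u)\<^sup>2" .
  qed (use q in simp)
  have t: "0 < t"
    using M c by (simp add: t_def)
  have "\<exists>y. B y = x" for x
  proof -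
    have "\<exists>!y. y - t *\<^sub>R (B y - x) = y"
    proof (rule banach_fix_type[OF q], intro allI)
      fix y z
      have "y - t *\<^sub>R (B y - x) - (z - t *\<^sub>R (B z - x)) = (y - z) - t *\<^sub>R B (y - z)"
        by (simp add: B.diff algebra_simps)
      then show "dist (y - t *\<^sub>R (B y - x)) (z - t *\<^sub>R (B z - x)) \<le> q * dist y z"
        unfolding dist_norm using contr[of "y - z"] by (simp only:)
    qed
    then show ?thesis
      using t by auto
  qed
  then obtain R where R: "\<And>x. B (R x) = x"
    by metis
  have inj: "x = y" if "B x = B y" for x y
    using lower[of "x - y"] that c(1) by (simp add: B.diff mult_le_0_iff)
  show thesis
  proof (rule that[of R])
    show "bounded_linear R"
    proof (rule bounded_linear_intro)
      show "R (x + y) = R x + R y" for x y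
        by (rule inj) (simp add: R B.add)
      show "R (r *\<^sub>R x) = r *\<^sub>R R x" for r x
        by (rule inj) (simp add: R B.scaleR)
      show "norm (R x) \<le> norm x * inverse c" for x
        using lower[of "R x"] c(1) by (simp add: R field_simps)
    qed
    show "R (B x) = x" for x
      by (rule inj) (simp add: R)
  qed (rule R)
qed

text \<open>\<open>J\<close> is an auxiliary factor that makes \<open>T - z\<close> coercive: a
  rotation for nonreal points, a sign for real ones. Its injectivity turns the left inverse obtained
  from \<open>lax_milgram\<close> into a two-sided one.\<close>

lemma not_in_spectrumI:
  fixes T :: "'a :: chilbert_space \<Rightarrow> 'a"
  assumes T: "bounded_clinear T" and J: "bounded_clinear J" "inj J"
    and c: "0 < c" "\<And>x. c * (norm x)\<^sup>2 \<le> inner (J (T x - z *\<^sub>C x)) x"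
  shows "z \<notin> spectrum T"
proof -
  define S where "S x = T x - z *\<^sub>C x" for x
  have S: "bounded_linear S" "S (a *\<^sub>C x) = a *\<^sub>C S x" for a x
    using T unfolding S_def bounded_clinear_def
    by (auto intro!: bounded_linear_sub bounded_linear_scaleC
        simp: scaleC_diff_right scaleC_scaleC mult.commute)
  have JS: "bounded_linear (\<lambda>x. J (S x))"
    using J(1) S(1) by (auto simp: bounded_clinear_def intro: bounded_linear_compose)
  obtain R where R: "bounded_linear R" "\<And>x. R (J (S x)) = x" "\<And>x. J (S (R x)) = x"
    using lax_milgram[OF JS c(1)] c(2) unfolding S_def by blast
  have Rc: "R (a *\<^sub>C x) = a *\<^sub>C R x" for a x
  proof -
    have "R (J (S (a *\<^sub>C R x))) = R (a *\<^sub>C x)"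
      using J(1) by (simp add: S(2) bounded_clinear_def R(3))
    then show ?thesis
      by (simp add: R(2))
  qed
  have "bounded_clinear (\<lambda>x. R (J x))"
    using J(1) R(1) by (auto simp: bounded_clinear_def Rc intro: bounded_linear_compose)
  moreover have "S (R (J x)) = x" for x
    using R(3)[of "J x"] J(2) by (simp add: inj_def)
  ultimately have "\<exists>R. bounded_clinear R \<and> R \<circ> S = id \<and> S \<circ> R = id"
    using R(2) by (intro exI[of _ "\<lambda>x. R (J x)"]) (auto simp: fun_eq_iff)
  then show ?thesis
    unfolding spectrum_def S_def[abs_def] by blast
qed

text \<open>Multiplied by \<open>\<i>\<close> times the sign of \<open>Im z\<close>, the operator
  \<open>A - z\<close> has a form with real part \<open>\<bar>Im z\<bar> * (norm x)\<^sup>2\<close>,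
  which is coercive.\<close>

lemma spectrum_real:
  fixes A :: "'a :: chilbert_space \<Rightarrow> 'a"
  assumes A: "selfadjoint_op A" and z: "z \<in> spectrum A"
  shows "z \<in> \<real>"
proof (rule ccontr)
  assume "z \<notin> \<real>"
  then have Im: "Im z \<noteq> 0"
    by (simp add: complex_is_Real_iff)
  define s where "s = \<i> * complex_of_real (sgn (Im z))"
  have "z \<notin> spectrum A"
  proof (rule not_in_spectrumI)
    show "bounded_clinear A"
      using A by (simp add: selfadjoint_op_def)
    show "bounded_clinear (\<lambda>x :: 'a. s *\<^sub>C x)"
      by (simp add: bounded_clinear_def bounded_linear_scaleC scaleC_scaleC mult.commute)
    show "inj (\<lambda>x :: 'a. s *\<^sub>C x)"
    proof (rule inj_on_inverseI)
      show "inverse s *\<^sub>C s *\<^sub>C x = x" for x :: 'a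
      proof -
        have "s \<noteq> 0"
          using Im by (simp add: s_def sgn_eq_0_iff)
        then show ?thesis
          by (simp add: scaleC_scaleC scaleC_one)
      qed
    qed
    show "0 < \<bar>Im z\<bar>"
      using Im by simp
    fix x
    have "cinner (s *\<^sub>C (A x - z *\<^sub>C x)) x = s * (complex_of_real (inner (A x) x) - z * complex_of_real ((norm x)\<^sup>2))"
    proof -
      have "cinner (A x - z *\<^sub>C x) x + cinner (z *\<^sub>C x) x = cinner (A x) x"
        by (simp flip: cinner_add_left)
      then have "cinner (A x - z *\<^sub>C x) x = cinner (A x) x - cinner (z *\<^sub>C x) x"
        by (simp add: eq_diff_eq)
      then show ?thesis
        by (simp only: cinner_scaleC_left selfadjoint_op_cinner_self[OF A] cinner_self)
    qed
    then have "inner (s *\<^sub>C (A x - z *\<^sub>C x)) x =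
        Re (s * (complex_of_real (inner (A x) x) - z * complex_of_real ((norm x)\<^sup>2)))"
      by (simp only: inner_eq_Re_cinner[of "s *\<^sub>C (A x - z *\<^sub>C x)"])
    also have "\<dots> = sgn (Im z) * Im z * (norm x)\<^sup>2"
      by (simp add: s_def algebra_simps)
    finally show "\<bar>Im z\<bar> * (norm x)\<^sup>2 \<le> inner (s *\<^sub>C (A x - z *\<^sub>C x)) x"
      by (simp add: abs_sgn mult.commute)
  qed
  with z show False by blast
qed

section \<open>The spectrum as the support of the spectral measure\<close>

locale spectral_rep = comm_ops W + E: form_pvm borel E
  for W :: "('a :: chilbert_space \<Rightarrow> 'a) set" and E :: "real set \<Rightarrow> 'a \<Rightarrow> 'a" and A :: "'a \<Rightarrow> 'a" +
  assumes AW: "A \<in> W" and EW: "B \<in> sets borel \<Longrightarrow> E B \<in> W"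
    and clinear: "T \<in> W \<Longrightarrow> T (c *\<^sub>C x) = c *\<^sub>C T x"
    and integrable_id: "integrable (E.nu x) (\<lambda>l. l)"
    and form_id: "inner (A x) x = (\<integral>l. l \<partial>E.nu x)"
begin

lemma bounded_clinear: "T \<in> W \<Longrightarrow> bounded_clinear T"
  using sym clinear by (auto simp: bounded_clinear_def symmetric_op_def)

lemma selfadjoint: "T \<in> W \<Longrightarrow> selfadjoint_op T"
  using sym clinear by (auto simp: selfadjoint_op_iff)

lemma shift_scaleC: "A x - complex_of_real r *\<^sub>C x = A x - r *\<^sub>R x"
  by (simp add: scaleR_scaleC)

lemma form_shift:
  "integrable (E.nu x) (\<lambda>l. l - r)"
  "inner (A x - r *\<^sub>R x) x = (\<integral>l. l - r \<partial>E.nu x)"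
proof -
  interpret finite_measure "E.nu x" by (rule E.finite_measure_nu)
  show "integrable (E.nu x) (\<lambda>l. l - r)" "inner (A x - r *\<^sub>R x) x = (\<integral>l. l - r \<partial>E.nu x)"
    using integrable_id[of x] E.measure_space_nu[of x]
    by (simp_all add: form_id inner_simps power2_norm_eq_inner mult.commute)
qed

lemma shift_le:
  assumes "AE l in E.nu x. l - r \<le> c"
  shows "inner (A x - r *\<^sub>R x) x \<le> c * (norm x)\<^sup>2"
proof -
  interpret finite_measure "E.nu x" by (rule E.finite_measure_nu)
  have "(\<integral>l. l - r \<partial>E.nu x) \<le> (\<integral>l. c \<partial>E.nu x)"
    by (rule integral_mono_AE[OF form_shift(1) _ assms]) simp
  then show ?thesis
    using E.measure_space_nu[of x] by (simp add: form_shift mult.commute)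
qed

lemma shift_ge:
  assumes "AE l in E.nu x. c \<le> l - r"
  shows "c * (norm x)\<^sup>2 \<le> inner (A x - r *\<^sub>R x) x"
proof -
  interpret finite_measure "E.nu x" by (rule E.finite_measure_nu)
  have "(\<integral>l. c \<partial>E.nu x) \<le> (\<integral>l. l - r \<partial>E.nu x)"
    by (rule integral_mono_AE[OF _ form_shift(1) assms]) simp
  then show ?thesis
    using E.measure_space_nu[of x] by (simp add: form_shift mult.commute)
qed

text \<open>\<open>J\<close> is the sign of \<open>A - r\<close>, so \<open>J (A - r)\<close> is its
  modulus, bounded below by \<open>e\<close> when no spectral mass lies within distance
  \<open>e\<close> of \<open>r\<close>.\<close>

lemma not_in_real_spectrumI:
  assumes e: "0 < e" and null: "\<And>x. E {r - e<..<r + e} x = 0"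
  shows "r \<notin> real_spectrum A"
proof -
  let ?P = "E {r..}"
  define J where "J x = 2 *\<^sub>R ?P x - x" for x
  have P: "proj ?P"
    by (simp add: proj_def EW E.idem)
  have PW: "?P \<in> W"
    by (rule projD(1)[OF P])
  have JW: "J \<in> W"
    unfolding J_def[abs_def] by (intro diff_mem scale_mem id_mem PW)
  have JJ: "J (J x) = x" for x
    by (simp add: J_def lin[OF PW] E.idem) (simp add: scaleR_2)
  have SW: "(\<lambda>x. A x - r *\<^sub>R x) \<in> W"
    by (intro diff_mem AW scale_mem id_mem)
  have gap: "AE l in E.nu z. l \<notin> {r - e<..<r + e}" for z
  proof -
    have "AE l in E.nu z. l \<in> UNIV - {r - e<..<r + e}"
      using E.compl[of "{r - e<..<r + e}" z] by (intro E.AE_nu) (simp_all add: null)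
    then show ?thesis by simp
  qed
  have "complex_of_real r \<notin> spectrum A"
  proof (rule not_in_spectrumI[OF bounded_clinear[OF AW] bounded_clinear[OF JW] _ e])
    show "inj J"
      by (rule inj_on_inverseI[of _ J]) (rule JJ)
    fix x
    define p n where "p = ?P x" and "n = x - ?P x"
    have Pp: "?P p = p" and Pn: "?P n = 0"
      by (simp_all add: p_def n_def E.idem lin[OF PW])
    have "AE l in E.nu p. l \<in> {r..}"
      by (rule E.AE_nu) (simp_all add: Pp)
    with gap[of p] have "AE l in E.nu p. e \<le> l - r"
      by eventually_elim auto
    then have 1: "e * (norm p)\<^sup>2 \<le> inner (A p - r *\<^sub>R p) p"
      by (rule shift_ge)
    have "AE l in E.nu n. l \<in> UNIV - {r..}"
      using E.compl[of "{r..}" n] by (intro E.AE_nu) (simp_all add: Pn)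
    with gap[of n] have "AE l in E.nu n. l - r \<le> - e"
      by eventually_elim auto
    then have 2: "inner (A n - r *\<^sub>R n) n \<le> - e * (norm n)\<^sup>2"
      by (rule shift_le)
    have comm': "J (A y - r *\<^sub>R y) = A (J y) - r *\<^sub>R J y" for y
      by (simp add: lin[OF JW] comm[OF JW AW])
    have "inner (J (A x - r *\<^sub>R x)) x = inner (J (A p - r *\<^sub>R p)) p + inner (J (A n - r *\<^sub>R n)) n"
      using inner_split[OF P comp_mem[OF JW SW], of x] by (simp add: p_def n_def)
    also have "\<dots> = inner (A p - r *\<^sub>R p) p - inner (A n - r *\<^sub>R n) n"
      unfolding comm' by (simp add: J_def[of p] J_def[of n] Pp Pn scaleR_2 lin[OF AW] inner_simps)
    also have "\<dots> \<ge> e * (norm x)\<^sup>2"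
      using 1 2 proj_pythagoras[OF P, of x] by (simp add: p_def n_def algebra_simps)
    finally show "e * (norm x)\<^sup>2 \<le> inner (J (A x - complex_of_real r *\<^sub>C x)) x"
      by (simp add: shift_scaleC)
  qed
  then show ?thesis
    by (simp add: real_spectrum_def)
qed

text \<open>On the range of \<open>E {r - e<..<r + e}\<close> the operator \<open>A - r\<close> has
  norm at most \<open>e\<close>. With \<open>e\<close> half the reciprocal of a bound
  \<open>K\<close> for the resolvent, applying the resolvent there gives
  \<open>norm z \<le> norm z / 2\<close>.\<close>

lemma null_neighbourhood:
  assumes "r \<notin> real_spectrum A"
  obtains e where "0 < e" "\<And>x. E {r - e<..<r + e} x = 0"
proof -
  from assms obtain R where R: "bounded_clinear R" "R \<circ> (\<lambda>x. A x - complex_of_real r *\<^sub>C x) = id"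
    by (auto simp: real_spectrum_def spectrum_def)
  obtain K where K: "0 < K" "\<And>x. norm (R x) \<le> norm x * K"
    using R(1) bounded_linear.pos_bounded[of R] unfolding bounded_clinear_def by blast
  define e where "e = inverse (2 * K)"
  have e: "0 < e" "e * K = 1/2"
    using K(1) by (simp_all add: e_def)
  let ?I = "{r - e<..<r + e}"
  have "E ?I x = 0" for x
  proof -
    define U where "U y = A (E ?I y) - r *\<^sub>R E ?I y" for y
    have UW: "U \<in> W"
      unfolding U_def[abs_def] by (intro diff_mem scale_mem comp_mem[OF AW EW] EW) auto
    have "\<bar>inner (U y) y\<bar> \<le> e * (norm y)\<^sup>2" for y
    proof -
      define z where "z = E ?I y"
      have z: "E ?I z = z"
        by (simp add: z_def E.idem)
      have "inner (U y) y = inner (U z) z"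
        using inner_split[of "E ?I", OF _ UW, of y]
        by (simp add: proj_def EW E.idem z_def U_def lin[OF EW] lin[OF AW])
      also have "\<dots> = inner (A z - r *\<^sub>R z) z"
        by (simp add: U_def z)
      finally have *: "inner (U y) y = inner (A z - r *\<^sub>R z) z" .
      have "AE l in E.nu z. l \<in> ?I"
        by (rule E.AE_nu) (simp_all add: z)
      then have "AE l in E.nu z. l - r \<le> e" "AE l in E.nu z. - e \<le> l - r"
        by (eventually_elim, auto)+
      then have "\<bar>inner (U y) y\<bar> \<le> e * (norm z)\<^sup>2"
        using shift_le[where x = z and r = r and c = e] shift_ge[where x = z and r = r and c = "- e"] unfolding * by (simp add: abs_le_iff)
      also have "\<dots> \<le> e * (norm y)\<^sup>2"
        using e(1) proj_norm_le[of "E ?I" y]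
        by (intro mult_left_mono power_mono) (simp_all add: z_def proj_def EW E.idem)
      finally show ?thesis .
    qed
    then have U: "norm (U y) \<le> e * norm y" for y
      using symmetric_op_norm_le[OF sym[OF UW]] by blast
    define z where "z = E ?I x"
    have "norm z = norm (R (U z))"
      using fun_cong[OF R(2), of z] by (simp add: U_def z_def E.idem shift_scaleC)
    also have "\<dots> \<le> (e * norm z) * K"
      using K(2)[of "U z"] mult_right_mono[OF U[of z], of K] K(1) by linarith
    also have "\<dots> = norm z / 2"
      using e(2) by (simp add: mult.commute mult.left_commute)
    finally show ?thesis
      by (simp add: z_def)
  qed
  with e(1) that show thesis by blast
qed

text \<open>The points off the spectrum are exactly those in some null interval with rational
  end-points; a countable union of such intervals yields openness and nullity together.\<close>

lemma open_compl_spectrum: "open (UNIV - real_spectrum A)"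
  and null_compl_spectrum: "E (UNIV - real_spectrum A) x = 0"
proof -
  define I where "I = {(a, b). a \<in> \<rat> \<and> b \<in> \<rat> \<and> (\<forall>x. E {a<..<b :: real} x = 0)}"
  have "UNIV - real_spectrum A = (\<Union>(a, b)\<in>I. {a<..<b})"
  proof (intro set_eqI iffI)
    fix r assume "r \<in> UNIV - real_spectrum A"
    then obtain e where e: "0 < e" "\<And>x. E {r - e<..<r + e} x = 0"
      using null_neighbourhood[of r] by auto
    obtain a b where ab: "a \<in> \<rat>" "r - e < a" "a < r" "b \<in> \<rat>" "r < b" "b < r + e"
      using Rats_dense_in_real[of "r - e" r] Rats_dense_in_real[of r "r + e"] e(1) by auto
    have "E {a<..<b} x = 0" for x
      by (rule E.null_subset[of _ "{r - e<..<r + e}"]) (use ab e(2) in auto)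
    then show "r \<in> (\<Union>(a, b)\<in>I. {a<..<b})"
      using ab by (auto simp: I_def)
  next
    fix r assume "r \<in> (\<Union>(a, b)\<in>I. {a<..<b})"
    then obtain a b where ab: "a < r" "r < b" "\<And>x. E {a<..<b} x = 0"
      by (auto simp: I_def)
    define e where "e = min (r - a) (b - r)"
    have "E {r - e<..<r + e} x = 0" for x
      by (rule E.null_subset[of _ "{a<..<b}"]) (use ab in \<open>auto simp: e_def\<close>)
    then show "r \<in> UNIV - real_spectrum A"
      using not_in_real_spectrumI[of e r] ab by (simp add: e_def)
  qed
  moreover have "countable I"
    by (rule countable_subset[of _ "\<rat> \<times> \<rat>"]) (auto simp: I_def countable_rat)
  ultimately show "open (UNIV - real_spectrum A)" "E (UNIV - real_spectrum A) x = 0"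
    using E.null_countable_Un[of I "\<lambda>(a, b). {a<..<b}" x] by (auto simp: I_def)
qed

lemma real_spectrum_borel: "real_spectrum A \<in> sets borel"
  using open_compl_spectrum by (intro borel_closed) (simp add: closed_def Compl_eq_Diff_UNIV)

lemma spectrum_eq: "spectrum A = complex_of_real ` real_spectrum A"
  using spectrum_real[OF selfadjoint[OF AW]] by (auto simp: real_spectrum_def Reals_def)

lemma real_spectrum_subset:
  assumes "closed C" "\<And>x. E (UNIV - C) x = 0"
  shows "real_spectrum A \<subseteq> C"
proof (rule ccontr)
  assume "\<not> real_spectrum A \<subseteq> C"
  then obtain r where r: "r \<in> real_spectrum A" "r \<in> - C"
    by blast
  then obtain e where e: "0 < e" "ball r e \<subseteq> - C"
    using assms(1) by (auto simp: closed_def open_contains_ball)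
  have "E {r - e<..<r + e} x = 0" for x
    by (rule E.null_subset[of _ "UNIV - C"])
      (use e(2) assms in \<open>auto simp: ball_eq_greaterThanLessThan\<close>)
  with e(1) r(1) show False
    using not_in_real_spectrumI by blast
qed

end

section \<open>Markov kernels from operator measures\<close>

context form_pvm
begin

lemma AE_not_null:
  assumes "B \<in> sets M" "E B x = 0"
  shows "AE l in nu x. l \<notin> B"
  by (rule AE_not_in) (use assms in \<open>simp add: null_sets_def emeasure_nu\<close>)

lemma AE_full:
  assumes "B \<in> sets M" "\<And>x. E (space M - B) x = 0"
  shows "AE l in nu x. l \<in> B"
  using assms by (intro AE_nu) (simp_all add: compl)

lemma integrable_bounded:
  assumes "f \<in> borel_measurable M" "\<And>l. 0 \<le> f l" "\<And>l. f l \<le> (1 :: real)"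
  shows "integrable (nu x) f"
  by (rule finite_measure.integrable_const_bound[OF finite_measure_nu, where B = 1])
    (use assms in simp_all)

lemma null_if_integral_eq:
  assumes f: "\<And>x. integrable (nu x) f" and g: "\<And>x. integrable (nu x) g"
    and eq: "\<And>x. (\<integral>l. f l \<partial>nu x) = (\<integral>l. g l \<partial>nu x)"
    and [measurable]: "f \<in> borel_measurable M" "g \<in> borel_measurable M"
  shows "E {l \<in> space M. f l \<noteq> (g l :: real)} x = 0"
proof -
  have "E ({l \<in> space M. g l < f l} \<union> {l \<in> space M. f l < g l}) x
      = E {l \<in> space M. g l < f l} x + E {l \<in> space M. f l < g l} x"
    by (rule additive) auto
  also have "\<dots> = 0"
    using null_if_integral_le[OF f g _ assms(4,5), of x] null_if_integral_le[OF g f _ assms(5,4), of x] eq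
    by simp
  also have "{l \<in> space M. g l < f l} \<union> {l \<in> space M. f l < g l} = {l \<in> space M. f l \<noteq> g l}"
    by auto
  finally show ?thesis .
qed

end

text \<open>\<open>psi B\<close> is tied to \<open>F\<close> by integrals only, for countably many
  \<open>B\<close>; on rational half-lines it supplies the candidate distribution functions.\<close>

locale povm_kernel = E: form_pvm borel E + F: form_povm borel F
  for E :: "real set \<Rightarrow> 'a :: real_inner \<Rightarrow> 'a" and F :: "real set \<Rightarrow> 'a \<Rightarrow> 'a" +
  fixes K :: "real set set" and psi :: "real set \<Rightarrow> real \<Rightarrow> real"
  assumes F_total: "F UNIV x = x"
    and K_countable: "countable K" and K_borel: "K \<subseteq> sets borel"
    and K_atMost: "q \<in> \<rat> \<Longrightarrow> {..q} \<in> K"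
    and psi_measurable: "B \<in> K \<Longrightarrow> psi B \<in> borel_measurable borel"
    and psi_range: "0 \<le> psi B l" "psi B l \<le> 1"
    and psi_form: "B \<in> K \<Longrightarrow> inner (F B x) x = (\<integral>l. psi B l \<partial>E.nu x)"
begin

text \<open>The infimum makes \<open>G l\<close> monotone and right continuous for every \<open>l\<close>, so that the interval measure
  makes sense without exceptional points.\<close>

definition rats_above :: "real \<Rightarrow> real set"
  where "rats_above t = {q \<in> \<rat>. t < q}"

lemma rats_above_nonempty: "rats_above t \<noteq> {}"
  using Rats_dense_in_real[of t "t + 1"] by (auto simp: rats_above_def)

definition G :: "real \<Rightarrow> real \<Rightarrow> real"
  where "G l t = (INF q\<in>rats_above t. psi {..q} l)"

lemma bdd_below_psi: "bdd_below ((\<lambda>q. psi {..q} l) ` A)"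
  by (rule bdd_belowI[of _ 0]) (auto simp: psi_range)

lemma G_le: "q \<in> \<rat> \<Longrightarrow> t < q \<Longrightarrow> G l t \<le> psi {..q} l"
  unfolding G_def by (rule cINF_lower[OF bdd_below_psi]) (simp add: rats_above_def)

lemma G_greatest: "(\<And>q. q \<in> \<rat> \<Longrightarrow> t < q \<Longrightarrow> c \<le> psi {..q} l) \<Longrightarrow> c \<le> G l t"
  unfolding G_def by (rule cINF_greatest[OF rats_above_nonempty]) (simp add: rats_above_def)

lemma G_range: "0 \<le> G l t" "G l t \<le> 1"
proof -
  show "0 \<le> G l t"
    by (rule G_greatest) (rule psi_range)
  obtain q where "q \<in> \<rat>" "t < q"
    using rats_above_nonempty[of t] by (auto simp: rats_above_def)
  then show "G l t \<le> 1"
    using G_le[of q t l] psi_range(2)[of "{..q}" l] by linarith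
qed

lemma G_mono: "s \<le> t \<Longrightarrow> G l s \<le> G l t"
  by (rule G_greatest) (rule G_le, auto)

lemma G_less:
  assumes "G l t < u"
  obtains q where "q \<in> \<rat>" "t < q" "psi {..q} l < u"
proof -
  have "\<not> (\<forall>q. q \<in> \<rat> \<longrightarrow> t < q \<longrightarrow> u \<le> psi {..q} l)"
    using G_greatest[of t u l] assms by force
  then show thesis
    using that by (auto simp: not_le)
qed

lemma G_continuous: "continuous (at_right t) (G l)"
  unfolding continuous_within
proof (rule order_tendstoI)
  fix c assume c: "c < G l t"
  have "\<forall>\<^sub>F s in at_right t. t < s"
    by (simp add: eventually_at_filter)
  then show "\<forall>\<^sub>F s in at_right t. c < G l s"
    by (rule eventually_mono) (use c G_mono less_le_trans less_imp_le in metis)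
next
  fix u assume "G l t < u"
  then obtain q where q: "q \<in> \<rat>" "t < q" "psi {..q} l < u"
    by (rule G_less)
  have "\<forall>\<^sub>F s in at_right t. s \<in> {t<..<q}"
    using q(2) by (rule eventually_at_right_real)
  then show "\<forall>\<^sub>F s in at_right t. G l s < u"
    by (rule eventually_mono) (use q G_le le_less_trans greaterThanLessThan_iff in metis)
qed

lemma G_measurable [measurable]: "(\<lambda>l. G l t) \<in> borel_measurable borel"
  unfolding G_def
proof (rule borel_measurable_cINF)
  show "countable (rats_above t)"
    by (rule countable_subset[OF _ countable_rat]) (auto simp: rats_above_def)
  show "(\<lambda>l. psi {..q} l) \<in> borel_measurable borel" if "q \<in> rats_above t" for q
    using psi_measurable[OF K_atMost, of q] that by (simp add: rats_above_def)
qed (rule bdd_below_psi)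

text \<open>The total mass is at most 1 for every \<open>l\<close>, but it may be smaller at
  exceptional points, where \<open>G l\<close> need not run from 0 to 1.\<close>

definition kern :: "real \<Rightarrow> real measure"
  where "kern l = interval_measure (G l)"

lemma sets_kern [simp]: "sets (kern l) = sets borel" and space_kern [simp]: "space (kern l) = UNIV"
  by (simp_all add: kern_def)

lemma emeasure_kern_Ioc: "a \<le> b \<Longrightarrow> emeasure (kern l) {a<..b} = ennreal (G l b - G l a)"
  unfolding kern_def by (rule emeasure_interval_measure_Ioc[OF _ G_mono G_continuous])

lemma emeasure_kern_le_1: "emeasure (kern l) UNIV \<le> 1"
proof (rule LIMSEQ_le_const2)
  show "(\<lambda>n. emeasure (kern l) (sym_Ioc n)) \<longlonglongrightarrow> emeasure (kern l) UNIV"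
    unfolding sym_Ioc(2)[symmetric]
    by (rule Lim_emeasure_incseq[OF _ sym_Ioc(1)]) (simp add: sym_Ioc(3))
  have "emeasure (kern l) (sym_Ioc n) \<le> 1" for n
    using G_range[of l "real n"] G_range[of l "- real n"]
    by (simp add: sym_Ioc_def emeasure_kern_Ioc ennreal_le_1)
  then show "\<exists>N. \<forall>n\<ge>N. emeasure (kern l) (sym_Ioc n) \<le> 1"
    by blast
qed

lemma finite_measure_kern: "finite_measure (kern l)"
proof (rule finite_measureI)
  show "emeasure (kern l) (space (kern l)) \<noteq> \<infinity>"
    using emeasure_kern_le_1[of l] by (auto simp: top_unique)
qed

lemma measure_kern_Ioc: "a \<le> b \<Longrightarrow> measure (kern l) {a<..b} = G l b - G l a"
  by (simp add: measure_def emeasure_kern_Ioc G_mono)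

lemma measure_kern_le_1: "measure (kern l) B \<le> 1"
proof -
  interpret finite_measure "kern l" by (rule finite_measure_kern)
  have "measure (kern l) B \<le> measure (kern l) UNIV"
    using bounded_measure[of B] by simp
  also have "\<dots> \<le> 1"
    using emeasure_kern_le_1[of l] by (simp add: emeasure_eq_measure)
  finally show ?thesis .
qed

text \<open>\<open>F\<close> is monotone on half-lines, which orders the integrals against every
  scalar measure; the countably many rational pairs leave a single null set.\<close>

lemma AE_psi_mono:
  "AE l in E.nu x. \<forall>q\<in>\<rat>. \<forall>r\<in>\<rat>. q \<le> r \<longrightarrow> psi {..q} l \<le> psi {..r} l"
proof (intro AE_ball_countable'[OF _ countable_rat])
  fix q r :: real assume qr: "q \<in> \<rat>" "r \<in> \<rat>"
  note [measurable] = psi_measurable[OF K_atMost[OF qr(1)]] psi_measurable[OF K_atMost[OF qr(2)]]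
  show "AE l in E.nu x. q \<le> r \<longrightarrow> psi {..q} l \<le> psi {..r} l"
  proof (cases "q \<le> r")
    case True
    have int: "integrable (E.nu x) (psi {..p})" if "p \<in> {q, r}" for p x
      by (rule E.integrable_bounded) (use that in \<open>auto simp: psi_range\<close>)
    have "E {l \<in> space borel. psi {..r} l < psi {..q} l} x = 0"
    proof (rule E.null_if_integral_le)
      fix x
      interpret finite_measure "F.nu x" by (rule F.finite_measure_nu)
      have "measure (F.nu x) {..q} \<le> measure (F.nu x) {..r}"
        using True by (intro finite_measure_mono) auto
      then show "(\<integral>l. psi {..q} l \<partial>E.nu x) \<le> (\<integral>l. psi {..r} l \<partial>E.nu x)"
        using qr by (simp add: F.measure_nu psi_form K_atMost)
    qed (simp_all add: int)
    then have "AE l in E.nu x. l \<notin> {l \<in> space borel. psi {..r} l < psi {..q} l}"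
      by (intro E.AE_not_null) auto
    then show ?thesis
      by (auto simp: not_less)
  qed simp
qed

lemma tendsto_G:
  assumes mono: "\<forall>q\<in>\<rat>. \<forall>r\<in>\<rat>. q \<le> r \<longrightarrow> psi {..q} l \<le> psi {..r} l"
    and q: "\<And>n. q n \<in> \<rat>" "\<And>n. t < q n" "q \<longlonglongrightarrow> t"
  shows "(\<lambda>n. psi {..q n} l) \<longlonglongrightarrow> G l t"
proof (rule order_tendstoI)
  fix c assume "c < G l t"
  then show "\<forall>\<^sub>F n in sequentially. c < psi {..q n} l"
    by (intro always_eventually allI less_le_trans[OF _ G_le[OF q(1,2)]])
next
  fix u assume "G l t < u"
  then obtain p where p: "p \<in> \<rat>" "t < p" "psi {..p} l < u"
    by (rule G_less)
  show "\<forall>\<^sub>F n in sequentially. psi {..q n} l < u"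
    using order_tendstoD(2)[OF q(3) p(2)]
  proof (rule eventually_mono)
    fix n assume "q n < p"
    then have "psi {..q n} l \<le> psi {..p} l"
      using mono p(1) q(1) by simp
    then show "psi {..q n} l < u"
      using p(3) by linarith
  qed
qed

text \<open>Both sides are limits along rationals tending to \<open>t\<close> from above: dominated
  convergence for \<open>E\<close>, continuity from above for \<open>F\<close>.\<close>

lemma G_form: "(\<integral>l. G l t \<partial>E.nu x) = inner (F {..t} x) x"
proof -
  have "\<exists>q\<in>\<rat>. t < q \<and> q < t + 1 / real (Suc n)" for n
    by (rule Rats_dense_in_real) simp
  then obtain q where q: "\<And>n. q n \<in> \<rat>" "\<And>n. t < q n" "\<And>n. q n < t + 1 / real (Suc n)"
    by metis
  have "(\<lambda>n. t + 1 / real (Suc n)) \<longlonglongrightarrow> t + 0"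
    by (intro tendsto_intros LIMSEQ_Suc[OF lim_1_over_n])
  then have above: "(\<lambda>n. t + 1 / real (Suc n)) \<longlonglongrightarrow> t"
    by simp
  have q_lim: "q \<longlonglongrightarrow> t"
    by (rule tendsto_sandwich[OF _ _ tendsto_const above];
        rule always_eventually; rule allI; rule less_imp_le; rule q)
  have "(\<lambda>n. \<integral>l. psi {..q n} l \<partial>E.nu x) \<longlonglongrightarrow> (\<integral>l. G l t \<partial>E.nu x)"
  proof (rule integral_dominated_convergence[where w = "\<lambda>_. 1"])
    show "integrable (E.nu x) (\<lambda>_. 1 :: real)"
      by (rule E.integrable_bounded) auto
    show "AE l in E.nu x. (\<lambda>n. psi {..q n} l) \<longlonglongrightarrow> G l t"
      using AE_psi_mono[of x] by eventually_elim (rule tendsto_G[OF _ q(1,2) q_lim])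
  qed (use psi_measurable[OF K_atMost[OF q(1)]] in \<open>auto simp: psi_range\<close>)
  moreover have "(\<lambda>n. \<integral>l. psi {..q n} l \<partial>E.nu x) \<longlonglongrightarrow> inner (F {..t} x) x"
  proof -
    interpret finite_measure "F.nu x" by (rule F.finite_measure_nu)
    have dec: "(\<lambda>n. measure (F.nu x) {..t + 1 / real (Suc n)}) \<longlonglongrightarrow>
        measure (F.nu x) (\<Inter>n. {..t + 1 / real (Suc n)})"
      by (rule finite_Lim_measure_decseq) (auto simp: decseq_def intro!: frac_le)
    have "(\<Inter>n. {..t + 1 / real (Suc n)}) = {..t}"
    proof (intro set_eqI iffI)
      fix r assume "r \<in> (\<Inter>n. {..t + 1 / real (Suc n)})"
      then have "r \<le> t + 1 / real (Suc n)" for n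
        by auto
      then have "r \<le> t + 0"
        by (intro LIMSEQ_le_const[OF tendsto_add[OF tendsto_const LIMSEQ_Suc[OF lim_1_over_n]]]) auto
      then show "r \<in> {..t}" by simp
    qed (auto intro!: add_increasing2)
    note dec = dec[unfolded this]
    have "(\<lambda>n. measure (F.nu x) {..q n}) \<longlonglongrightarrow> measure (F.nu x) {..t}"
    proof (rule tendsto_sandwich[OF _ _ tendsto_const dec])
      show "\<forall>\<^sub>F n in sequentially. measure (F.nu x) {..t} \<le> measure (F.nu x) {..q n}"
        using q(2)[THEN less_imp_le] by (intro always_eventually allI finite_measure_mono) simp_all
      show "\<forall>\<^sub>F n in sequentially. measure (F.nu x) {..q n} \<le> measure (F.nu x) {..t + 1 / real (Suc n)}"
        using q(3)[THEN less_imp_le] by (intro always_eventually allI finite_measure_mono) simp_all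
    qed
    then show ?thesis
      using q(1) by (simp add: F.measure_nu psi_form[symmetric] K_atMost)
  qed
  ultimately show ?thesis
    by (rule LIMSEQ_unique)
qed

lemma G_integrable: "integrable (E.nu x) (\<lambda>l. G l t)"
  by (rule E.integrable_bounded) (auto simp: G_range)

lemma kern_form_Ioc:
  assumes "a \<le> b"
  shows "(\<integral>l. measure (kern l) {a<..b} \<partial>E.nu x) = inner (F {a<..b} x) x"
proof -
  have "{..a} \<union> {a<..b} = {..b}" "{..a} \<inter> {a<..b} = {}"
    using assms by auto
  then have "F {..b} x = F {..a} x + F {a<..b} x"
    using F.additive[of "{..a}" "{a<..b}" x] by simp
  then show ?thesis
    using assms by (simp add: measure_kern_Ioc G_integrable G_form inner_simps)
qed

text \<open>Comes before \<open>kern_form\<close> because the complement step there subtracts from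
  the total mass, which at this stage is not known to be 1.\<close>

lemma kern_form_UNIV:
  "(\<lambda>l. measure (kern l) UNIV) \<in> borel_measurable borel"
  "(\<integral>l. measure (kern l) UNIV \<partial>E.nu x) = inner (F UNIV x) x"
proof -
  have lim: "(\<lambda>n. measure (kern l) (sym_Ioc n)) \<longlonglongrightarrow> measure (kern l) UNIV" for l
    unfolding sym_Ioc(2)[symmetric]
    by (rule finite_measure.finite_Lim_measure_incseq[OF finite_measure_kern _ sym_Ioc(1)])
      (simp add: sym_Ioc(3))
  have eq: "measure (kern l) (sym_Ioc n) = G l (real n) - G l (- real n)" for l n
    by (simp add: sym_Ioc_def measure_kern_Ioc)
  have meas: "(\<lambda>l. measure (kern l) (sym_Ioc n)) \<in> borel_measurable borel" for n
    unfolding eq by measurable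
  show *: "(\<lambda>l. measure (kern l) UNIV) \<in> borel_measurable borel"
    by (rule borel_measurable_LIMSEQ_real[OF lim meas])
  have "(\<lambda>n. \<integral>l. measure (kern l) (sym_Ioc n) \<partial>E.nu x) \<longlonglongrightarrow>
      (\<integral>l. measure (kern l) UNIV \<partial>E.nu x)"
  proof (rule integral_dominated_convergence[where w = "\<lambda>_. 1"])
    show "integrable (E.nu x) (\<lambda>_. 1 :: real)"
      by (rule E.integrable_bounded) auto
  qed (use * meas lim measure_kern_le_1 in auto)
  moreover have "(\<integral>l. measure (kern l) (sym_Ioc n) \<partial>E.nu x) = measure (F.nu x) (sym_Ioc n)" for n
    by (simp add: sym_Ioc_def kern_form_Ioc F.measure_nu)
  moreover have "(\<lambda>n. measure (F.nu x) (sym_Ioc n)) \<longlonglongrightarrow> measure (F.nu x) UNIV"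
    unfolding sym_Ioc(2)[symmetric]
    by (rule finite_measure.finite_Lim_measure_incseq[OF F.finite_measure_nu _ sym_Ioc(1)])
      (simp add: sym_Ioc(3))
  ultimately show "(\<integral>l. measure (kern l) UNIV \<partial>E.nu x) = inner (F UNIV x) x"
    by (simp add: F.measure_nu LIMSEQ_unique)
qed

lemma kern_form:
  assumes "B \<in> sets borel"
  shows "(\<lambda>l. measure (kern l) B) \<in> borel_measurable borel \<and>
    (\<forall>x. (\<integral>l. measure (kern l) B \<partial>E.nu x) = inner (F B x) x)"
  using assms
proof (induction rule: borel_Ioc_induct)
  case (Ioc a b)
  then have "(\<lambda>l. measure (kern l) {a<..b}) \<in> borel_measurable borel"
    by (simp add: measure_kern_Ioc)
  with Ioc show ?case
    by (simp only: kern_form_Ioc) simp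
next
  case empty
  show ?case by (simp add: F.empty)
next
  case (compl B)
  have [measurable]: "(\<lambda>l. measure (kern l) B) \<in> borel_measurable borel"
    "(\<lambda>l. measure (kern l) UNIV) \<in> borel_measurable borel"
    using compl(2) kern_form_UNIV by auto
  note B = compl(1)
  have eq: "measure (kern l) (UNIV - B) = measure (kern l) UNIV - measure (kern l) B" for l
    using finite_measure.finite_measure_compl[OF finite_measure_kern, of B l] B by simp
  have int: "integrable (E.nu x) (\<lambda>l. measure (kern l) UNIV)"
    "integrable (E.nu x) (\<lambda>l. measure (kern l) B)" for x
    by (rule E.integrable_bounded; simp add: measure_kern_le_1)+
  have "F UNIV x = F B x + F (UNIV - B) x" for x
    using F.additive[of B "UNIV - B" x] B by simp
  then show ?case
    using compl(2) int by (simp add: eq kern_form_UNIV inner_simps)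
next
  case (union D)
  note D = union(2)
  have meas [measurable]: "(\<lambda>l. measure (kern l) (D i)) \<in> borel_measurable borel" for i
    using union(3) by blast
  have sums: "(\<lambda>i. measure (kern l) (D i)) sums measure (kern l) (\<Union>i. D i)" for l
    using D union(1) by (intro finite_measure.finite_measure_UNION[OF finite_measure_kern]) auto
  then have eq: "measure (kern l) (\<Union>i. D i) = (\<Sum>i. measure (kern l) (D i))" for l
    by (simp add: sums_iff)
  have int: "integrable (E.nu x) (\<lambda>l. measure (kern l) (D i))" for x i
    by (rule E.integrable_bounded) (simp_all add: measure_kern_le_1)
  have "(\<integral>l. measure (kern l) (\<Union>i. D i) \<partial>E.nu x) = inner (F (\<Union>i. D i) x) x" for x
  proof (rule sums_unique2)
    have F: "(\<lambda>i. inner (F (D i) x) x) sums inner (F (\<Union>i. D i) x) x"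
      using F.sums[OF D union(1)] .
    then show "(\<lambda>i. \<integral>l. measure (kern l) (D i) \<partial>E.nu x) sums inner (F (\<Union>i. D i) x) x"
      using union(3) by simp
    show "(\<lambda>i. \<integral>l. measure (kern l) (D i) \<partial>E.nu x) sums
        (\<integral>l. measure (kern l) (\<Union>i. D i) \<partial>E.nu x)"
      unfolding eq
    proof (rule sums_integral[OF int])
      show "AE l in E.nu x. summable (\<lambda>i. norm (measure (kern l) (D i)))"
        using sums by (auto simp: sums_iff)
      show "summable (\<lambda>i. \<integral>l. norm (measure (kern l) (D i)) \<partial>E.nu x)"
        using F union(3) by (auto simp: sums_iff)
    qed
  qed
  moreover have "(\<lambda>l. measure (kern l) (\<Union>i. D i)) \<in> borel_measurable borel"
    unfolding eq by measurable
  ultimately show ?case by blast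
qed

text \<open>Agreement with \<open>psi\<close> is demanded on all of \<open>K\<close>, so that on
  this set \<open>psi\<close> may replace the kernel measure without spoiling additivity.\<close>

definition typical :: "real set"
  where "typical = {l. measure (kern l) UNIV = 1} \<inter> (\<Inter>B\<in>K. {l. measure (kern l) B = psi B l})"

lemma typical_borel: "typical \<in> sets borel"
  and typical_null: "E (UNIV - typical) x = 0"
proof -
  have "K \<noteq> {}"
    using K_atMost[of 0] by auto
  have [measurable]: "(\<lambda>l. measure (kern l) UNIV) \<in> borel_measurable borel"
    by (rule kern_form_UNIV)
  have BK: "(\<lambda>l. measure (kern l) B) \<in> borel_measurable borel" "psi B \<in> borel_measurable borel"
    if "B \<in> K" for B
    using that K_borel kern_form psi_measurable by blast+
  have set1: "{l. measure (kern l) B \<noteq> psi B l} \<in> sets borel" "{l. measure (kern l) B = psi B l} \<in> sets borel"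
    if "B \<in> K" for B
  proof -
    note [measurable] = BK[OF that]
    show "{l. measure (kern l) B \<noteq> psi B l} \<in> sets borel" "{l. measure (kern l) B = psi B l} \<in> sets borel"
      by measurable
  qed
  show "typical \<in> sets borel"
    unfolding typical_def using set1(2) \<open>K \<noteq> {}\<close> K_countable
    by (intro sets.Int sets.countable_INT') auto
  have 0: "E {l. measure (kern l) UNIV \<noteq> 1} x = 0" for x
  proof -
    have "E {l \<in> space borel. measure (kern l) UNIV \<noteq> 1} x = 0"
    proof (rule E.null_if_integral_eq)
      show "integrable (E.nu x) (\<lambda>l. measure (kern l) UNIV)" "integrable (E.nu x) (\<lambda>l. 1 :: real)" for x
        by (rule E.integrable_bounded; simp add: measure_kern_le_1)+
      show "(\<integral>l. measure (kern l) UNIV \<partial>E.nu x) = (\<integral>l. 1 \<partial>E.nu x)" for x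
        using E.measure_space_nu[of x] by (simp add: kern_form_UNIV F_total power2_norm_eq_inner)
    qed simp_all
    then show ?thesis by simp
  qed
  have 1: "E {l. measure (kern l) B \<noteq> psi B l} x = 0" if "B \<in> K" for B x
  proof -
    note [measurable] = BK[OF that]
    have "B \<in> sets borel"
      using K_borel that by blast
    have "E {l \<in> space borel. measure (kern l) B \<noteq> psi B l} x = 0"
    proof (rule E.null_if_integral_eq)
      show "integrable (E.nu x) (\<lambda>l. measure (kern l) B)" "integrable (E.nu x) (psi B)" for x
        by (rule E.integrable_bounded; simp add: measure_kern_le_1 psi_range)+
      show "(\<integral>l. measure (kern l) B \<partial>E.nu x) = (\<integral>l. psi B l \<partial>E.nu x)" for x
        using kern_form[OF \<open>B \<in> sets borel\<close>] psi_form[OF that, of x] by simp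
    qed simp_all
    then show ?thesis by simp
  qed
  have "UNIV - typical = (\<Union>i\<in>insert None (Some ` K). case i of
      None \<Rightarrow> {l. measure (kern l) UNIV \<noteq> 1} | Some B \<Rightarrow> {l. measure (kern l) B \<noteq> psi B l})"
    by (auto simp: typical_def)
  also have "E \<dots> x = 0"
    by (rule E.null_countable_Un) (use K_countable set1 0 1 in \<open>auto split: option.split\<close>)
  finally show "E (UNIV - typical) x = 0" .
qed

end

section \<open>Commutative measures are smearings of a spectral measure\<close>

context form_pvm
begin

context
  fixes S assumes S: "S \<in> sets M" and null: "\<And>x. E (space M - S) x = 0"
begin

lemma sets_restrict: "B \<in> sets (restrict_space M S) \<longleftrightarrow> B \<subseteq> S \<and> B \<in> sets M"
  using S by (auto simp: sets_restrict_space_iff)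

lemma form_pvm_restrict: "form_pvm (restrict_space M S) E"
proof
  have "S \<inter> space M = S"
    using sets.sets_into_space[OF S] by blast
  then show "E (space (restrict_space M S)) x = x" for x
    using compl[OF S, of x] null[of x] by (simp add: space_restrict_space)
  show "(\<lambda>n. inner (E (D n) x) x) sums inner (E (\<Union>n. D n) x) x"
    if "range D \<subseteq> sets (restrict_space M S)" "disjoint_family D" for D :: "nat \<Rightarrow> _" and x
    using that by (intro sums) (auto simp: sets_restrict)
qed (simp_all add: sets_restrict symmetric nonneg idem)

lemma form_measure_restrict:
  "form_measure (restrict_space M S) E x = restrict_space (nu x) S"
proof (rule measure_eqI)
  interpret R: form_pvm "restrict_space M S" E
    by (rule form_pvm_restrict)
  show "sets (form_measure (restrict_space M S) E x) = sets (restrict_space (nu x) S)"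
    by (simp add: sets_restrict_space)
  fix B assume "B \<in> sets (form_measure (restrict_space M S) E x)"
  then have B: "B \<in> sets (restrict_space M S)" "B \<subseteq> S" "B \<in> sets M"
    by (simp_all add: sets_restrict)
  have "S \<inter> space M \<in> sets M"
    using S by blast
  then show "emeasure (form_measure (restrict_space M S) E x) B = emeasure (restrict_space (nu x) S) B"
    using B by (simp add: R.emeasure_nu emeasure_nu emeasure_restrict_space)
qed

end

end

lemma has_op_integral_restrict:
  fixes E :: "real set \<Rightarrow> 'a :: complex_inner \<Rightarrow> 'a"
  assumes E: "form_pvm borel E" and S: "S \<in> sets borel"
    and G: "G \<in> sets borel" "G \<subseteq> S" "\<And>x. E (UNIV - G) x = 0"
    and T: "selfadjoint_op T"
    and int: "\<And>x. integrable (form_measure borel E x) f"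
    and form: "\<And>x. inner (T x) x = (\<integral>l. f l \<partial>form_measure borel E x)"
  shows "has_op_integral (restrict_space borel S) E G f T"
  unfolding has_op_integral_def
proof (intro conjI allI)
  interpret E: form_pvm borel E by (rule E)
  have null: "E (space borel - S) x = 0" for x
    by (rule E.null_subset[of _ "UNIV - G"]) (use G S in auto)
  show "bounded_clinear T"
    using T by (simp add: selfadjoint_op_def)
  fix x
  have eq: "(\<lambda>l. indicator S l *\<^sub>R indicator G l *\<^sub>R f l) = (\<lambda>l. indicator G l *\<^sub>R f l)"
    using G(2) by (auto simp: fun_eq_iff indicator_def)
  have SE: "S \<inter> space (E.nu x) \<in> sets (E.nu x)"
    using S by simp
  have int': "integrable (E.nu x) (\<lambda>l. indicator G l *\<^sub>R f l)"
    using G(1) by (intro integrable_mult_indicator int) simp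
  then show "set_integrable (scalar_measure (restrict_space borel S) E x) G f"
    unfolding scalar_measure_eq E.form_measure_restrict[OF S null] set_integrable_def
    by (simp only: integrable_restrict_space[OF SE] eq)
  have "(LINT l:G|scalar_measure (restrict_space borel S) E x. f l)
      = (\<integral>l. indicator G l *\<^sub>R f l \<partial>E.nu x)"
    unfolding scalar_measure_eq E.form_measure_restrict[OF S null] set_lebesgue_integral_def
    by (simp only: integral_restrict_space[OF SE] eq)
  also have "\<dots> = (\<integral>l. f l \<partial>E.nu x)"
  proof (rule integral_cong_AE)
    have "AE l in E.nu x. l \<in> G"
      using G by (intro E.AE_full) simp_all
    then show "AE l in E.nu x. indicator G l *\<^sub>R f l = f l"
      by eventually_elim simp
  qed (use int int' in \<open>blast dest: borel_measurable_integrable\<close>)+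
  finally show "cinner (T x) x = complex_of_real (LINT l:G|scalar_measure (restrict_space borel S) E x. f l)"
    by (simp add: selfadjoint_op_cinner_self[OF T] form)
qed

lemma AE_scalar_measure_restrict:
  assumes E: "form_pvm borel E" and S: "S \<in> sets borel"
    and G: "G \<in> sets borel" "G \<subseteq> S" "\<And>x. E (UNIV - G) x = 0"
  shows "AE l in scalar_measure (restrict_space borel S) E x. l \<in> G"
proof -
  interpret E: form_pvm borel E by (rule E)
  have null: "E (space borel - S) x = 0" for x
    by (rule E.null_subset[of _ "UNIV - G"]) (use G S in auto)
  have "AE l in E.nu x. l \<in> G"
    using G by (intro E.AE_full) simp_all
  moreover have "S \<inter> space (E.nu x) \<in> sets (E.nu x)"
    using S by simp
  ultimately show ?thesis
    unfolding scalar_measure_eq E.form_measure_restrict[OF S null]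
    by (auto simp: AE_restrict_space_iff)
qed

lemma povm_clinear: "povm M F \<Longrightarrow> B \<in> sets M \<Longrightarrow> F B (c *\<^sub>C x) = c *\<^sub>C F B x"
  by (auto simp: povm_def positive_op_iff selfadjoint_op_iff)

theorem ex_strong_markov_kernel:
  fixes F :: "real set \<Rightarrow> 'a::chilbert_space \<Rightarrow> 'a"
  assumes F: "normalized_povm borel F" and C: "commutative_povm borel F"
  shows "\<exists>A E \<mu> \<Gamma>.
        selfadjoint_op A \<and> spectral_measure_of A E \<and>
        spectrum A \<subseteq> complex_of_real ` {0..1} \<and>
        strong_markov_kernel \<mu> E \<Gamma> (real_spectrum A) \<and>
        (\<forall>\<Delta>\<in>rational_ring. continuous_on (real_spectrum A) (\<mu> \<Delta>)) \<and>
        (\<forall>\<Delta>\<in>sets borel.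
          has_op_integral (restrict_space borel (real_spectrum A)) E \<Gamma> (\<mu> \<Delta>) (F \<Delta>)) \<and>
        separates_points \<mu> \<Gamma>"
proof -
  have povm: "povm borel F" and F_UNIV: "F UNIV x = x" for x
    using F by (auto simp: normalized_povm_def)
  interpret F: form_povm borel F
    by (rule form_povm_if_povm[OF povm])
  have comm: "F B (F D x) = F D (F B x)" if "B \<in> sets borel" "D \<in> sets borel" for B D x
    using C that by (auto simp: commutative_povm_def fun_eq_iff)
  define W where "W = bicommutant F"
  interpret comm_ops W
    unfolding W_def by (rule comm_ops_bicommutant[OF F.symmetric comm])
  have FW: "F B \<in> W" if "B \<in> sets borel" for B
    unfolding W_def by (rule mem_bicommutant[where F = F and B = B, OF that F.symmetric[OF that]])
  have W_clinear: "T (c *\<^sub>C x) = c *\<^sub>C T x" if "T \<in> W" for T c x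
    using bicommutant_clinear[of F T c x] povm_clinear[OF povm] that by (simp add: W_def)
  have F_contr: "contraction (F B)" if B: "B \<in> sets borel" for B
  proof -
    have "inner (F B x) x \<le> (norm x)\<^sup>2" for x
    proof -
      interpret finite_measure "F.nu x" by (rule F.finite_measure_nu)
      have "measure (F.nu x) B \<le> measure (F.nu x) UNIV"
        using bounded_measure[of B] by simp
      then show ?thesis
        using B by (simp add: F.measure_nu F_UNIV power2_norm_eq_inner)
    qed
    then show ?thesis
      using FW[OF B] F.nonneg[OF B] by (simp add: contraction_def)
  qed
  \<comment> \<open>Members of the ring are bounded sets; the half-lines are adjoined to feed the
    distribution functions.\<close>
  define K where "K = rational_ring \<union> atMost ` \<rat>"
  have K_countable: "countable K"
    unfolding K_def by (intro countable_Un countable_rational_ring countable_image countable_rat)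
  have K_borel: "K \<subseteq> sets borel"
    using rational_ring_borel by (auto simp: K_def)
  \<comment> \<open>Makes the enumeration of \<open>K\<close> a bijection with the indices, so that
    every \<open>\<psi> n\<close> is \<open>psi\<close> of the set with index
    \<open>n\<close>.\<close>
  have "infinite K"
  proof (rule infinite_super)
    show "range (\<lambda>n :: nat. {..real n}) \<subseteq> K"
      by (auto simp: K_def)
    show "infinite (range (\<lambda>n :: nat. {..real n}))"
      by (rule range_inj_infinite) (auto simp: inj_def)
  qed
  have K_enum: "from_nat_into K n \<in> K" for n
    using \<open>infinite K\<close> by (intro from_nat_into) auto
  obtain A E \<psi> \<Gamma>0 where A: "contraction A" and E: "form_pvm borel E"
    and EW: "\<And>B. B \<in> sets borel \<Longrightarrow> E B \<in> W"
    and id: "\<And>x. integrable (form_measure borel E x) (\<lambda>l. l)"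
      "\<And>x. inner (A x) x = (\<integral>l. l \<partial>form_measure borel E x)"
    and \<psi>_meas: "\<And>n. \<psi> n \<in> borel_measurable borel"
    and \<psi>_range: "\<And>n l. 0 \<le> \<psi> n l" "\<And>n l. \<psi> n l \<le> 1"
    and \<psi>_cont: "\<And>n. continuous_on cantor (\<psi> n)"
    and \<psi>_form: "\<And>n x. inner (F (from_nat_into K n) x) x = (\<integral>l. \<psi> n l \<partial>form_measure borel E x)"
    and \<Gamma>0: "\<Gamma>0 \<in> sets borel" "\<And>x. E (UNIV - \<Gamma>0) x = 0" "\<Gamma>0 \<subseteq> cantor"
    and inj: "\<And>l l'. l \<in> \<Gamma>0 \<Longrightarrow> l' \<in> \<Gamma>0 \<Longrightarrow> (\<And>n. \<psi> n l = \<psi> n l') \<Longrightarrow> l = l'"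
    by (rule simultaneous_diagonalization[of "\<lambda>n. F (from_nat_into K n)"])
      (use F_contr K_enum K_borel in blast)+
  interpret spectral_rep W E A
    by (intro spectral_rep.intro spectral_rep_axioms.intro comm_ops_axioms E EW W_clinear id)
      (rule contractionD(1)[OF A])
  define psi where "psi B = \<psi> (to_nat_on K B)" for B
  have psi_form: "inner (F B x) x = (\<integral>l. psi B l \<partial>E.nu x)" if "B \<in> K" for B x
    using \<psi>_form[of "to_nat_on K B" x] that K_countable by (simp add: psi_def)
  interpret k: povm_kernel E F K psi
    by unfold_locales
      (use F_UNIV K_countable K_borel \<psi>_meas \<psi>_range psi_form in \<open>auto simp: K_def psi_def\<close>)
  define \<Lambda> where "\<Lambda> = real_spectrum A"
  have cantor_null: "E (UNIV - cantor) x = 0" for x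
    by (rule E.null_subset[of _ "UNIV - \<Gamma>0"])
      (use \<Gamma>0 borel_closed[OF closed_cantor] in auto)
  have \<Lambda>_cantor: "\<Lambda> \<subseteq> cantor"
    unfolding \<Lambda>_def by (rule real_spectrum_subset[OF closed_cantor cantor_null])
  have \<Lambda>: "\<Lambda> \<in> sets borel" "E (UNIV - \<Lambda>) x = 0" for x
    unfolding \<Lambda>_def by (rule real_spectrum_borel null_compl_spectrum)+
  \<comment> \<open>Three demands meet: \<open>\<Gamma>0\<close> separates points,
    \<open>\<Lambda>\<close> confines the kernel to the spectrum, \<open>k.typical\<close> provides
    probability measures.\<close>
  define \<Gamma> where "\<Gamma> = \<Gamma>0 \<inter> \<Lambda> \<inter> k.typical"
  have \<Gamma>: "\<Gamma> \<in> sets borel" "\<Gamma> \<subseteq> \<Lambda>"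
    using \<Gamma>0(1) \<Lambda>(1) k.typical_borel by (auto simp: \<Gamma>_def)
  have \<Gamma>_null: "E (UNIV - \<Gamma>) x = 0" for x
  proof -
    have "E (\<Union>X\<in>{\<Gamma>0, \<Lambda>, k.typical}. UNIV - X) x = 0"
      by (rule E.null_countable_Un) (use \<Gamma>0 \<Lambda> k.typical_borel k.typical_null in auto)
    also have "(\<Union>X\<in>{\<Gamma>0, \<Lambda>, k.typical}. UNIV - X) = UNIV - \<Gamma>"
      by (auto simp: \<Gamma>_def)
    finally show ?thesis .
  qed
  \<comment> \<open>The first branch holds for all \<open>l\<close>, which gives continuity on the
    whole spectrum; on \<Gamma>, a subset of \<open>k.typical\<close>, it coincides with the
    measure.\<close>
  define \<mu> where "\<mu> B l = (if B \<in> K then psi B l else if l \<in> \<Gamma> then measure (k.kern l) B else 0)" for B l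
  have \<mu>_\<Gamma>: "\<mu> B l = measure (k.kern l) B" if "l \<in> \<Gamma>" for B l
    using that by (auto simp: \<mu>_def \<Gamma>_def k.typical_def)
  have \<mu>_range: "0 \<le> \<mu> B l" "\<mu> B l \<le> 1" for B l
    by (auto simp: \<mu>_def psi_def \<psi>_range k.measure_kern_le_1)
  have \<mu>_meas: "\<mu> B \<in> borel_measurable borel" if "B \<in> sets borel" for B
  proof (cases "B \<in> K")
    case True
    then have "\<mu> B = \<psi> (to_nat_on K B)"
      by (simp add: \<mu>_def psi_def fun_eq_iff)
    then show ?thesis
      using \<psi>_meas by simp
  next
    case False
    then have "\<mu> B = (\<lambda>l. if l \<in> \<Gamma> then measure (k.kern l) B else 0)"
      by (simp add: \<mu>_def fun_eq_iff)
    then show ?thesis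
      using k.kern_form[OF that] \<Gamma>(1) by (simp add: measurable_If_set)
  qed
  have \<mu>_form: "inner (F B x) x = (\<integral>l. \<mu> B l \<partial>E.nu x)" if B: "B \<in> sets borel" for B x
  proof -
    have "AE l in E.nu x. l \<in> \<Gamma>"
      using \<Gamma> \<Gamma>_null by (intro E.AE_full) auto
    then have "AE l in E.nu x. \<mu> B l = measure (k.kern l) B"
      by eventually_elim (rule \<mu>_\<Gamma>)
    then have "(\<integral>l. \<mu> B l \<partial>E.nu x) = (\<integral>l. measure (k.kern l) B \<partial>E.nu x)"
      using \<mu>_meas[OF B] k.kern_form[OF B] by (intro integral_cong_AE) auto
    then show ?thesis
      using k.kern_form[OF B] by simp
  qed
  have \<mu>_int: "integrable (E.nu x) (\<mu> B)" if "B \<in> sets borel" for B x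
    by (rule E.integrable_bounded) (use \<mu>_meas[OF that] \<mu>_range in auto)
  have AE_\<Gamma>: "AE l in scalar_measure (restrict_space borel \<Lambda>) E x. l \<in> \<Gamma>" for x
    by (rule AE_scalar_measure_restrict[OF E \<Lambda>(1) \<Gamma> \<Gamma>_null])
  have \<mu>_sums: "(\<lambda>i. \<mu> (D i) l) sums \<mu> (\<Union>i. D i) l"
    if "l \<in> \<Gamma>" "range D \<subseteq> sets borel" "disjoint_family D" for D :: "nat \<Rightarrow> real set" and l
    using that finite_measure.finite_measure_UNION[OF k.finite_measure_kern, of D l]
    by (simp add: \<mu>_\<Gamma>)
  have \<mu>_UNIV: "\<mu> UNIV l = 1" if "l \<in> \<Gamma>" for l
    using that unfolding \<mu>_\<Gamma>[OF that] by (simp add: \<Gamma>_def k.typical_def)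
  have pvm: "pvm (restrict_space borel \<Lambda>) E"
    by (rule pvmI[OF E.form_pvm_restrict])
      (use \<Lambda> W_clinear[OF EW] in \<open>auto simp: E.sets_restrict\<close>)
  have E_\<Gamma>: "E \<Gamma> = id"
    using E.compl[OF \<Gamma>(1)] \<Gamma>_null by (simp add: fun_eq_iff)
  have weak: "weak_markov_kernel \<Lambda> E \<mu>"
    unfolding weak_markov_kernel_def Let_def
  proof (intro conjI ballI allI impI)
    fix x
    note AE = AE_\<Gamma>[of x]
    show "AE l in scalar_measure (restrict_space borel \<Lambda>) E x. \<mu> UNIV l = 1"
      using AE by eventually_elim (rule \<mu>_UNIV)
    show "AE l in scalar_measure (restrict_space borel \<Lambda>) E x. \<mu> {} l = 0"
      using AE by eventually_elim (simp add: \<mu>_\<Gamma>)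
    show "AE l in scalar_measure (restrict_space borel \<Lambda>) E x. (\<lambda>i. \<mu> (D i) l) sums \<mu> (\<Union>i. D i) l"
      if "range D \<subseteq> sets borel" "disjoint_family D" for D :: "nat \<Rightarrow> real set"
      using AE by eventually_elim (rule \<mu>_sums[OF _ that])
  qed (simp_all add: pvm \<mu>_range \<mu>_meas measurable_restrict_space1)
  have markov: "markov_kernel \<Gamma> \<mu>"
    unfolding markov_kernel_def
  proof (intro conjI ballI)
    fix l assume l: "l \<in> \<Gamma>"
    have "(\<lambda>B. ennreal (\<mu> B l)) = emeasure (k.kern l)"
      using finite_measure.emeasure_eq_measure[OF k.finite_measure_kern]
      by (simp add: \<mu>_\<Gamma>[OF l] fun_eq_iff)
    then show "measure_space UNIV (sets borel) (\<lambda>B. ennreal (\<mu> B l))"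
      using measure_space[of "k.kern l"] by simp
  qed (simp_all add: \<mu>_range \<mu>_meas \<mu>_UNIV measurable_restrict_space1)
  have "selfadjoint_op A"
    by (rule selfadjoint[OF AW])
  moreover have "spectral_measure_of A E"
    unfolding spectral_measure_of_def \<Lambda>_def[symmetric]
    using pvm has_op_integral_restrict[OF E \<Lambda>(1) \<Lambda>(1) order_refl \<Lambda>(2) selfadjoint[OF AW] id] by simp
  moreover have "spectrum A \<subseteq> complex_of_real ` {0..1}"
    unfolding spectrum_eq \<Lambda>_def[symmetric] using \<Lambda>_cantor cantor_subset by blast
  moreover have "strong_markov_kernel \<mu> E \<Gamma> (real_spectrum A)"
    unfolding strong_markov_kernel_def \<Lambda>_def[symmetric] using weak markov \<Gamma> E_\<Gamma> by blast
  moreover have "continuous_on (real_spectrum A) (\<mu> B)" if "B \<in> rational_ring" for B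
  proof -
    have "\<mu> B = \<psi> (to_nat_on K B)"
      using that by (simp add: \<mu>_def psi_def K_def fun_eq_iff)
    then show ?thesis
      using continuous_on_subset[OF \<psi>_cont \<Lambda>_cantor] by (simp add: \<Lambda>_def)
  qed
  moreover have "has_op_integral (restrict_space borel (real_spectrum A)) E \<Gamma> (\<mu> B) (F B)"
    if "B \<in> sets borel" for B
    unfolding \<Lambda>_def[symmetric]
    by (rule has_op_integral_restrict[OF E \<Lambda>(1) \<Gamma> \<Gamma>_null selfadjoint[OF FW[OF that]]
          \<mu>_int[OF that] \<mu>_form[OF that]])
  moreover have "separates_points \<mu> \<Gamma>"
    unfolding separates_points_def
  proof (intro ballI impI)
    fix l l' assume l: "l \<in> \<Gamma>" "l' \<in> \<Gamma>" "l \<noteq> l'"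
    then obtain n where n: "\<psi> n l \<noteq> \<psi> n l'"
      using inj[of l l'] by (auto simp: \<Gamma>_def)
    have "\<mu> (from_nat_into K n) = \<psi> n"
      using K_enum[of n] K_countable \<open>infinite K\<close>
      by (simp add: \<mu>_def psi_def fun_eq_iff)
    then show "\<exists>B\<in>sets borel. \<mu> B l \<noteq> \<mu> B l'"
      using n K_enum[of n] K_borel by (metis subsetD)
  qed
  ultimately show ?thesis
    by blast
qed


section \<open>Smearings of a spectral measure commute\<close>

context form_pvm
begin

text \<open>Equating sums of measures, rather than differences, keeps every term in
  \<open>ennreal\<close>, where the identity extends from sets to functions by monotone
  approximation.\<close>

lemma nn_integral_four:
  assumes f: "f \<in> borel_measurable M"
    and eq: "\<And>B. B \<in> sets M \<Longrightarrow>
      emeasure (nu a) B + emeasure (nu b) B = emeasure (nu c) B + emeasure (nu d) B"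
  shows "(\<integral>\<^sup>+ l. f l \<partial>nu a) + (\<integral>\<^sup>+ l. f l \<partial>nu b) = (\<integral>\<^sup>+ l. f l \<partial>nu c) + (\<integral>\<^sup>+ l. f l \<partial>nu d)"
  using f
proof (induction rule: borel_measurable_induct)
  case (cong f g)
  have "(\<integral>\<^sup>+ l. f l \<partial>nu x) = (\<integral>\<^sup>+ l. g l \<partial>nu x)" for x
    using cong(3) by (intro nn_integral_cong) simp
  with cong(4) show ?case by simp
next
  case (set B)
  then show ?case by (simp add: eq)
next
  case (mult u k)
  then show ?case
    by (simp add: nn_integral_cmult distrib_left[symmetric])
next
  case (add u v)
  have "(\<integral>\<^sup>+ l. v l + u l \<partial>nu x) = (\<integral>\<^sup>+ l. v l \<partial>nu x) + (\<integral>\<^sup>+ l. u l \<partial>nu x)" for x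
    using add by (intro nn_integral_add) simp_all
  then show ?case
    using arg_cong2[where f = "(+)", OF add.IH] by (simp only: ac_simps)
next
  case (seq U)
  have "(\<integral>\<^sup>+ l. (SUP i. U i l) \<partial>nu x) = (SUP i. \<integral>\<^sup>+ l. U i l \<partial>nu x)" for x
    using seq by (intro nn_integral_monotone_convergence_SUP) simp_all
  moreover have "incseq (\<lambda>i. \<integral>\<^sup>+ l. U i l \<partial>nu x)" for x
    using seq by (auto simp: incseq_def le_fun_def intro!: nn_integral_mono)
  ultimately show ?case
    using seq.IH by (simp add: SUP_apply[abs_def] flip: ennreal_SUP_add)
qed

lemma integral_four:
  assumes f: "\<And>x. integrable (nu x) (f :: 'b \<Rightarrow> real)"
    and eq: "\<And>B. B \<in> sets M \<Longrightarrow>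
      emeasure (nu a) B + emeasure (nu b) B = emeasure (nu c) B + emeasure (nu d) B"
  shows "(\<integral>l. f l \<partial>nu a) + (\<integral>l. f l \<partial>nu b) = (\<integral>l. f l \<partial>nu c) + (\<integral>l. f l \<partial>nu d)"
proof -
  have [measurable]: "f \<in> borel_measurable M"
    using borel_measurable_integrable[OF f] by simp
  define p n where "p x = (\<integral>\<^sup>+ l. ennreal (f l) \<partial>nu x)" and "n x = (\<integral>\<^sup>+ l. ennreal (- f l) \<partial>nu x)" for x
  have fin: "p x < top" "n x < top" for x
    using f[of x] by (simp_all add: real_integrable_def p_def n_def less_top)
  have int: "(\<integral>l. f l \<partial>nu x) = enn2real (p x) - enn2real (n x)" for x
    unfolding p_def n_def by (rule real_lebesgue_integral_def[OF f])
  have "p a + p b = p c + p d" "n a + n b = n c + n d"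
    unfolding p_def n_def by (rule nn_integral_four[OF _ eq]; simp)+
  then have "enn2real (p a) + enn2real (p b) = enn2real (p c) + enn2real (p d)"
    "enn2real (n a) + enn2real (n b) = enn2real (n c) + enn2real (n d)"
    by (simp_all add: enn2real_plus[symmetric] fin)
  then show ?thesis
    unfolding int by linarith
qed

text \<open>By polarization the commutation of \<open>S\<close> with the spectral projections is an identity between
  sums of scalar measures, which then holds for the integrals of \<open>f\<close> as well.\<close>

lemma op_integral_commute:
  assumes S: "symmetric_op S" and SE: "\<And>B x. B \<in> sets M \<Longrightarrow> S (E B x) = E B (S x)"
    and T: "symmetric_op T" and f: "\<And>x. integrable (nu x) f"
    and form: "\<And>x. inner (T x) x = (\<integral>l. f l \<partial>nu x)"
  shows "T (S x) = S (T x)"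
proof -
  have "inner (T (S x)) y = inner (S (T x)) y" for y
  proof -
    \<comment> \<open>Polarization at \<open>S x, y\<close> and at \<open>x, S y\<close>, with the
      negative terms moved to the other side.\<close>
    have "(\<integral>l. f l \<partial>nu (S x + y)) + (\<integral>l. f l \<partial>nu (x - S y)) =
        (\<integral>l. f l \<partial>nu (x + S y)) + (\<integral>l. f l \<partial>nu (S x - y))"
    proof (rule integral_four[OF f])
      fix B assume B: "B \<in> sets M"
      have "inner (E B (S x)) y = inner (E B x) (S y)"
        using SE[OF B, of x] symmetric_opD(2)[OF S, of "E B x" y] by simp
      then have "inner (E B (S x + y)) (S x + y) + inner (E B (x - S y)) (x - S y) =
          inner (E B (x + S y)) (x + S y) + inner (E B (S x - y)) (S x - y)"
        using symmetric_op_polarization[OF symmetric[OF B], of "S x" y]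
          symmetric_op_polarization[OF symmetric[OF B], of x "S y"] by linarith
      then show "emeasure (nu (S x + y)) B + emeasure (nu (x - S y)) B =
          emeasure (nu (x + S y)) B + emeasure (nu (S x - y)) B"
        using B nonneg[OF B] by (simp add: emeasure_nu flip: ennreal_plus)
    qed
    then have "4 * inner (T (S x)) y = 4 * inner (T x) (S y)"
      using symmetric_op_polarization[OF T, of "S x" y] symmetric_op_polarization[OF T, of x "S y"]
      unfolding form by linarith
    then show ?thesis
      using symmetric_opD(2)[OF S, of "T x" y] by simp
  qed
  then show ?thesis
    by (metis vector_eq_rdot)
qed

end

text \<open>\<open>op_integral_commute\<close> is used twice: with a spectral projection as
  \<open>S\<close> it shows that each \<open>F B\<close> commutes with \<open>E\<close>, and then,
  with \<open>F C\<close> as \<open>S\<close>, that the values of \<open>F\<close> commute with each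
  other.\<close>

theorem commutative_if_op_integral:
  assumes F: "povm N F" and E: "pvm M E"
    and int: "\<And>B. B \<in> sets N \<Longrightarrow> has_op_integral M E G (\<mu> B) (F B)"
  shows "commutative_povm N F"
  unfolding commutative_povm_def
proof (intro conjI ballI F)
  interpret E: form_pvm M E
    by (rule form_pvm_if_pvm[OF E])
  interpret F: form_povm N F
    by (rule form_povm_if_povm[OF F])
  have f: "integrable (E.nu x) (\<lambda>l. indicator G l *\<^sub>R \<mu> B l)"
    and form: "inner (F B x) x = (\<integral>l. indicator G l *\<^sub>R \<mu> B l \<partial>E.nu x)"
    if "B \<in> sets N" for B x
    using int[OF that]
    by (auto simp: has_op_integral_def scalar_measure_eq set_integrable_def
        set_lebesgue_integral_def inner_eq_Re_cinner)
  have FE: "F B (E D x) = E D (F B x)" if "B \<in> sets N" "D \<in> sets M" for B D x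
    by (rule E.op_integral_commute[OF E.symmetric[OF that(2)] E.commute[OF that(2)]
          F.symmetric[OF that(1)] f[OF that(1)] form[OF that(1)]])
  fix B C assume B: "B \<in> sets N" and C: "C \<in> sets N"
  have "F B (F C x) = F C (F B x)" for x
    by (rule E.op_integral_commute[OF F.symmetric[OF C] FE[OF C] F.symmetric[OF B] f[OF B] form[OF B]])
  then show "F B \<circ> F C = F C \<circ> F B"
    unfolding fun_eq_iff comp_def by blast
qed


section \<open>The Feller property\<close>

lemma empty_mem_rational_ring: "{} \<in> rational_ring"
  unfolding rational_ring_def hull_def
  by (auto intro: semiring_of_sets.empty_sets ring_of_sets.axioms(1))

text \<open>Continuity from below along an exhaustion \<open>I\<close> of \<open>U\<close>; the
  end-points of \<open>I n\<close> may be irrational, so it is enlarged to a rational interval still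
  inside \<open>U\<close>.\<close>

lemma ex_rational_interval:
  fixes M :: "real measure"
  assumes M: "finite_measure M" "sets M = sets borel"
    and I: "incseq I" "(\<Union>n :: nat. I n) = U" "\<And>n. I n \<in> sets borel"
    and inner: "\<And>n. \<exists>a\<in>\<rat>. \<exists>b\<in>\<rat>. I n \<subseteq> {a<..<b} \<and> {a<..<b} \<subseteq> U"
    and c: "c < measure M U"
  shows "\<exists>J\<in>rational_ring. J \<subseteq> U \<and> c < measure M J"
proof -
  interpret finite_measure M by (rule M)
  have "(\<lambda>n. measure M (I n)) \<longlonglongrightarrow> measure M (\<Union>n. I n)"
    using I M(2) by (intro finite_Lim_measure_incseq) auto
  then have "\<forall>\<^sub>F n in sequentially. c < measure M (I n)"
    using c unfolding I(2) by (rule order_tendstoD(1))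
  then obtain n where n: "c < measure M (I n)"
    by (auto simp: eventually_sequentially)
  obtain a b where ab: "a \<in> \<rat>" "b \<in> \<rat>" "I n \<subseteq> {a<..<b}" "{a<..<b} \<subseteq> U"
    using inner by blast
  have "measure M (I n) \<le> measure M {a<..<b}"
    using ab M(2) by (intro finite_measure_mono) auto
  moreover have "{a<..<b} \<in> rational_ring"
    using ab empty_mem_rational_ring by (cases "a < b") (auto intro: rational_interval_mem_ring)
  ultimately show ?thesis
    using n ab(4) by (intro bexI[of _ "{a<..<b}"]) auto
qed

lemma ex_rational_interval_lessThan:
  fixes M :: "real measure"
  assumes "finite_measure M" "sets M = sets borel" "c < measure M {..<x}"
  shows "\<exists>J\<in>rational_ring. J \<subseteq> {..<x} \<and> c < measure M J"
proof (rule ex_rational_interval[OF assms(1,2) _ _ _ _ assms(3)])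
  let ?I = "\<lambda>n. {- real n<..<x - 1 / real (Suc n)}"
  show "incseq ?I"
    by (auto simp: incseq_def frac_le intro!: greaterThanLessThan_subseteq_greaterThanLessThan[THEN iffD2])
  show "(\<Union>n. ?I n) = {..<x}"
  proof (intro set_eqI iffI)
    fix r assume "r \<in> {..<x}"
    then obtain n m where n: "1 / real (Suc n) < x - r" and m: "\<bar>r\<bar> < real m"
      using reals_Archimedean[of "x - r"] reals_Archimedean2[of "\<bar>r\<bar>"]
      by (auto simp: inverse_eq_divide)
    have "1 / real (Suc (max n m)) \<le> 1 / real (Suc n)"
      by (intro frac_le) auto
    with n m show "r \<in> (\<Union>n. ?I n)"
      by (intro UN_I[of "max n m"]) (auto simp del: of_nat_Suc)
  next
    fix r assume "r \<in> (\<Union>n. ?I n)"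
    then obtain n where "r < x - 1 / real (Suc n)"
      by auto
    moreover have "0 < 1 / real (Suc n)"
      by simp
    ultimately show "r \<in> {..<x}"
      unfolding lessThan_iff by linarith
  qed
  show "\<exists>a\<in>\<rat>. \<exists>b\<in>\<rat>. ?I n \<subseteq> {a<..<b} \<and> {a<..<b} \<subseteq> {..<x}" for n
  proof -
    obtain b where "b \<in> \<rat>" "x - 1 / real (Suc n) < b" "b < x"
      using Rats_dense_in_real[of "x - 1 / real (Suc n)" x] by auto
    then show ?thesis
      by (intro bexI[of _ "- real n"] bexI[of _ b]) auto
  qed
qed simp

lemma ex_rational_interval_greaterThan:
  fixes M :: "real measure"
  assumes "finite_measure M" "sets M = sets borel" "c < measure M {x<..}"
  shows "\<exists>J\<in>rational_ring. J \<subseteq> {x<..} \<and> c < measure M J"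
proof (rule ex_rational_interval[OF assms(1,2) _ _ _ _ assms(3)])
  let ?I = "\<lambda>n. {x + 1 / real (Suc n)<..<real n}"
  show "incseq ?I"
    by (auto simp: incseq_def frac_le intro!: greaterThanLessThan_subseteq_greaterThanLessThan[THEN iffD2])
  show "(\<Union>n. ?I n) = {x<..}"
  proof (intro set_eqI iffI)
    fix r assume "r \<in> {x<..}"
    then obtain n m where n: "1 / real (Suc n) < r - x" and m: "\<bar>r\<bar> < real m"
      using reals_Archimedean[of "r - x"] reals_Archimedean2[of "\<bar>r\<bar>"]
      by (auto simp: inverse_eq_divide)
    have "1 / real (Suc (max n m)) \<le> 1 / real (Suc n)"
      by (intro frac_le) auto
    with n m show "r \<in> (\<Union>n. ?I n)"
      by (intro UN_I[of "max n m"]) (auto simp del: of_nat_Suc)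
  next
    fix r assume "r \<in> (\<Union>n. ?I n)"
    then obtain n where "x + 1 / real (Suc n) < r"
      by auto
    moreover have "0 < 1 / real (Suc n)"
      by simp
    ultimately show "r \<in> {x<..}"
      unfolding greaterThan_iff by linarith
  qed
  show "\<exists>a\<in>\<rat>. \<exists>b\<in>\<rat>. ?I n \<subseteq> {a<..<b} \<and> {a<..<b} \<subseteq> {x<..}" for n
  proof -
    obtain a where "a \<in> \<rat>" "x < a" "a < x + 1 / real (Suc n)"
      using Rats_dense_in_real[of x "x + 1 / real (Suc n)"] by auto
    then show ?thesis
      by (intro bexI[of _ a] bexI[of _ "real n"]) auto
  qed
qed simp

text \<open>Ring members inside an open set give lower bounds for its mass. The upper bound for
  \<open>cdf (M n) x\<close> is therefore obtained as a lower bound for the mass of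
  \<open>{x<..}\<close>, turned around by the total mass 1.\<close>

lemma weak_conv_rational_ring:
  assumes M: "\<And>n. real_distribution (M n)" and N: "real_distribution N"
    and lim: "\<And>J. J \<in> rational_ring \<Longrightarrow> (\<lambda>n. measure (M n) J) \<longlonglongrightarrow> measure N J"
  shows "weak_conv_m M N"
  unfolding weak_conv_m_def weak_conv_def
proof (intro allI impI)
  interpret N: real_distribution N by (rule N)
  interpret M: real_distribution "M n" for n by (rule M)
  have ring: "J \<in> sets borel" if "J \<in> rational_ring" for J
    using that rational_ring_borel by blast
  fix x assume cont: "isCont (cdf N) x"
  show "(\<lambda>n. cdf (M n) x) \<longlonglongrightarrow> cdf N x"
  proof (rule order_tendstoI)
    fix c assume c: "c < cdf N x"
    have "measure N {..x} = measure N {..<x} + measure N {x}"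
      by (subst N.finite_measure_Union[symmetric]) (auto intro!: arg_cong[where f = "measure N"])
    \<comment> \<open>Continuity of the distribution function enters here: without an atom at
      \<open>x\<close> the open half-line, which can be exhausted from inside, carries all of
      \<open>cdf N x\<close>.\<close>
    moreover have "measure N {x} = 0"
      using cont by (simp add: N.isCont_cdf)
    ultimately have "c < measure N {..<x}"
      using c by (simp add: cdf_def)
    then obtain J where J: "J \<in> rational_ring" "J \<subseteq> {..<x}" "c < measure N J"
      using ex_rational_interval_lessThan[OF N.finite_measure_axioms N.events_eq_borel] by blast
    have "measure (M n) J \<le> cdf (M n) x" for n
      unfolding cdf_def using J(2) ring[OF J(1)] by (intro M.finite_measure_mono) auto
    then show "\<forall>\<^sub>F n in sequentially. c < cdf (M n) x"
      using order_tendstoD(1)[OF lim[OF J(1)] J(3)] by (auto elim!: eventually_mono intro: less_le_trans)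
  next
    fix u assume u: "cdf N x < u"
    have compl: "measure P {x<..} = 1 - cdf P x" if "real_distribution P" for P
    proof -
      interpret P: real_distribution P by (rule that)
      have "UNIV - {..x} = {x<..}"
        by auto
      then show ?thesis
        using P.prob_compl[of "{..x}"] by (simp add: cdf_def)
    qed
    have "1 - u < measure N {x<..}"
      using u by (simp add: compl[OF N])
    then obtain J where J: "J \<in> rational_ring" "J \<subseteq> {x<..}" "1 - u < measure N J"
      using ex_rational_interval_greaterThan[OF N.finite_measure_axioms N.events_eq_borel] by blast
    have "measure (M n) J \<le> 1 - cdf (M n) x" for n
      unfolding compl[OF M, symmetric] using J(2) ring[OF J(1)] by (intro M.finite_measure_mono) auto
    then show "\<forall>\<^sub>F n in sequentially. cdf (M n) x < u"
      using order_tendstoD(1)[OF lim[OF J(1)] J(3)]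
      by (elim eventually_mono) (smt (verit))
  qed
qed

lemma kernel_measure:
  assumes "markov_kernel \<Lambda> \<mu>" "l \<in> \<Lambda>"
  shows "real_distribution (kernel_measure \<mu> l)"
    "B \<in> sets borel \<Longrightarrow> measure (kernel_measure \<mu> l) B = \<mu> B l"
proof -
  have ms: "measure_space UNIV (sets borel) (\<lambda>B. ennreal (\<mu> B l))" and one: "\<mu> UNIV l = 1"
    and nn: "\<And>B. B \<in> sets borel \<Longrightarrow> 0 \<le> \<mu> B l"
    using assms by (auto simp: markov_kernel_def)
  have sets: "sets (kernel_measure \<mu> l) = sets borel" and space: "space (kernel_measure \<mu> l) = UNIV"
    using sets.sigma_sets_eq[of borel] by (simp_all add: kernel_measure_def sets_measure_of space_measure_of)
  have em: "emeasure (kernel_measure \<mu> l) B = ennreal (\<mu> B l)" if "B \<in> sets borel" for B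
    unfolding kernel_measure_def
    by (rule emeasure_measure_of_sigma) (use ms that in \<open>auto simp: measure_space_def\<close>)
  show "measure (kernel_measure \<mu> l) B = \<mu> B l" if "B \<in> sets borel"
    using that by (simp add: measure_def em nn)
  have "prob_space (kernel_measure \<mu> l)"
    by (rule prob_spaceI) (simp add: space em one)
  then show "real_distribution (kernel_measure \<mu> l)"
    using sets by (simp add: real_distribution_def real_distribution_axioms_def)
qed

text \<open>Along a sequence in \<Gamma>, continuity on the ring means convergence of the kernel
  measures on ring members, hence weak convergence, which passes to integrals of bounded continuous
  functions.\<close>

theorem feller_if_continuous_on_ring:
  assumes mk: "markov_kernel \<Gamma> \<mu>"
    and cont: "\<And>J. J \<in> rational_ring \<Longrightarrow> continuous_on \<Gamma> (\<mu> J)"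
  shows "feller_markov_kernel \<Gamma> \<mu>"
  unfolding feller_markov_kernel_def
proof (intro conjI allI impI mk)
  fix f :: "real \<Rightarrow> real"
  assume f: "continuous_on UNIV f" and bdd: "bounded (range f)"
  then obtain B where B: "\<And>x. norm (f x) \<le> B"
    by (auto simp: bounded_iff)
  have [measurable]: "f \<in> borel_measurable borel"
    by (rule borel_measurable_continuous_onI[OF f])
  show "bounded ((\<lambda>l. LINT t|kernel_measure \<mu> l. f t) ` \<Gamma>)"
    unfolding bounded_iff
  proof (intro exI ballI)
    fix y assume "y \<in> (\<lambda>l. LINT t|kernel_measure \<mu> l. f t) ` \<Gamma>"
    then obtain l where l: "l \<in> \<Gamma>" "y = (LINT t|kernel_measure \<mu> l. f t)"
      by blast
    interpret real_distribution "kernel_measure \<mu> l"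
      by (rule kernel_measure[OF mk l(1)])
    have "norm y \<le> (LINT t|kernel_measure \<mu> l. norm (f t))"
      unfolding l(2) by (rule integral_norm_bound)
    also have "\<dots> \<le> (LINT t|kernel_measure \<mu> l. B)"
      by (rule integral_mono[OF integrable_const_bound[where B = B]]) (use B in simp_all)
    finally show "norm y \<le> B"
      using prob_space by simp
  qed
  show "continuous_on \<Gamma> (\<lambda>l. LINT t|kernel_measure \<mu> l. f t)"
    unfolding continuous_on_sequentially comp_def
  proof (intro ballI allI impI)
    fix l u assume l: "l \<in> \<Gamma>" and u: "(\<forall>n. u n \<in> \<Gamma>) \<and> u \<longlonglongrightarrow> l"
    then have u': "u n \<in> \<Gamma>" for n
      by blast
    show "(\<lambda>n. LINT t|kernel_measure \<mu> (u n). f t) \<longlonglongrightarrow> (LINT t|kernel_measure \<mu> l. f t)"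
    proof (rule weak_conv_imp_integral_bdd_continuous_conv[where B = B])
      show "weak_conv_m (\<lambda>n. kernel_measure \<mu> (u n)) (kernel_measure \<mu> l)"
      proof (rule weak_conv_rational_ring)
        fix J assume J: "J \<in> rational_ring"
        then have "J \<in> sets borel"
          using rational_ring_borel by blast
        then show "(\<lambda>n. measure (kernel_measure \<mu> (u n)) J) \<longlonglongrightarrow> measure (kernel_measure \<mu> l) J"
          using cont[OF J] l u u' unfolding continuous_on_sequentially comp_def
          by (simp add: kernel_measure(2)[OF mk])
      qed (rule kernel_measure(1)[OF mk] l u')+
      show "isCont f x" for x
        using f by (simp add: continuous_on_eq_continuous_at)
    qed (rule kernel_measure(1)[OF mk] l u' B)+
  qed
qed

theorem theorem4p3:
  fixes F :: "real set \<Rightarrow> 'a::chilbert_space \<Rightarrow> 'a"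
  assumes "normalized_povm borel F"
  shows
    "(commutative_povm borel F \<longleftrightarrow>
      (\<exists>A E \<mu> \<Gamma>.
        selfadjoint_op A \<and> spectral_measure_of A E \<and>
        spectrum A \<subseteq> complex_of_real ` {0..1} \<and>
        strong_markov_kernel \<mu> E \<Gamma> (real_spectrum A) \<and>
        (\<forall>\<Delta>\<in>rational_ring. continuous_on (real_spectrum A) (\<mu> \<Delta>)) \<and>
        (\<forall>\<Delta>\<in>sets borel.
          has_op_integral (restrict_space borel (real_spectrum A)) E \<Gamma> (\<mu> \<Delta>) (F \<Delta>)) \<and>
        separates_points \<mu> \<Gamma>)) \<and>
     (\<forall>A E \<mu> \<Gamma>.
        selfadjoint_op A \<and> spectral_measure_of A E \<and>
        spectrum A \<subseteq> complex_of_real ` {0..1} \<and>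
        strong_markov_kernel \<mu> E \<Gamma> (real_spectrum A) \<and>
        (\<forall>\<Delta>\<in>rational_ring. continuous_on (real_spectrum A) (\<mu> \<Delta>)) \<and>
        (\<forall>\<Delta>\<in>sets borel.
          has_op_integral (restrict_space borel (real_spectrum A)) E \<Gamma> (\<mu> \<Delta>) (F \<Delta>)) \<and>
        separates_points \<mu> \<Gamma> \<longrightarrow>
        feller_markov_kernel \<Gamma> \<mu>)"
proof -
  have "normalized_povm borel F"
    by (rule assms)
  then have "povm borel F"
    by (simp add: normalized_povm_def)
  have feller: "feller_markov_kernel \<Gamma> \<mu>"
    if "strong_markov_kernel \<mu> E \<Gamma> \<Lambda>" "\<forall>\<Delta>\<in>rational_ring. continuous_on \<Lambda> (\<mu> \<Delta>)"
    for E :: "real set \<Rightarrow> 'a \<Rightarrow> 'a" and \<mu> \<Gamma> \<Lambda>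
    using that unfolding strong_markov_kernel_def
    by (blast intro: feller_if_continuous_on_ring continuous_on_subset)
  have "commutative_povm borel F"
    if "spectral_measure_of A E"
      "\<forall>\<Delta>\<in>sets borel. has_op_integral (restrict_space borel (real_spectrum A)) E \<Gamma> (\<mu> \<Delta>) (F \<Delta>)"
    for A E \<mu> \<Gamma>
    using that \<open>povm borel F\<close> unfolding spectral_measure_of_def
    by (blast intro: commutative_if_op_integral)
  with ex_strong_markov_kernel[OF assms] feller show ?thesis
    by blast
qed

end
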